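(* Let $(\mathscr{C},\mathbf{W})$ satisfy conditions (BF), fix a set of choices $\mathrm{C}(\mathbf{W})$, and consider the six morphisms of $\mathscr{C}[\mathbf{W}^{-1}]$ $$\underline f=(A',u,f):A\to B,\quad \underline g=(B',v,g):B\to C,\quad \underline h=(C',w,h):C\to D,$$ $$\underline f'=(A',u\circ\mathrm{id}_{A'},f\circ\mathrm{id}_{A'}),\quad \underline g'=(B',v\circ\mathrm{id}_{B'},g\circ\mathrm{id}_{B'}),\quad \underline h'=(C',w\circ\mathrm{id}_{C'},h\circ\mathrm{id}_{C'}).$$ Then the associator $\Theta^{\mathscr{C},\mathbf{W}}_{\underline h,\underline g,\underline f}:\underline h\circ(\underline g\circ\underline f)\Rightarrow(\underline h\circ\underline g)\circ\underline f$ is equal to the vertical composition in $\mathscr{C}[\mathbf{W}^{-1}]$ of $$\underline h\circ(\underline g\circ\underline f)\xRightarrow{\ \chi(\underline h)^{-1}\circ(\chi(\underline g)^{-1}\circ\chi(\underline f)^{-1})\ }\underline h'\circ(\underline g'\circ\underline f')\xRightarrow{\ \Theta^{\mathscr{C},\mathbf{W}}_{\underline h',\underline g',\underline f'}\ }(\underline h'\circ\underline g')\circ\underline f'\xRightarrow{\ (\chi(\underline h)\circ\chi(\underline g))\circ\chi(\underline f)\ }(\underline h\circ\underline g)\circ\underline f.$$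
   Context: Conventions. $\mathscr{C}$ is a bicategory (not assumed to be a 2-category), $\mathbf{W}$ a class of 1-morphisms in it, $\pi_a:a\circ\mathrm{id}_A\Rightarrow a$ the right unitor of $\mathscr{C}$ for $a:A\to B$. $\circ$ denotes composition of 1-morphisms and whiskering/horizontal composition; $\bullet$ denotes vertical composition of 2-morphisms of $\mathscr{C}$ ($\beta\bullet\alpha$ means first $\alpha$, then $\beta$). In the formulas below associators (and, where not written, unitors) of $\mathscr{C}$ are to be inserted in the unique way allowed by coherence; 1-morphisms $a\circ\mathrm{id}$ and $a$ are however not identified. For a morphism $\underline f=(A',u,f)$ of $\mathscr{C}[\mathbf{W}^{-1}]$, with $\underline f'=(A',u\circ\mathrm{id}_{A'},f\circ\mathrm{id}_{A'})$, the invertible 2-morphism $\chi(\underline f):\underline f'\Rightarrow\underline f$ is the class $[A',\mathrm{id}_{A'},\mathrm{id}_{A'},\pi_u\circ\mathrm{id}_{A'},\pi_f\circ\mathrm{id}_{A'}]$; analogously $\chi(\underline g)$ and $\chi(\underline h)$ (using $\pi_v,\pi_g$ and $\pi_w,\pi_h$). Conditions (BF): (BF1) every $\mathrm{id}_A$ is in $\mathbf{W}$. (BF2) $\mathbf{W}$ is closed under composition. (BF3) For every $w:A\to B$ in $\mathbf{W}$ and every $f:C\to B$ there are an object $D$, $w':D\to C$ in $\mathbf{W}$, $f':D\to A$ and an invertible 2-morphism $f\circ w'\Rightarrow w\circ f'$. (BF4a) For every $w:B\to A$ in $\mathbf{W}$, $f^1,f^2:C\to B$ and $\alpha:w\circ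 f^1\Rightarrow w\circ f^2$ there are an object $D$, $v:D\to C$ in $\mathbf{W}$ and $\beta:f^1\circ v\Rightarrow f^2\circ v$ with $\alpha\circ v=w\circ\beta$. (BF4b) If $\alpha$ in (BF4a) is invertible, so is $\beta$. (BF4c) If $(D',v',\beta')$ is another triple with the same properties as $(D,v,\beta)$ in (BF4a), there are an object $E$, $u:E\to D$, $u':E\to D'$ and an invertible $\zeta:v\circ u\Rightarrow v'\circ u'$ with $v\circ u\in\mathbf{W}$ and $(\beta'\circ u')\bullet(f^1\circ\zeta)=(f^2\circ\zeta)\bullet(\beta\circ u)$. (BF5) If $w:A\to B$ is in $\mathbf{W}$ and there is an invertible $v\Rightarrow w$, then $v\in\mathbf{W}$. $\mathrm{C}(\mathbf{W})$: for every $f:A'\to B$ and $v:B'\to B$ in $\mathbf{W}$, a chosen $(A'',v',f',\rho)$ with $v':A''\to A'$ in $\mathbf{W}$, $f':A''\to B'$, $\rho:f\circ v'\Rightarrow v\circ f'$ invertible. Bicategory of fractions $\mathscr{C}[\mathbf{W}^{-1}]$ (Pronk). Objects: those of $\mathscr{C}$. A morphism $A\to B$ is a triple $(A',w,f)$ with $w:A'\to A$ in $\mathbf{W}$, $f:A'\to B$. Composition: $(B',v,g)\circ(A',w,f):=(A'',w\circ v',g\circ f')$ with $(A'',v',f',\rho)$ the choice in $\mathrm{C}(\mathbf{W})$ for $(f,v)$. A 2-morphism $(A^1,w^1,f^1)\Rightarrow(A^2,w^2,f^2)$ is a class $[A^3,v^1,v^2,\alpha,\beta]$ with $v^m:A^3\to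 A^m$, $w^1\circ v^1\in\mathbf{W}$, $\alpha:w^1\circ v^1\Rightarrow w^2\circ v^2$ invertible, $\beta:f^1\circ v^1\Rightarrow f^2\circ v^2$; $(A^3,v^1,v^2,\alpha,\beta)$ and $(A'^3,v'^1,v'^2,\alpha',\beta')$ are equivalent iff there are $z:A^4\to A^3$, $z':A^4\to A'^3$ and invertible $\sigma^1:v'^1\circ z'\Rightarrow v^1\circ z$, $\sigma^2:v^2\circ z\Rightarrow v'^2\circ z'$ with $w^1\circ v^1\circ z\in\mathbf{W}$, $(w^2\circ\sigma^2)\bullet(\alpha\circ z)\bullet(w^1\circ\sigma^1)=\alpha'\circ z'$ and $(f^2\circ\sigma^2)\bullet(\beta\circ z)\bullet(f^1\circ\sigma^1)=\beta'\circ z'$. The remaining structure is computed as follows (in each case auxiliary data of the indicated kind exist and the result does not depend on them nor on the representatives): Vertical composition of $[A^4,u^1,u^2,\alpha^1,\beta^1]:(A^1,w^1,f^1)\Rightarrow(A^2,w^2,f^2)$ followed by $[A^5,u^3,u^4,\alpha^2,\beta^2]:(A^2,w^2,f^2)\Rightarrow(A^3,w^3,f^3)$: data $t^1:C\to A^4$ in $\mathbf{W}$, $t^2:C\to A^5$, $\rho:u^2\circ t^1\Rightarrow u^3\circ t^2$ invertible; the composite is the class of $(C,u^1\circ t^1,u^4\circ t^2,(\alpha^2\circ t^2)\bullet(w^2\circ\rho)\bullet(\alpha^1\circ t^1),(\beta^2\circ t^2)\bullet(f^2\circ\rho)\bullet(\beta^1\circ t^1))$. $\Delta\circ\underline f$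 for $\underline f=(A',w,f):A\to B$ and $\Delta=[B^3,u^1,u^2,\alpha,\beta]:(B^1,v^1,g^1)\Rightarrow(B^2,v^2,g^2)$: let $(D^m,w^m,f^m,\rho^m)$ be the choice in $\mathrm{C}(\mathbf{W})$ for $(f,v^m)$. Data: $t^1:D^3\to D^1$, $t^2:D^4\to D^2$ in $\mathbf{W}$, $h^1:D^3\to B^3$, $h^2:D^4\to B^3$, invertible $\sigma^m:f^m\circ t^m\Rightarrow u^m\circ h^m$; $t^3:D^5\to D^3$ in $\mathbf{W}$, $t^4:D^5\to D^4$, invertible $\varphi:w^1\circ t^1\circ t^3\Rightarrow w^2\circ t^2\circ t^4$; invertible $\delta:h^1\circ t^3\Rightarrow h^2\circ t^4$ with $v^1\circ u^1\circ\delta=(\alpha^{-1}\circ h^2\circ t^4)\bullet(v^2\circ\sigma^2\circ t^4)\bullet(\rho^2\circ t^2\circ t^4)\bullet(f\circ\varphi)\bullet((\rho^1)^{-1}\circ t^1\circ t^3)\bullet(v^1\circ(\sigma^1)^{-1}\circ t^3)$. Then $\Delta\circ\underline f$ is the class of $(D^5,t^1\circ t^3,t^2\circ t^4,w\circ\varphi,\xi)$ with $\xi=(g^2\circ(\sigma^2)^{-1}\circ t^4)\bullet(\beta\circ h^2\circ t^4)\bullet(g^1\circ u^1\circ\delta)\bullet(g^1\circ\sigma^1\circ t^3)$. $\underline g\circ\Gamma$ for $\underline g=(B',u,g):B\to C$ and $\Gamma=[A^3,v^1,v^2,\alpha,\beta]:(A^1,w^1,f^1)\Rightarrow(A^2,w^2,f^2)$: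 let $(D^m,u^m,h^m,\rho^m)$ be the choice for $(f^m,u)$. Data: $u^3:D^3\to A^3$, $u^5:D^4\to A^3$ in $\mathbf{W}$, $u^4:D^3\to D^1$, $u^6:D^4\to D^2$, invertible $\eta^1:v^1\circ u^3\Rightarrow u^1\circ u^4$, $\eta^2:v^2\circ u^5\Rightarrow u^2\circ u^6$; $u^7:D^5\to D^3$ in $\mathbf{W}$, $u^8:D^5\to D^4$, invertible $\eta^3:u^3\circ u^7\Rightarrow u^5\circ u^8$; $\lambda:h^1\circ u^4\circ u^7\Rightarrow h^2\circ u^6\circ u^8$ with $u\circ\lambda=(\rho^2\circ u^6\circ u^8)\bullet(f^2\circ\eta^2\circ u^8)\bullet(f^2\circ v^2\circ\eta^3)\bullet(\beta\circ u^3\circ u^7)\bullet(f^1\circ(\eta^1)^{-1}\circ u^7)\bullet((\rho^1)^{-1}\circ u^4\circ u^7)$. Then $\underline g\circ\Gamma$ is the class of $(D^5,u^4\circ u^7,u^6\circ u^8,\mu,g\circ\lambda)$ with $\mu=(w^2\circ\eta^2\circ u^8)\bullet(w^2\circ v^2\circ\eta^3)\bullet(\alpha\circ u^3\circ u^7)\bullet(w^1\circ(\eta^1)^{-1}\circ u^7)$. Horizontal composition: for $\Gamma:\underline f^1\Rightarrow\underline f^2$ and $\Delta:\underline g^1\Rightarrow\underline g^2$ composable, $\Delta\circ\Gamma$ is the vertical composite of $\underline g^1\circ\Gamma$ followed by $\Delta\circ\underline f^2$. Associator for $\underline f=(A',u,f)$, $\underline g=(B',v,g)$, $\underline h=(C',w,h)$: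 let $(A^1,u^1,f^1,\delta)$, $(A^2,u^2,l,\sigma)$, $(B^2,v^1,g^1,\xi)$, $(A^3,u^3,f^2,\eta)$ be the choices in $\mathrm{C}(\mathbf{W})$ for $(f,v)$, $(g\circ f^1,w)$, $(g,w)$, $(f,v\circ v^1)$. Data: $u^4:A^4\to A^2$ with $u\circ u^1\circ u^2\circ u^4\in\mathbf{W}$, $u^5:A^4\to A^3$, invertible $\gamma:u^1\circ u^2\circ u^4\Rightarrow u^3\circ u^5$, $\omega:f^1\circ u^2\circ u^4\Rightarrow v^1\circ f^2\circ u^5$, $\rho:l\circ u^4\Rightarrow g^1\circ f^2\circ u^5$ with $v\circ\omega=(\eta\circ u^5)\bullet(f\circ\gamma)\bullet(\delta^{-1}\circ u^2\circ u^4)$ and $w\circ\rho=(\xi\circ f^2\circ u^5)\bullet(g\circ\omega)\bullet(\sigma^{-1}\circ u^4)$. Then $\Theta^{\mathscr{C},\mathbf{W}}_{\underline h,\underline g,\underline f}$ is the class of $(A^4,u^4,u^5,u\circ\gamma,h\circ\rho)$. *)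

theory Defs
  imports Main
begin

section \<open>Bicategories\<close>

record ('o, 'm, 'c) bicat =
  Ob :: "'o set"
  Mor :: "'m set"
  Cell :: "'c set"
  src :: "'m \<Rightarrow> 'o"
  tgt :: "'m \<Rightarrow> 'o"
  src2 :: "'c \<Rightarrow> 'm"
  tgt2 :: "'c \<Rightarrow> 'm"
  id1 :: "'o \<Rightarrow> 'm"
  id2 :: "'m \<Rightarrow> 'c"
  comp :: "'m \<Rightarrow> 'm \<Rightarrow> 'm"  (infixr "\<odot>\<index>" 75)
  vcomp :: "'c \<Rightarrow> 'c \<Rightarrow> 'c"  (infixr "\<bullet>\<index>" 65)
  hcomp :: "'c \<Rightarrow> 'c \<Rightarrow> 'c"  (infixr "\<star>\<index>" 75)
  assoc :: "'m \<Rightarrow> 'm \<Rightarrow> 'm \<Rightarrow> 'c"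
  lunit :: "'m \<Rightarrow> 'c"
  runit :: "'m \<Rightarrow> 'c"

text \<open>The locale \<open>bicat_ops\<close> only fixes the data, so that the notions below can be used both
  in the axioms and after them.\<close>

locale bicat_ops =
  fixes C :: "('o, 'm, 'c) bicat" (structure)
begin

definition hom :: "'o \<Rightarrow> 'o \<Rightarrow> 'm \<Rightarrow> bool" where
  "hom A B f \<longleftrightarrow> A \<in> Ob C \<and> B \<in> Ob C \<and> f \<in> Mor C \<and> src C f = A \<and> tgt C f = B"

definition hom2 :: "'m \<Rightarrow> 'm \<Rightarrow> 'c \<Rightarrow> bool" where
  "hom2 f g \<alpha> \<longleftrightarrow> f \<in> Mor C \<and> g \<in> Mor C \<and> \<alpha> \<in> Cell C \<and> src2 C \<alpha> = f \<and> tgt2 C \<alpha> = g"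

definition is_inverse :: "'c \<Rightarrow> 'c \<Rightarrow> bool" where
  "is_inverse \<alpha> \<beta> \<longleftrightarrow> hom2 (src2 C \<alpha>) (tgt2 C \<alpha>) \<alpha> \<and> hom2 (tgt2 C \<alpha>) (src2 C \<alpha>) \<beta> \<and>
     \<beta> \<bullet> \<alpha> = id2 C (src2 C \<alpha>) \<and> \<alpha> \<bullet> \<beta> = id2 C (tgt2 C \<alpha>)"

definition invertible :: "'c \<Rightarrow> bool" where
  "invertible \<alpha> \<longleftrightarrow> (\<exists>\<beta>. is_inverse \<alpha> \<beta>)"

definition inv2 :: "'c \<Rightarrow> 'c" where
  "inv2 \<alpha> = (THE \<beta>. is_inverse \<alpha> \<beta>)"

end

text \<open>\<open>g \<odot> f\<close> is \<open>f\<close> followed by \<open>g\<close>, \<open>\<beta> \<bullet> \<alpha>\<close> is \<open>\<alpha>\<close> followed by \<open>\<beta>\<close>.\<close>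

locale bicategory = bicat_ops C for C :: "('o, 'm, 'c) bicat" (structure) +
  assumes src_tgt: "f \<in> Mor C \<Longrightarrow> src C f \<in> Ob C \<and> tgt C f \<in> Ob C"
    and src2_tgt2: "\<alpha> \<in> Cell C \<Longrightarrow> src2 C \<alpha> \<in> Mor C \<and> tgt2 C \<alpha> \<in> Mor C"
    and globular: "\<alpha> \<in> Cell C \<Longrightarrow>
      src C (src2 C \<alpha>) = src C (tgt2 C \<alpha>) \<and> tgt C (src2 C \<alpha>) = tgt C (tgt2 C \<alpha>)"
    and id1: "A \<in> Ob C \<Longrightarrow> hom A A (id1 C A)"
    and comp: "hom A B f \<Longrightarrow> hom B D g \<Longrightarrow> hom A D (g \<odot> f)"
    and id2: "f \<in> Mor C \<Longrightarrow> hom2 f f (id2 C f)"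
    and vcomp: "hom2 f g \<alpha> \<Longrightarrow> hom2 g h \<beta> \<Longrightarrow> hom2 f h (\<beta> \<bullet> \<alpha>)"
    and vcomp_id2: "hom2 f g \<alpha> \<Longrightarrow> \<alpha> \<bullet> id2 C f = \<alpha>"
    and id2_vcomp: "hom2 f g \<alpha> \<Longrightarrow> id2 C g \<bullet> \<alpha> = \<alpha>"
    and vcomp_assoc: "hom2 f g \<alpha> \<Longrightarrow> hom2 g h \<beta> \<Longrightarrow> hom2 h k \<gamma> \<Longrightarrow>
      (\<gamma> \<bullet> \<beta>) \<bullet> \<alpha> = \<gamma> \<bullet> (\<beta> \<bullet> \<alpha>)"
    and hcomp: "hom A B f \<Longrightarrow> hom B D g \<Longrightarrow> hom2 f f' \<alpha> \<Longrightarrow> hom2 g g' \<beta> \<Longrightarrow>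
      hom2 (g \<odot> f) (g' \<odot> f') (\<beta> \<star> \<alpha>)"
    and hcomp_id2: "hom A B f \<Longrightarrow> hom B D g \<Longrightarrow> id2 C g \<star> id2 C f = id2 C (g \<odot> f)"
    and interchange: "hom A B f \<Longrightarrow> hom B D g \<Longrightarrow>
      hom2 f f' \<alpha> \<Longrightarrow> hom2 f' f'' \<alpha>' \<Longrightarrow> hom2 g g' \<beta> \<Longrightarrow> hom2 g' g'' \<beta>' \<Longrightarrow>
      (\<beta>' \<bullet> \<beta>) \<star> (\<alpha>' \<bullet> \<alpha>) = (\<beta>' \<star> \<alpha>') \<bullet> (\<beta> \<star> \<alpha>)"
    and assoc: "hom A B f \<Longrightarrow> hom B D g \<Longrightarrow> hom D E h \<Longrightarrow>
      hom2 (h \<odot> (g \<odot> f)) ((h \<odot> g) \<odot> f) (assoc C h g f) \<and> invertible (assoc C h g f)"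
    and assoc_natural: "hom A B f \<Longrightarrow> hom B D g \<Longrightarrow> hom D E h \<Longrightarrow>
      hom2 f f' \<alpha> \<Longrightarrow> hom2 g g' \<beta> \<Longrightarrow> hom2 h h' \<gamma> \<Longrightarrow>
      ((\<gamma> \<star> \<beta>) \<star> \<alpha>) \<bullet> assoc C h g f = assoc C h' g' f' \<bullet> (\<gamma> \<star> (\<beta> \<star> \<alpha>))"
    and lunit: "hom A B f \<Longrightarrow>
      hom2 (id1 C B \<odot> f) f (lunit C f) \<and> invertible (lunit C f)"
    and runit: "hom A B f \<Longrightarrow>
      hom2 (f \<odot> id1 C A) f (runit C f) \<and> invertible (runit C f)"
    and lunit_natural: "hom A B f \<Longrightarrow> hom2 f f' \<alpha> \<Longrightarrow>
      lunit C f' \<bullet> (id2 C (id1 C B) \<star> \<alpha>) = \<alpha> \<bullet> lunit C f"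
    and runit_natural: "hom A B f \<Longrightarrow> hom2 f f' \<alpha> \<Longrightarrow>
      runit C f' \<bullet> (\<alpha> \<star> id2 C (id1 C A)) = \<alpha> \<bullet> runit C f"
    and pentagon: "hom A B f \<Longrightarrow> hom B D g \<Longrightarrow> hom D E h \<Longrightarrow> hom E F k \<Longrightarrow>
      assoc C (k \<odot> h) g f \<bullet> assoc C k h (g \<odot> f) =
      (assoc C k h g \<star> id2 C f) \<bullet> assoc C k (h \<odot> g) f \<bullet> (id2 C k \<star> assoc C h g f)"
    and triangle: "hom A B f \<Longrightarrow> hom B D g \<Longrightarrow>
      (runit C g \<star> id2 C f) \<bullet> assoc C g (id1 C B) f = id2 C g \<star> lunit C f"


section \<open>Canonical insertion of associators\<close>

context bicat_ops
begin

text \<open>Unbracketed composites are rendered as nonempty lists of 1-morphisms, evaluated with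
  brackets to the right. In this normal form all associators are determined:
  \<open>unbr xs ys\<close> is the coherence cell \<open>path xs \<odot> path ys \<Rightarrow> path (xs @ ys)\<close>, and
  \<open>whisk ps xs ys qs \<alpha> : path (ps @ xs @ qs) \<Rightarrow> path (ps @ ys @ qs)\<close> is the whiskering
  \<open>ps \<circ> \<alpha> \<circ> qs\<close> of \<open>\<alpha> : path xs \<Rightarrow> path ys\<close>. Here \<open>ps\<close>, \<open>qs\<close> may be empty. Identity
  1-morphisms in a list are kept.\<close>

fun path :: "'m list \<Rightarrow> 'm" where
  "path [] = undefined"
| "path [x] = x"
| "path (x # y # ys) = x \<odot> path (y # ys)"

fun unbr :: "'m list \<Rightarrow> 'm list \<Rightarrow> 'c" where
  "unbr [] ys = undefined"
| "unbr [x] ys = id2 C (x \<odot> path ys)"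
| "unbr (x # x' # xs) ys =
     (id2 C x \<star> unbr (x' # xs) ys) \<bullet> inv2 (assoc C x (path (x' # xs)) (path ys))"

definition rwhisk :: "'m list \<Rightarrow> 'm list \<Rightarrow> 'm list \<Rightarrow> 'c \<Rightarrow> 'c" where
  "rwhisk xs ys qs \<alpha> =
     (if qs = [] then \<alpha> else unbr ys qs \<bullet> (\<alpha> \<star> id2 C (path qs)) \<bullet> inv2 (unbr xs qs))"

definition whisk :: "'m list \<Rightarrow> 'm list \<Rightarrow> 'm list \<Rightarrow> 'm list \<Rightarrow> 'c \<Rightarrow> 'c" where
  "whisk ps xs ys qs \<alpha> = foldr (\<lambda>p \<theta>. id2 C p \<star> \<theta>) ps (rwhisk xs ys qs \<alpha>)"

definition cell :: "'m list \<Rightarrow> 'm list \<Rightarrow> 'c \<Rightarrow> bool" where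
  "cell xs ys \<alpha> \<longleftrightarrow> hom2 (path xs) (path ys) \<alpha>"

definition iso :: "'m list \<Rightarrow> 'm list \<Rightarrow> 'c \<Rightarrow> bool" where
  "iso xs ys \<alpha> \<longleftrightarrow> hom2 (path xs) (path ys) \<alpha> \<and> invertible \<alpha>"

end


section \<open>The conditions (BF) and choices\<close>

text \<open>In \<open>BF4ab\<close> invertibility of \<open>\<beta>\<close> is asked, as in Pronk's axioms, of some solution \<open>(D, v, \<beta>)\<close>,
  not of every solution.\<close>

locale bicategory_BF = bicategory C for C :: "('o, 'm, 'c) bicat" (structure) +
  fixes W :: "'m set"
  assumes W_Mor: "W \<subseteq> Mor C"
    and BF1: "A \<in> Ob C \<Longrightarrow> id1 C A \<in> W"
    and BF2: "hom A B f \<Longrightarrow> hom B D g \<Longrightarrow> f \<in> W \<Longrightarrow> g \<in> W \<Longrightarrow> g \<odot> f \<in> W"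
    and BF3: "hom A B w \<Longrightarrow> w \<in> W \<Longrightarrow> hom E B f \<Longrightarrow>
      \<exists>D w' f' \<rho>. hom D E w' \<and> w' \<in> W \<and> hom D A f' \<and> iso [f, w'] [w, f'] \<rho>"
    and BF4ab: "hom B A w \<Longrightarrow> w \<in> W \<Longrightarrow> hom E B f1 \<Longrightarrow> hom E B f2 \<Longrightarrow>
      cell [w, f1] [w, f2] \<alpha> \<Longrightarrow>
      \<exists>D v \<beta>. hom D E v \<and> v \<in> W \<and> cell [f1, v] [f2, v] \<beta> \<and>
        whisk [] [w, f1] [w, f2] [v] \<alpha> = whisk [w] [f1, v] [f2, v] [] \<beta> \<and>
        (invertible \<alpha> \<longrightarrow> invertible \<beta>)"
    and BF4c: "hom B A w \<Longrightarrow> w \<in> W \<Longrightarrow> hom E B f1 \<Longrightarrow> hom E B f2 \<Longrightarrow>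
      cell [w, f1] [w, f2] \<alpha> \<Longrightarrow>
      hom D E v \<Longrightarrow> v \<in> W \<Longrightarrow> cell [f1, v] [f2, v] \<beta> \<Longrightarrow>
      whisk [] [w, f1] [w, f2] [v] \<alpha> = whisk [w] [f1, v] [f2, v] [] \<beta> \<Longrightarrow>
      hom D' E v' \<Longrightarrow> v' \<in> W \<Longrightarrow> cell [f1, v'] [f2, v'] \<beta>' \<Longrightarrow>
      whisk [] [w, f1] [w, f2] [v'] \<alpha> = whisk [w] [f1, v'] [f2, v'] [] \<beta>' \<Longrightarrow>
      \<exists>G u u' \<zeta>. hom G D u \<and> hom G D' u' \<and> iso [v, u] [v', u'] \<zeta> \<and> v \<odot> u \<in> W \<and>
        whisk [] [f1, v'] [f2, v'] [u'] \<beta>' \<bullet> whisk [f1] [v, u] [v', u'] [] \<zeta> =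
        whisk [f2] [v, u] [v', u'] [] \<zeta> \<bullet> whisk [] [f1, v] [f2, v] [u] \<beta>"
    and BF5: "w \<in> W \<Longrightarrow> hom2 v w \<nu> \<Longrightarrow> invertible \<nu> \<Longrightarrow> v \<in> W"

type_synonym ('o, 'm) fmor = "'o \<times> 'm \<times> 'm"
type_synonym ('o, 'm, 'c) frep = "'o \<times> 'm \<times> 'm \<times> 'c \<times> 'c"
type_synonym ('o, 'm, 'c) fcell = "('o, 'm) fmor \<times> ('o, 'm) fmor \<times> ('o, 'm, 'c) frep set"

text \<open>\<open>choice f v = (A'', v', f', \<rho>)\<close> is the choice in \<open>C(W)\<close> for \<open>(f, v)\<close>; its values on other
  arguments are irrelevant.\<close>

locale bicategory_of_fractions = bicategory_BF C W
  for C :: "('o, 'm, 'c) bicat" (structure) and W :: "'m set" +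
  fixes choice :: "'m \<Rightarrow> 'm \<Rightarrow> 'o \<times> 'm \<times> 'm \<times> 'c"
  assumes choice: "hom A' B f \<Longrightarrow> hom B' B v \<Longrightarrow> v \<in> W \<Longrightarrow> choice f v = (A'', v', f', \<rho>) \<Longrightarrow>
      hom A'' A' v' \<and> v' \<in> W \<and> hom A'' B' f' \<and> iso [f, v'] [v, f'] \<rho>"
begin


section \<open>Morphisms and 2-morphisms of the bicategory of fractions\<close>

fun is_fmor :: "'o \<Rightarrow> 'o \<Rightarrow> ('o, 'm) fmor \<Rightarrow> bool" where
  "is_fmor A B (A', w, f) \<longleftrightarrow> hom A' A w \<and> w \<in> W \<and> hom A' B f"

fun fcomp :: "('o, 'm) fmor \<Rightarrow> ('o, 'm) fmor \<Rightarrow> ('o, 'm) fmor" where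
  "fcomp (B', v, g) (A', w, f) = (case choice f v of (A'', v', f', \<rho>) \<Rightarrow> (A'', w \<odot> v', g \<odot> f'))"

fun is_frep :: "('o, 'm) fmor \<Rightarrow> ('o, 'm) fmor \<Rightarrow> ('o, 'm, 'c) frep \<Rightarrow> bool" where
  "is_frep (A1, w1, f1) (A2, w2, f2) (A3, v1, v2, \<alpha>, \<beta>) \<longleftrightarrow>
     (\<exists>A B. is_fmor A B (A1, w1, f1) \<and> is_fmor A B (A2, w2, f2)) \<and>
     hom A3 A1 v1 \<and> hom A3 A2 v2 \<and> w1 \<odot> v1 \<in> W \<and>
     iso [w1, v1] [w2, v2] \<alpha> \<and> cell [f1, v1] [f2, v2] \<beta>"

fun frep_equiv ::
  "('o, 'm) fmor \<Rightarrow> ('o, 'm) fmor \<Rightarrow> ('o, 'm, 'c) frep \<Rightarrow> ('o, 'm, 'c) frep \<Rightarrow> bool" where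
  "frep_equiv (A1, w1, f1) (A2, w2, f2) (A3, v1, v2, \<alpha>, \<beta>) (A3', v1', v2', \<alpha>', \<beta>') \<longleftrightarrow>
     (\<exists>A4 z z' \<sigma>1 \<sigma>2. hom A4 A3 z \<and> hom A4 A3' z' \<and>
        iso [v1', z'] [v1, z] \<sigma>1 \<and> iso [v2, z] [v2', z'] \<sigma>2 \<and> path [w1, v1, z] \<in> W \<and>
        whisk [w2] [v2, z] [v2', z'] [] \<sigma>2 \<bullet> whisk [] [w1, v1] [w2, v2] [z] \<alpha> \<bullet>
          whisk [w1] [v1', z'] [v1, z] [] \<sigma>1 = whisk [] [w1, v1'] [w2, v2'] [z'] \<alpha>' \<and>
        whisk [f2] [v2, z] [v2', z'] [] \<sigma>2 \<bullet> whisk [] [f1, v1] [f2, v2] [z] \<beta> \<bullet>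
          whisk [f1] [v1', z'] [v1, z] [] \<sigma>1 = whisk [] [f1, v1'] [f2, v2'] [z'] \<beta>')"

text \<open>\<open>fclass F1 F2 r\<close> is the 2-morphism \<open>[r] : F1 \<Rightarrow> F2\<close>. The class is tagged with its source and
  target, which the representatives do not determine.\<close>

definition fclass ::
  "('o, 'm) fmor \<Rightarrow> ('o, 'm) fmor \<Rightarrow> ('o, 'm, 'c) frep \<Rightarrow> ('o, 'm, 'c) fcell" where
  "fclass F1 F2 r = (F1, F2, {r'. is_frep F1 F2 r' \<and> frep_equiv F1 F2 r r'})"

definition is_fcell :: "('o, 'm) fmor \<Rightarrow> ('o, 'm) fmor \<Rightarrow> ('o, 'm, 'c) fcell \<Rightarrow> bool" where
  "is_fcell F1 F2 \<Gamma> \<longleftrightarrow> (\<exists>r. is_frep F1 F2 r \<and> \<Gamma> = fclass F1 F2 r)"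

fun fsrc :: "('o, 'm, 'c) fcell \<Rightarrow> ('o, 'm) fmor" where
  "fsrc (F1, F2, R) = F1"

fun ftgt :: "('o, 'm, 'c) fcell \<Rightarrow> ('o, 'm) fmor" where
  "ftgt (F1, F2, R) = F2"


section \<open>Compositions of 2-morphisms\<close>

text \<open>Each operation is given by a relation that holds for the results computed from any
  representatives and any auxiliary data; the operation picks such a result (which does not
  depend on the data).\<close>

text \<open>\<open>fvcomp_rel \<Gamma> \<Delta> \<Omega>\<close>: \<open>\<Omega>\<close> is \<open>\<Gamma>\<close> followed by \<open>\<Delta>\<close>.\<close>

inductive fvcomp_rel ::
  "('o, 'm, 'c) fcell \<Rightarrow> ('o, 'm, 'c) fcell \<Rightarrow> ('o, 'm, 'c) fcell \<Rightarrow> bool" where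
  "\<lbrakk> is_frep (A1, w1, f1) (A2, w2, f2) (A4, u1, u2, \<alpha>1, \<beta>1);
     is_frep (A2, w2, f2) (A3, w3, f3) (A5, u3, u4, \<alpha>2, \<beta>2);
     hom D A4 t1; t1 \<in> W; hom D A5 t2; iso [u2, t1] [u3, t2] \<rho>;
     \<alpha> = whisk [] [w2, u3] [w3, u4] [t2] \<alpha>2 \<bullet> whisk [w2] [u2, t1] [u3, t2] [] \<rho> \<bullet>
         whisk [] [w1, u1] [w2, u2] [t1] \<alpha>1;
     \<beta> = whisk [] [f2, u3] [f3, u4] [t2] \<beta>2 \<bullet> whisk [f2] [u2, t1] [u3, t2] [] \<rho> \<bullet>
         whisk [] [f1, u1] [f2, u2] [t1] \<beta>1 \<rbrakk>
   \<Longrightarrow> fvcomp_rel (fclass (A1, w1, f1) (A2, w2, f2) (A4, u1, u2, \<alpha>1, \<beta>1))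
                  (fclass (A2, w2, f2) (A3, w3, f3) (A5, u3, u4, \<alpha>2, \<beta>2))
                  (fclass (A1, w1, f1) (A3, w3, f3) (D, u1 \<odot> t1, u4 \<odot> t2, \<alpha>, \<beta>))"

definition fvcomp :: "('o, 'm, 'c) fcell \<Rightarrow> ('o, 'm, 'c) fcell \<Rightarrow> ('o, 'm, 'c) fcell" where
  "fvcomp \<Delta> \<Gamma> = (SOME \<Omega>. fvcomp_rel \<Gamma> \<Delta> \<Omega>)"

text \<open>\<open>fwhisk_r_rel \<Delta> F \<Omega>\<close>: \<open>\<Omega>\<close> is \<open>\<Delta> \<circ> F\<close>. The outermost factors \<open>unbr\<close> of \<open>\<mu>\<close> and \<open>\<nu>\<close>
  only rebracket, since e.g. \<open>\<mu>\<close> has source \<open>(w \<odot> w1) \<odot> (t1 \<odot> t3)\<close>.\<close>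

inductive fwhisk_r_rel ::
  "('o, 'm, 'c) fcell \<Rightarrow> ('o, 'm) fmor \<Rightarrow> ('o, 'm, 'c) fcell \<Rightarrow> bool" where
  "\<lbrakk> is_fmor A B (A', w, f); is_fmor B E (B1, v1, g1); is_fmor B E (B2, v2, g2);
     is_frep (B1, v1, g1) (B2, v2, g2) (B3, u1, u2, \<alpha>, \<beta>);
     choice f v1 = (D1, w1, f1, \<rho>1); choice f v2 = (D2, w2, f2, \<rho>2);
     hom D3 D1 t1; t1 \<in> W; hom D4 D2 t2; t2 \<in> W; hom D3 B3 h1; hom D4 B3 h2;
     iso [f1, t1] [u1, h1] \<sigma>1; iso [f2, t2] [u2, h2] \<sigma>2;
     hom D5 D3 t3; t3 \<in> W; hom D5 D4 t4; iso [w1, t1, t3] [w2, t2, t4] \<phi>;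
     iso [h1, t3] [h2, t4] \<delta>;
     whisk [v1, u1] [h1, t3] [h2, t4] [] \<delta> =
       whisk [] [v2, u2] [v1, u1] [h2, t4] (inv2 \<alpha>) \<bullet>
       whisk [v2] [f2, t2] [u2, h2] [t4] \<sigma>2 \<bullet>
       whisk [] [f, w2] [v2, f2] [t2, t4] \<rho>2 \<bullet>
       whisk [f] [w1, t1, t3] [w2, t2, t4] [] \<phi> \<bullet>
       whisk [] [v1, f1] [f, w1] [t1, t3] (inv2 \<rho>1) \<bullet>
       whisk [v1] [u1, h1] [f1, t1] [t3] (inv2 \<sigma>1);
     \<mu> = inv2 (unbr [w, w2] [t2, t4]) \<bullet>
         whisk [w] [w1, t1, t3] [w2, t2, t4] [] \<phi> \<bullet>
         unbr [w, w1] [t1, t3];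
     \<xi> = whisk [g2] [u2, h2] [f2, t2] [t4] (inv2 \<sigma>2) \<bullet>
         whisk [] [g1, u1] [g2, u2] [h2, t4] \<beta> \<bullet>
         whisk [g1, u1] [h1, t3] [h2, t4] [] \<delta> \<bullet>
         whisk [g1] [f1, t1] [u1, h1] [t3] \<sigma>1;
     \<nu> = inv2 (unbr [g2, f2] [t2, t4]) \<bullet> \<xi> \<bullet> unbr [g1, f1] [t1, t3] \<rbrakk>
   \<Longrightarrow> fwhisk_r_rel (fclass (B1, v1, g1) (B2, v2, g2) (B3, u1, u2, \<alpha>, \<beta>)) (A', w, f)
         (fclass (fcomp (B1, v1, g1) (A', w, f)) (fcomp (B2, v2, g2) (A', w, f))
            (D5, t1 \<odot> t3, t2 \<odot> t4, \<mu>, \<nu>))"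

definition fwhisk_r :: "('o, 'm, 'c) fcell \<Rightarrow> ('o, 'm) fmor \<Rightarrow> ('o, 'm, 'c) fcell" where
  "fwhisk_r \<Delta> F = (SOME \<Omega>. fwhisk_r_rel \<Delta> F \<Omega>)"

text \<open>\<open>fwhisk_l_rel G \<Gamma> \<Omega>\<close>: \<open>\<Omega>\<close> is \<open>G \<circ> \<Gamma>\<close>; the \<open>unbr\<close> factors again only rebracket.\<close>

inductive fwhisk_l_rel ::
  "('o, 'm) fmor \<Rightarrow> ('o, 'm, 'c) fcell \<Rightarrow> ('o, 'm, 'c) fcell \<Rightarrow> bool" where
  "\<lbrakk> is_fmor B E (B', u, g); is_fmor A B (A1, w1, f1); is_fmor A B (A2, w2, f2);
     is_frep (A1, w1, f1) (A2, w2, f2) (A3, v1, v2, \<alpha>, \<beta>);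
     choice f1 u = (D1, u1, h1, \<rho>1); choice f2 u = (D2, u2, h2, \<rho>2);
     hom D3 A3 u3; u3 \<in> W; hom D4 A3 u5; u5 \<in> W; hom D3 D1 u4; hom D4 D2 u6;
     iso [v1, u3] [u1, u4] \<eta>1; iso [v2, u5] [u2, u6] \<eta>2;
     hom D5 D3 u7; u7 \<in> W; hom D5 D4 u8; iso [u3, u7] [u5, u8] \<eta>3;
     cell [h1, u4, u7] [h2, u6, u8] \<Lambda>;
     whisk [u] [h1, u4, u7] [h2, u6, u8] [] \<Lambda> =
       whisk [] [f2, u2] [u, h2] [u6, u8] \<rho>2 \<bullet>
       whisk [f2] [v2, u5] [u2, u6] [u8] \<eta>2 \<bullet>
       whisk [f2, v2] [u3, u7] [u5, u8] [] \<eta>3 \<bullet>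
       whisk [] [f1, v1] [f2, v2] [u3, u7] \<beta> \<bullet>
       whisk [f1] [u1, u4] [v1, u3] [u7] (inv2 \<eta>1) \<bullet>
       whisk [] [u, h1] [f1, u1] [u4, u7] (inv2 \<rho>1);
     \<mu> = whisk [w2] [v2, u5] [u2, u6] [u8] \<eta>2 \<bullet>
         whisk [w2, v2] [u3, u7] [u5, u8] [] \<eta>3 \<bullet>
         whisk [] [w1, v1] [w2, v2] [u3, u7] \<alpha> \<bullet>
         whisk [w1] [u1, u4] [v1, u3] [u7] (inv2 \<eta>1);
     \<mu>' = inv2 (unbr [w2, u2] [u6, u8]) \<bullet> \<mu> \<bullet> unbr [w1, u1] [u4, u7];
     \<nu> = inv2 (unbr [g, h2] [u6, u8]) \<bullet>
         whisk [g] [h1, u4, u7] [h2, u6, u8] [] \<Lambda> \<bullet>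
         unbr [g, h1] [u4, u7] \<rbrakk>
   \<Longrightarrow> fwhisk_l_rel (B', u, g) (fclass (A1, w1, f1) (A2, w2, f2) (A3, v1, v2, \<alpha>, \<beta>))
         (fclass (fcomp (B', u, g) (A1, w1, f1)) (fcomp (B', u, g) (A2, w2, f2))
            (D5, u4 \<odot> u7, u6 \<odot> u8, \<mu>', \<nu>))"

definition fwhisk_l :: "('o, 'm) fmor \<Rightarrow> ('o, 'm, 'c) fcell \<Rightarrow> ('o, 'm, 'c) fcell" where
  "fwhisk_l G \<Gamma> = (SOME \<Omega>. fwhisk_l_rel G \<Gamma> \<Omega>)"

definition fhcomp :: "('o, 'm, 'c) fcell \<Rightarrow> ('o, 'm, 'c) fcell \<Rightarrow> ('o, 'm, 'c) fcell" where
  "fhcomp \<Delta> \<Gamma> = fvcomp (fwhisk_r \<Delta> (ftgt \<Gamma>)) (fwhisk_l (fsrc \<Delta>) \<Gamma>)"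

fun fid2 :: "('o, 'm) fmor \<Rightarrow> ('o, 'm, 'c) fcell" where
  "fid2 (A', w, f) = fclass (A', w, f) (A', w, f)
     (A', id1 C A', id1 C A', id2 C (w \<odot> id1 C A'), id2 C (f \<odot> id1 C A'))"

definition finv2 :: "('o, 'm, 'c) fcell \<Rightarrow> ('o, 'm, 'c) fcell" where
  "finv2 \<Gamma> = (THE \<Delta>. is_fcell (ftgt \<Gamma>) (fsrc \<Gamma>) \<Delta> \<and>
     fvcomp \<Delta> \<Gamma> = fid2 (fsrc \<Gamma>) \<and> fvcomp \<Gamma> \<Delta> = fid2 (ftgt \<Gamma>))"


section \<open>The associator and \<open>\<chi>\<close>\<close>

text \<open>\<open>\<sigma>'\<close> and \<open>\<eta>'\<close> are \<open>\<sigma> : (g \<odot> f1) \<odot> u2 \<Rightarrow> w \<odot> l\<close> and \<open>\<eta> : f \<odot> u3 \<Rightarrow> (v \<odot> v1) \<odot> f2\<close>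
  rebracketed to the right; \<open>\<mu>\<close> and \<open>\<nu>\<close> are \<open>u \<circ> \<gamma>\<close> and \<open>h \<circ> \<rho>\<close>, rebracketed so that their
  sources are \<open>((u \<odot> u1) \<odot> u2) \<odot> u4\<close>, \<open>(h \<odot> l) \<odot> u4\<close> and their targets
  \<open>(u \<odot> u3) \<odot> u5\<close>, \<open>((h \<odot> g1) \<odot> f2) \<odot> u5\<close>.\<close>

inductive fassoc_rel ::
  "('o, 'm) fmor \<Rightarrow> ('o, 'm) fmor \<Rightarrow> ('o, 'm) fmor \<Rightarrow> ('o, 'm, 'c) fcell \<Rightarrow> bool" where
  "\<lbrakk> is_fmor A B (A', u, f); is_fmor B E (B', v, g); is_fmor E D (E', w, h);
     choice f v = (A1, u1, f1, \<delta>); choice (g \<odot> f1) w = (A2, u2, l, \<sigma>);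
     choice g w = (B2, v1, g1, \<xi>); choice f (v \<odot> v1) = (A3, u3, f2, \<eta>);
     \<sigma>' = \<sigma> \<bullet> inv2 (unbr [g, f1] [u2]);
     \<eta>' = unbr [v, v1] [f2] \<bullet> \<eta>;
     hom A4 A2 u4; path [u, u1, u2, u4] \<in> W; hom A4 A3 u5;
     iso [u1, u2, u4] [u3, u5] \<gamma>;
     iso [f1, u2, u4] [v1, f2, u5] \<omega>;
     iso [l, u4] [g1, f2, u5] \<rho>;
     whisk [v] [f1, u2, u4] [v1, f2, u5] [] \<omega> =
       whisk [] [f, u3] [v, v1, f2] [u5] \<eta>' \<bullet>
       whisk [f] [u1, u2, u4] [u3, u5] [] \<gamma> \<bullet>
       whisk [] [v, f1] [f, u1] [u2, u4] (inv2 \<delta>);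
     whisk [w] [l, u4] [g1, f2, u5] [] \<rho> =
       whisk [] [g, v1] [w, g1] [f2, u5] \<xi> \<bullet>
       whisk [g] [f1, u2, u4] [v1, f2, u5] [] \<omega> \<bullet>
       whisk [] [w, l] [g, f1, u2] [u4] (inv2 \<sigma>');
     \<mu> = inv2 (unbr [u, u3] [u5]) \<bullet>
         whisk [u] [u1, u2, u4] [u3, u5] [] \<gamma> \<bullet>
         unbr [u, u1] [u2, u4] \<bullet> unbr [u \<odot> u1, u2] [u4];
     \<nu> = inv2 (unbr [h \<odot> g1, f2] [u5]) \<bullet> inv2 (unbr [h, g1] [f2, u5]) \<bullet>
         whisk [h] [l, u4] [g1, f2, u5] [] \<rho> \<bullet>
         unbr [h, l] [u4] \<rbrakk>
   \<Longrightarrow> fassoc_rel (E', w, h) (B', v, g) (A', u, f)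
         (fclass (fcomp (E', w, h) (fcomp (B', v, g) (A', u, f)))
                 (fcomp (fcomp (E', w, h) (B', v, g)) (A', u, f))
            (A4, u4, u5, \<mu>, \<nu>))"

definition fassoc ::
  "('o, 'm) fmor \<Rightarrow> ('o, 'm) fmor \<Rightarrow> ('o, 'm) fmor \<Rightarrow> ('o, 'm, 'c) fcell" where
  "fassoc H G F = (SOME \<Omega>. fassoc_rel H G F \<Omega>)"

fun prime :: "('o, 'm) fmor \<Rightarrow> ('o, 'm) fmor" where
  "prime (A', u, f) = (A', u \<odot> id1 C A', f \<odot> id1 C A')"

fun chi :: "('o, 'm) fmor \<Rightarrow> ('o, 'm, 'c) fcell" where
  "chi (A', u, f) = fclass (prime (A', u, f)) (A', u, f)
     (A', id1 C A', id1 C A',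
      runit C u \<star> id2 C (id1 C A'), runit C f \<star> id2 C (id1 C A'))"

end

end

theory Submission
  imports Defs
begin

text \<open>Restricted to a test object \<open>T\<close>, a morphism of fractions composed in any way of
  \<open>(A', u, f)\<close>, \<open>(B', v, g)\<close>, \<open>(C', w, h)\<close> or their primed versions amounts to 1-morphisms
  \<open>x : T \<rightarrow> A'\<close>, \<open>y : T \<rightarrow> B'\<close>, \<open>z : T \<rightarrow> C'\<close> with invertible 2-morphisms \<open>f x \<Rightarrow> v y\<close> and
  \<open>g y \<Rightarrow> w z\<close>. Call a 2-morphism \<open>[T, q, q', \<alpha>, \<beta>]\<close> between two such composites canonical if,
  after composing with some morphism of \<open>W\<close>, \<open>\<alpha>\<close> and \<open>\<beta>\<close> come from \<open>u \<circ> \<xi>\<close> and \<open>h \<circ> \<zeta>\<close> for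
  2-morphisms \<open>\<xi>\<close>, \<open>\<upsilon>\<close>, \<open>\<zeta>\<close> between the \<open>x\<close>, \<open>y\<close>, \<open>z\<close> that commute with the given ones.
  By (BF4) left composition with a morphism of \<open>W\<close> is faithful up to refinement, so \<open>\<alpha>\<close> determines
  \<open>\<xi>\<close>, then \<open>\<upsilon>\<close>, then \<open>\<zeta>\<close> and finally \<open>\<beta>\<close>: between two given composites there is at most one
  canonical 2-morphism. Identities, \<open>\<chi>\<close>, its inverse and the associators are canonical, and
  vertical composition and whiskering preserve canonicity whatever auxiliary data are used. Both
  sides of the claim are therefore the same canonical 2-morphism; in particular no independence of
  choices is needed, only the existence of the auxiliary data.\<close>

section \<open>Whiskering along paths\<close>

text \<open>The data of the fractions are given only up to insertion of associators. Cells are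
  therefore taken between lists of 1-morphisms bracketed to the right, where whiskering is strictly
  associative; this takes the place of a coherence theorem. Identity 1-morphisms stay visible in the
  lists, because \<open>chi\<close> is exactly the passage from \<open>u \<odot> id\<close> to
  \<open>u\<close>. The primed triples are treated as second presentations of the same spans,
  identified with them by right unitors, so that primed and unprimed composites can be compared at
  all. Since \<open>finv2\<close> picks by \<open>THE\<close>, the inverse of \<open>chi\<close>
  must be shown unique without associativity of vertical composition; this is done by cancelling a
  canonical 2-morphism from a canonical composite. Lifts through \<open>W\<close> exist only after
  refinement, so every comparison is asked for only after some refinement. The refinement
  \<open>z\<close> that comes with a representative need not lie in \<open>W\<close>, only its
  composite with the left leg does; \<open>Cmp_local\<close> is what allows such a \<open>z\<close>
  to be exchanged for any other refinement.\<close>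

context bicategory
begin

section \<open>Typing, units, interchange and inverses for the raw cells\<close>

lemma Mor_Ob [simp]: "f \<in> Mor C \<Longrightarrow> src C f \<in> Ob C" "f \<in> Mor C \<Longrightarrow> tgt C f \<in> Ob C"
  using src_tgt by auto

lemma Cell_Mor [simp]:
  "\<alpha> \<in> Cell C \<Longrightarrow> src2 C \<alpha> \<in> Mor C" "\<alpha> \<in> Cell C \<Longrightarrow> tgt2 C \<alpha> \<in> Mor C"
  "\<alpha> \<in> Cell C \<Longrightarrow> src C (tgt2 C \<alpha>) = src C (src2 C \<alpha>)"
  "\<alpha> \<in> Cell C \<Longrightarrow> tgt C (tgt2 C \<alpha>) = tgt C (src2 C \<alpha>)"
  using src2_tgt2 globular by auto

lemma hom_self: "f \<in> Mor C \<Longrightarrow> hom (src C f) (tgt C f) f"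
  by (simp add: hom_def)

lemma hom2_self: "\<alpha> \<in> Cell C \<Longrightarrow> hom2 (src2 C \<alpha>) (tgt2 C \<alpha>) \<alpha>"
  by (simp add: hom2_def)

lemma comp_Mor [simp]:
  assumes "f \<in> Mor C" "g \<in> Mor C" "tgt C f = src C g"
  shows "g \<odot> f \<in> Mor C" "src C (g \<odot> f) = src C f" "tgt C (g \<odot> f) = tgt C g"
  using comp[of "src C f" "tgt C f" f "tgt C g" g] assms by (auto simp: hom_def)

lemma vcomp_Cell [simp]:
  assumes "\<alpha> \<in> Cell C" "\<beta> \<in> Cell C" "src2 C \<beta> = tgt2 C \<alpha>"
  shows "\<beta> \<bullet> \<alpha> \<in> Cell C" "src2 C (\<beta> \<bullet> \<alpha>) = src2 C \<alpha>" "tgt2 C (\<beta> \<bullet> \<alpha>) = tgt2 C \<beta>"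
  using vcomp[of "src2 C \<alpha>" "tgt2 C \<alpha>" \<alpha> "tgt2 C \<beta>" \<beta>] assms by (auto simp: hom2_def)

lemma hcomp_Cell [simp]:
  assumes "\<alpha> \<in> Cell C" "\<beta> \<in> Cell C" "src C (src2 C \<beta>) = tgt C (src2 C \<alpha>)"
  shows "\<beta> \<star> \<alpha> \<in> Cell C" "src2 C (\<beta> \<star> \<alpha>) = src2 C \<beta> \<odot> src2 C \<alpha>"
    "tgt2 C (\<beta> \<star> \<alpha>) = tgt2 C \<beta> \<odot> tgt2 C \<alpha>"
  using hcomp[of "src C (src2 C \<alpha>)" "tgt C (src2 C \<alpha>)" "src2 C \<alpha>" "tgt C (src2 C \<beta>)" "src2 C \<beta>"
      "tgt2 C \<alpha>" \<alpha> "tgt2 C \<beta>" \<beta>] assms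
  by (auto simp: hom2_def hom_def)

lemma id2_Cell [simp]:
  "f \<in> Mor C \<Longrightarrow> id2 C f \<in> Cell C" "f \<in> Mor C \<Longrightarrow> src2 C (id2 C f) = f"
  "f \<in> Mor C \<Longrightarrow> tgt2 C (id2 C f) = f"
  using id2 by (auto simp: hom2_def)

lemma id1_Mor [simp]:
  "A \<in> Ob C \<Longrightarrow> id1 C A \<in> Mor C" "A \<in> Ob C \<Longrightarrow> src C (id1 C A) = A"
  "A \<in> Ob C \<Longrightarrow> tgt C (id1 C A) = A"
  using id1 by (auto simp: hom_def)

lemma vcomp_id2_right [simp]: "\<alpha> \<in> Cell C \<Longrightarrow> src2 C \<alpha> = f \<Longrightarrow> \<alpha> \<bullet> id2 C f = \<alpha>"
  using vcomp_id2 hom2_self by blast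

lemma vcomp_id2_left [simp]: "\<alpha> \<in> Cell C \<Longrightarrow> tgt2 C \<alpha> = f \<Longrightarrow> id2 C f \<bullet> \<alpha> = \<alpha>"
  using id2_vcomp hom2_self by blast

lemma vcomp_vcomp [simp]:
  "\<alpha> \<in> Cell C \<Longrightarrow> \<beta> \<in> Cell C \<Longrightarrow> \<gamma> \<in> Cell C \<Longrightarrow> src2 C \<beta> = tgt2 C \<alpha> \<Longrightarrow>
    src2 C \<gamma> = tgt2 C \<beta> \<Longrightarrow> (\<gamma> \<bullet> \<beta>) \<bullet> \<alpha> = \<gamma> \<bullet> \<beta> \<bullet> \<alpha>"
  by (metis hom2_self vcomp_assoc)

lemma hcomp_id2_id2 [simp]:
  "f \<in> Mor C \<Longrightarrow> g \<in> Mor C \<Longrightarrow> src C g = tgt C f \<Longrightarrow> id2 C g \<star> id2 C f = id2 C (g \<odot> f)"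
  by (metis hom_self hcomp_id2)

lemma hcomp_vcomp:
  assumes "\<alpha> \<in> Cell C" "\<alpha>' \<in> Cell C" "\<beta> \<in> Cell C" "\<beta>' \<in> Cell C"
    "src2 C \<alpha>' = tgt2 C \<alpha>" "src2 C \<beta>' = tgt2 C \<beta>" "src C (src2 C \<beta>) = tgt C (src2 C \<alpha>)"
  shows "(\<beta>' \<star> \<alpha>') \<bullet> (\<beta> \<star> \<alpha>) = (\<beta>' \<bullet> \<beta>) \<star> (\<alpha>' \<bullet> \<alpha>)"
proof (rule interchange[symmetric])
  show "hom (src C (src2 C \<alpha>)) (tgt C (src2 C \<alpha>)) (src2 C \<alpha>)" using assms by (simp add: hom_self)
  show "hom (tgt C (src2 C \<alpha>)) (tgt C (src2 C \<beta>)) (src2 C \<beta>)" using assms by (simp add: hom_def)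
qed (use assms in \<open>auto simp: hom2_def\<close>)

lemma is_inverse_unique:
  assumes "is_inverse \<alpha> \<beta>" "is_inverse \<alpha> \<beta>'"
  shows "\<beta> = \<beta>'"
proof -
  have c: "\<alpha> \<in> Cell C" "\<beta> \<in> Cell C" "\<beta>' \<in> Cell C" "src2 C \<beta> = tgt2 C \<alpha>" "tgt2 C \<beta> = src2 C \<alpha>"
    "src2 C \<beta>' = tgt2 C \<alpha>" "tgt2 C \<beta>' = src2 C \<alpha>"
    using assms by (auto simp: is_inverse_def hom2_def)
  have "\<beta> = \<beta> \<bullet> (\<alpha> \<bullet> \<beta>')" using assms c by (simp add: is_inverse_def)
  also have "\<dots> = (\<beta> \<bullet> \<alpha>) \<bullet> \<beta>'" using c by simp
  also have "\<dots> = \<beta>'" using assms c by (simp add: is_inverse_def)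
  finally show ?thesis .
qed

lemma inv2_eq: "is_inverse \<alpha> \<beta> \<Longrightarrow> inv2 \<alpha> = \<beta>"
  unfolding inv2_def using is_inverse_unique by blast

lemma invertible_inverse: "invertible \<alpha> \<Longrightarrow> is_inverse \<alpha> (inv2 \<alpha>)"
  using inv2_eq by (auto simp: invertible_def)

lemma invertible_Cell: "invertible \<alpha> \<Longrightarrow> \<alpha> \<in> Cell C"
  by (auto simp: invertible_def is_inverse_def hom2_def)

lemma inv2_Cell [simp]:
  assumes "invertible \<alpha>"
  shows "inv2 \<alpha> \<in> Cell C" "src2 C (inv2 \<alpha>) = tgt2 C \<alpha>" "tgt2 C (inv2 \<alpha>) = src2 C \<alpha>"
    "inv2 \<alpha> \<bullet> \<alpha> = id2 C (src2 C \<alpha>)" "\<alpha> \<bullet> inv2 \<alpha> = id2 C (tgt2 C \<alpha>)"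
  using invertible_inverse[OF assms] by (auto simp: is_inverse_def hom2_def)

lemma inv2_cancel [simp]:
  assumes "invertible \<alpha>" "\<beta> \<in> Cell C"
  shows "tgt2 C \<beta> = src2 C \<alpha> \<Longrightarrow> inv2 \<alpha> \<bullet> \<alpha> \<bullet> \<beta> = \<beta>"
    "tgt2 C \<beta> = tgt2 C \<alpha> \<Longrightarrow> \<alpha> \<bullet> inv2 \<alpha> \<bullet> \<beta> = \<beta>"
  using assms invertible_Cell[OF assms(1)] by (simp_all flip: vcomp_vcomp)

lemma is_inverseI:
  assumes "\<alpha> \<in> Cell C" "\<beta> \<in> Cell C" "src2 C \<beta> = tgt2 C \<alpha>" "tgt2 C \<beta> = src2 C \<alpha>"
    "\<beta> \<bullet> \<alpha> = id2 C (src2 C \<alpha>)" "\<alpha> \<bullet> \<beta> = id2 C (tgt2 C \<alpha>)"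
  shows "is_inverse \<alpha> \<beta>"
  using assms by (simp add: is_inverse_def hom2_def)

lemma is_inverse_inv2: "invertible \<alpha> \<Longrightarrow> is_inverse (inv2 \<alpha>) \<alpha>"
  by (simp add: is_inverseI invertible_Cell)

lemma invertible_inv2 [simp]: "invertible \<alpha> \<Longrightarrow> invertible (inv2 \<alpha>)"
  using is_inverse_inv2 invertible_def by blast

lemma is_inverse_id2: "f \<in> Mor C \<Longrightarrow> is_inverse (id2 C f) (id2 C f)"
  by (simp add: is_inverseI)

lemma invertible_id2 [simp]: "f \<in> Mor C \<Longrightarrow> invertible (id2 C f)"
  using is_inverse_id2 invertible_def by blast

lemma inv2_id2 [simp]: "f \<in> Mor C \<Longrightarrow> inv2 (id2 C f) = id2 C f"
  using is_inverse_id2 inv2_eq by blast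

lemma is_inverse_vcomp:
  assumes "invertible \<alpha>" "invertible \<beta>" "src2 C \<beta> = tgt2 C \<alpha>"
  shows "is_inverse (\<beta> \<bullet> \<alpha>) (inv2 \<alpha> \<bullet> inv2 \<beta>)"
  using assms by (intro is_inverseI) (simp_all add: invertible_Cell)

lemma invertible_vcomp [simp]:
  "invertible \<alpha> \<Longrightarrow> invertible \<beta> \<Longrightarrow> src2 C \<beta> = tgt2 C \<alpha> \<Longrightarrow> invertible (\<beta> \<bullet> \<alpha>)"
  using is_inverse_vcomp invertible_def by blast

lemma inv2_vcomp:
  "invertible \<alpha> \<Longrightarrow> invertible \<beta> \<Longrightarrow> src2 C \<beta> = tgt2 C \<alpha> \<Longrightarrow> inv2 (\<beta> \<bullet> \<alpha>) = inv2 \<alpha> \<bullet> inv2 \<beta>"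
  using is_inverse_vcomp inv2_eq by blast

lemma is_inverse_hcomp:
  assumes "invertible \<alpha>" "invertible \<beta>" "src C (src2 C \<beta>) = tgt C (src2 C \<alpha>)"
  shows "is_inverse (\<beta> \<star> \<alpha>) (inv2 \<beta> \<star> inv2 \<alpha>)"
  using assms by (intro is_inverseI) (simp_all add: invertible_Cell hcomp_vcomp)

lemma invertible_hcomp [simp]:
  "invertible \<alpha> \<Longrightarrow> invertible \<beta> \<Longrightarrow> src C (src2 C \<beta>) = tgt C (src2 C \<alpha>) \<Longrightarrow> invertible (\<beta> \<star> \<alpha>)"
  using is_inverse_hcomp invertible_def by blast

lemma inv2_hcomp:
  "invertible \<alpha> \<Longrightarrow> invertible \<beta> \<Longrightarrow> src C (src2 C \<beta>) = tgt C (src2 C \<alpha>) \<Longrightarrow>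
    inv2 (\<beta> \<star> \<alpha>) = inv2 \<beta> \<star> inv2 \<alpha>"
  using is_inverse_hcomp inv2_eq by blast

lemma assoc_Cell [simp]:
  assumes "f \<in> Mor C" "g \<in> Mor C" "h \<in> Mor C" "src C g = tgt C f" "src C h = tgt C g"
  shows "assoc C h g f \<in> Cell C" "src2 C (assoc C h g f) = h \<odot> (g \<odot> f)"
    "tgt2 C (assoc C h g f) = (h \<odot> g) \<odot> f" "invertible (assoc C h g f)"
  using assoc[of "src C f" "tgt C f" f "tgt C g" g "tgt C h" h] assms by (auto simp: hom_def hom2_def)

text \<open>Naturality of the associator conjugated by inverses on both sides. The rebracketing
  cells \<open>unbr\<close> are built from inverse associators, so this is the form in which
  naturality is met.\<close>

lemma assoc_natural':
  assumes "\<alpha> \<in> Cell C" "\<beta> \<in> Cell C" "\<gamma> \<in> Cell C"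
    "src C (src2 C \<beta>) = tgt C (src2 C \<alpha>)" "src C (src2 C \<gamma>) = tgt C (src2 C \<beta>)"
  shows "inv2 (assoc C (tgt2 C \<gamma>) (tgt2 C \<beta>) (tgt2 C \<alpha>)) \<bullet> ((\<gamma> \<star> \<beta>) \<star> \<alpha>) =
    (\<gamma> \<star> (\<beta> \<star> \<alpha>)) \<bullet> inv2 (assoc C (src2 C \<gamma>) (src2 C \<beta>) (src2 C \<alpha>))" (is "inv2 ?a' \<bullet> ?x = ?y \<bullet> inv2 ?a")
proof -
  have "?x \<bullet> ?a = ?a' \<bullet> ?y"
    by (rule assoc_natural[of "src C (src2 C \<alpha>)" "tgt C (src2 C \<alpha>)" _ "tgt C (src2 C \<beta>)" _
        "tgt C (src2 C \<gamma>)"])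
      (use assms in \<open>simp_all add: hom_def hom2_def\<close>)
  then have "inv2 ?a' \<bullet> (?x \<bullet> ?a) \<bullet> inv2 ?a = inv2 ?a' \<bullet> (?a' \<bullet> ?y) \<bullet> inv2 ?a" by simp
  then show ?thesis using assms by simp
qed

text \<open>Inverting both sides of the pentagon gives the form that fits the inverse associators in
  \<open>unbr\<close>.\<close>

lemma pentagon_inv:
  assumes "f \<in> Mor C" "g \<in> Mor C" "h \<in> Mor C" "k \<in> Mor C" "src C g = tgt C f" "src C h = tgt C g"
    "src C k = tgt C h"
  shows "inv2 (assoc C k h (g \<odot> f)) \<bullet> inv2 (assoc C (k \<odot> h) g f) =
    (id2 C k \<star> inv2 (assoc C h g f)) \<bullet> inv2 (assoc C k (h \<odot> g) f) \<bullet> (inv2 (assoc C k h g) \<star> id2 C f)"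
proof -
  have "inv2 (assoc C (k \<odot> h) g f \<bullet> assoc C k h (g \<odot> f)) =
    inv2 ((assoc C k h g \<star> id2 C f) \<bullet> assoc C k (h \<odot> g) f \<bullet> (id2 C k \<star> assoc C h g f))"
    by (subst pentagon[of "src C f" "tgt C f" _ "tgt C g" _ "tgt C h" _ "tgt C k"])
      (use assms in \<open>simp_all add: hom_def\<close>)
  then show ?thesis using assms by (simp add: inv2_vcomp inv2_hcomp)
qed

text \<open>Nonemptiness is part of the notion because the empty path has no value: without an
  object there is no identity 1-morphism to assign to it.\<close>

definition ok :: "'m list \<Rightarrow> bool" where
  "ok xs \<longleftrightarrow> xs \<noteq> [] \<and> set xs \<subseteq> Mor C \<and> successively (\<lambda>x y. src C x = tgt C y) xs"

lemma ok_Nil [simp]: "\<not> ok []"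
  by (simp add: ok_def)

lemma ok_Cons: "ok (x # xs) \<longleftrightarrow> x \<in> Mor C \<and> (xs \<noteq> [] \<longrightarrow> src C x = tgt C (hd xs) \<and> ok xs)"
  by (cases xs) (auto simp: ok_def)

lemma ok_single [simp]: "ok [x] \<longleftrightarrow> x \<in> Mor C"
  by (simp add: ok_Cons)

lemma ok_Cons2 [simp]: "ok (x # y # xs) \<longleftrightarrow> x \<in> Mor C \<and> src C x = tgt C y \<and> ok (y # xs)"
  by (simp add: ok_Cons)

lemma ok_append:
  assumes "xs \<noteq> []" "ys \<noteq> []"
  shows "ok (xs @ ys) \<longleftrightarrow> ok xs \<and> ok ys \<and> src C (last xs) = tgt C (hd ys)"
  using assms by (auto simp: ok_def successively_append_iff)

lemma ok_appendD1: "ok (xs @ ys) \<Longrightarrow> xs \<noteq> [] \<Longrightarrow> ok xs"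
  by (cases "ys = []") (auto simp: ok_append)

lemma ok_appendD2: "ok (xs @ ys) \<Longrightarrow> ys \<noteq> [] \<Longrightarrow> ok ys"
  by (cases "xs = []") (auto simp: ok_append)

lemma path_Cons: "xs \<noteq> [] \<Longrightarrow> path (x # xs) = x \<odot> path xs"
  by (cases xs) auto

lemma path_ok [simp]:
  assumes "ok xs"
  shows "path xs \<in> Mor C" "src C (path xs) = src C (last xs)" "tgt C (path xs) = tgt C (hd xs)"
proof -
  have "path xs \<in> Mor C \<and> src C (path xs) = src C (last xs) \<and> tgt C (path xs) = tgt C (hd xs)"
    using assms by (induction xs rule: induct_list012) auto
  then show "path xs \<in> Mor C" "src C (path xs) = src C (last xs)" "tgt C (path xs) = tgt C (hd xs)"
    by auto
qed

lemma unbr_Cons: "xs \<noteq> [] \<Longrightarrow>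
    unbr (x # xs) ys = (id2 C x \<star> unbr xs ys) \<bullet> inv2 (assoc C x (path xs) (path ys))"
  by (cases xs) auto

lemma unbr_ok [simp]:
  assumes "ok (xs @ ys)" "xs \<noteq> []" "ys \<noteq> []"
  shows "unbr xs ys \<in> Cell C" "src2 C (unbr xs ys) = path xs \<odot> path ys"
    "tgt2 C (unbr xs ys) = path (xs @ ys)" "invertible (unbr xs ys)"
proof -
  have "unbr xs ys \<in> Cell C \<and> src2 C (unbr xs ys) = path xs \<odot> path ys \<and>
      tgt2 C (unbr xs ys) = path (xs @ ys) \<and> invertible (unbr xs ys)"
    using assms
  proof (induction xs)
    case (Cons x xs)
    show ?case
    proof (cases "xs = []")
      case True
      then show ?thesis using Cons.prems by (auto simp: path_Cons ok_Cons)
    next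
      case False
      then show ?thesis using Cons by (auto simp: unbr_Cons path_Cons ok_append ok_Cons)
    qed
  qed simp
  then show "unbr xs ys \<in> Cell C" "src2 C (unbr xs ys) = path xs \<odot> path ys"
    "tgt2 C (unbr xs ys) = path (xs @ ys)" "invertible (unbr xs ys)" by auto
qed

text \<open>Composites are normalised to the right, so an equation between two-fold composites does
  not match inside a longer one. This version carries the tail \<open>\<gamma>\<close>
  along.\<close>

lemma vcomp_reassoc:
  assumes "\<beta> \<bullet> \<alpha> = \<beta>' \<bullet> \<alpha>'" "\<alpha> \<in> Cell C" "\<beta> \<in> Cell C" "\<gamma> \<in> Cell C" "\<alpha>' \<in> Cell C" "\<beta>' \<in> Cell C"
    "src2 C \<beta> = tgt2 C \<alpha>" "src2 C \<beta>' = tgt2 C \<alpha>'" "src2 C \<alpha> = tgt2 C \<gamma>" "src2 C \<alpha>' = tgt2 C \<gamma>"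
  shows "\<beta> \<bullet> \<alpha> \<bullet> \<gamma> = \<beta>' \<bullet> \<alpha>' \<bullet> \<gamma>"
  using assms by (metis vcomp_vcomp)

text \<open>The coherence behind the whole calculus: flattening three segments gives the same cell
  whether the first two or the last two are joined first. By induction on \<open>xs\<close>, the new
  letter contributes one pentagon, and naturality of the associator moves the remaining cells into
  place.\<close>

lemma unbr_unbr:
  assumes "ok (xs @ ys @ zs)" "xs \<noteq> []" "ys \<noteq> []" "zs \<noteq> []"
  shows "unbr (xs @ ys) zs \<bullet> (unbr xs ys \<star> id2 C (path zs)) =
    unbr xs (ys @ zs) \<bullet> (id2 C (path xs) \<star> unbr ys zs) \<bullet> inv2 (assoc C (path xs) (path ys) (path zs))"
  using assms
proof (induction xs)
  case (Cons x xs)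
  let ?U = unbr and ?a = "\<lambda>f g h. inv2 (assoc C f g h)" and ?i = "\<lambda>xs. id2 C (path xs)"
  have okyz: "ok ys" "ok zs" "src C (last ys) = tgt C (hd zs)" "ok (ys @ zs)"
    using Cons.prems ok_appendD2[of "x # xs" "ys @ zs"] by (auto simp: ok_append)
  show ?case
  proof (cases "xs = []")
    case True
    then show ?thesis using Cons.prems okyz by (auto simp: unbr_Cons ok_Cons path_Cons)
  next
    case False
    note ne = False Cons.prems(2-)
    have okx: "ok xs" "x \<in> Mor C" "src C x = tgt C (hd xs)" "src C (last xs) = tgt C (hd ys)"
      using ne Cons.prems(1) ok_append[of xs "ys @ zs"] by (auto simp: ok_Cons)
    have ok3: "ok (xs @ ys)" "ok (xs @ ys @ zs)" "ok ((xs @ ys) @ zs)"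
      using okx okyz ne by (auto simp: ok_append)
    note o = okx okyz ok3 ne
    note IH = Cons.IH[OF ok3(2) ne(1) ne(3,4)]
    have "?U (x # xs @ ys) zs \<bullet> (?U (x # xs) ys \<star> ?i zs)
      = (id2 C x \<star> ?U (xs @ ys) zs) \<bullet> ?a x (path (xs @ ys)) (path zs) \<bullet> ((id2 C x \<star> ?U xs ys) \<star> ?i zs) \<bullet>
        (?a x (path xs) (path ys) \<star> ?i zs)"
      using o by (simp add: unbr_Cons hcomp_vcomp)
    also have "\<dots> = (id2 C x \<star> ?U (xs @ ys) zs) \<bullet> (id2 C x \<star> (?U xs ys \<star> ?i zs)) \<bullet>
        ?a x (path xs \<odot> path ys) (path zs) \<bullet> (?a x (path xs) (path ys) \<star> ?i zs)"
    proof -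
      have "?a x (path (xs @ ys)) (path zs) \<bullet> ((id2 C x \<star> ?U xs ys) \<star> ?i zs) =
          (id2 C x \<star> (?U xs ys \<star> ?i zs)) \<bullet> ?a x (path xs \<odot> path ys) (path zs)"
        using o assoc_natural'[of "?i zs" "?U xs ys" "id2 C x"] by simp
      from vcomp_reassoc[OF this] show ?thesis using o by simp
    qed
    also have "\<dots> = (id2 C x \<star> (?U (xs @ ys) zs \<bullet> (?U xs ys \<star> ?i zs))) \<bullet>
        ?a x (path xs \<odot> path ys) (path zs) \<bullet> (?a x (path xs) (path ys) \<star> ?i zs)"
      using o by (simp add: hcomp_vcomp flip: vcomp_vcomp)
    also have "\<dots> = (id2 C x \<star> ?U xs (ys @ zs)) \<bullet> (id2 C x \<star> (?i xs \<star> ?U ys zs)) \<bullet>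
        (id2 C x \<star> ?a (path xs) (path ys) (path zs)) \<bullet>
        ?a x (path xs \<odot> path ys) (path zs) \<bullet> (?a x (path xs) (path ys) \<star> ?i zs)"
      unfolding IH using o by (simp add: hcomp_vcomp flip: vcomp_vcomp)
    \<comment> \<open>The pentagon merges the three inverse associators into two.\<close>
    also have "\<dots> = (id2 C x \<star> ?U xs (ys @ zs)) \<bullet> (id2 C x \<star> (?i xs \<star> ?U ys zs)) \<bullet>
        ?a x (path xs) (path ys \<odot> path zs) \<bullet> ?a (x \<odot> path xs) (path ys) (path zs)"
      using o by (simp add: pentagon_inv)
    also have "\<dots> = (id2 C x \<star> ?U xs (ys @ zs)) \<bullet> ?a x (path xs) (path (ys @ zs)) \<bullet>
        ((id2 C x \<star> ?i xs) \<star> ?U ys zs) \<bullet> ?a (x \<odot> path xs) (path ys) (path zs)"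
    proof -
      have "?a x (path xs) (path (ys @ zs)) \<bullet> ((id2 C x \<star> ?i xs) \<star> ?U ys zs) =
          (id2 C x \<star> (?i xs \<star> ?U ys zs)) \<bullet> ?a x (path xs) (path ys \<odot> path zs)"
        using o assoc_natural'[of "?U ys zs" "?i xs" "id2 C x"] by simp
      from vcomp_reassoc[OF this] show ?thesis using o by simp
    qed
    also have "\<dots> = ?U (x # xs) (ys @ zs) \<bullet> (?i (x # xs) \<star> ?U ys zs) \<bullet>
        ?a (path (x # xs)) (path ys) (path zs)"
      using o by (simp add: unbr_Cons path_Cons)
    finally show ?thesis by simp
  qed
qed simp

section \<open>Left and right whiskering of cells between paths\<close>

definition pcl :: "'m list \<Rightarrow> 'm list \<Rightarrow> 'c \<Rightarrow> bool" where
  "pcl xs ys \<alpha> \<longleftrightarrow> ok xs \<and> ok ys \<and> \<alpha> \<in> Cell C \<and> src2 C \<alpha> = path xs \<and> tgt2 C \<alpha> = path ys"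

lemma pcl_parallel:
  assumes "pcl xs ys \<alpha>"
  shows "src C (last ys) = src C (last xs)" "tgt C (hd ys) = tgt C (hd xs)"
  using assms Cell_Mor(3,4)[of \<alpha>] by (auto simp: pcl_def)

lemma pcl_simps:
  assumes "pcl xs ys \<alpha>"
  shows "ok xs" "ok ys" "xs \<noteq> []" "ys \<noteq> []" "\<alpha> \<in> Cell C" "src2 C \<alpha> = path xs" "tgt2 C \<alpha> = path ys"
    "src C (last ys) = src C (last xs)" "tgt C (hd ys) = tgt C (hd xs)"
  using assms pcl_parallel by (auto simp: pcl_def)

lemma ok_append_iff: "ok (xs @ ys) \<longleftrightarrow> (if xs = [] then ok ys else if ys = [] then ok xs else
    ok xs \<and> ok ys \<and> src C (last xs) = tgt C (hd ys))"
  by (simp add: ok_append)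

lemma pcl_vcomp: "pcl xs ys \<alpha> \<Longrightarrow> pcl ys zs \<beta> \<Longrightarrow> pcl xs zs (\<beta> \<bullet> \<alpha>)"
  by (simp add: pcl_def)

text \<open>With brackets to the right, whiskering on the left is iterated horizontal composition
  with identities and needs no associators. Only whiskering on the right has to be conjugated by
  \<open>unbr\<close>.\<close>

abbreviation (input) lwh :: "'m list \<Rightarrow> 'c \<Rightarrow> 'c" where
  "lwh ps \<alpha> \<equiv> foldr (\<lambda>p \<theta>. id2 C p \<star> \<theta>) ps \<alpha>"

lemma pcl_lwh: "pcl xs ys \<alpha> \<Longrightarrow> ok (ps @ xs) \<Longrightarrow> pcl (ps @ xs) (ps @ ys) (lwh ps \<alpha>)"
proof (induction ps)
  case (Cons p ps)
  note s = pcl_simps[OF Cons.prems(1)]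
  have "ok (ps @ xs)" "ps @ xs \<noteq> []" "p \<in> Mor C" "src C p = tgt C (hd (ps @ xs))"
    using Cons.prems s by (auto simp: ok_Cons)
  then show ?case using Cons.IH[OF Cons.prems(1)] s pcl_simps(9)[OF Cons.IH[OF Cons.prems(1)]]
    by (auto simp: pcl_def path_Cons ok_Cons)
qed simp

lemma lwh_vcomp: "pcl xs ys \<alpha> \<Longrightarrow> pcl ys zs \<beta> \<Longrightarrow> ok (ps @ xs) \<Longrightarrow>
    lwh ps (\<beta> \<bullet> \<alpha>) = lwh ps \<beta> \<bullet> lwh ps \<alpha>"
proof (induction ps)
  case (Cons p ps)
  note s = pcl_simps[OF Cons.prems(1)] pcl_simps[OF Cons.prems(2)]
  have o: "ok (ps @ xs)" "ps @ xs \<noteq> []" "p \<in> Mor C" "src C p = tgt C (hd (ps @ xs))"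
    using Cons.prems s by (auto simp: ok_Cons)
  have o2: "ok (ps @ ys)" using s o by (auto simp: ok_append_iff)
  have t: "pcl (ps @ xs) (ps @ ys) (lwh ps \<alpha>)" "pcl (ps @ ys) (ps @ zs) (lwh ps \<beta>)"
    using pcl_lwh Cons.prems o o2 by blast+
  show ?case using Cons.IH[OF Cons.prems(1,2) o(1)] pcl_simps[OF t(1)] pcl_simps[OF t(2)] o
    by (simp add: hcomp_vcomp)
qed simp

lemma lwh_id2: "ok (ps @ xs) \<Longrightarrow> xs \<noteq> [] \<Longrightarrow> lwh ps (id2 C (path xs)) = id2 C (path (ps @ xs))"
  by (induction ps) (auto simp: ok_Cons path_Cons)

lemma pcl_rwhisk:
  assumes "pcl xs ys \<alpha>" "ok (xs @ qs)"
  shows "pcl (xs @ qs) (ys @ qs) (rwhisk xs ys qs \<alpha>)"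
proof (cases "qs = []")
  case False
  note s = pcl_simps[OF assms(1)]
  have "ok (ys @ qs)" "ok qs" "src C (last xs) = tgt C (hd qs)" using assms s False by (auto simp: ok_append)
  then show ?thesis using s assms(2) False by (auto simp: pcl_def rwhisk_def)
qed (use assms in \<open>simp add: rwhisk_def\<close>)

lemma rwhisk_vcomp:
  assumes "pcl xs ys \<alpha>" "pcl ys zs \<beta>" "ok (xs @ qs)"
  shows "rwhisk xs zs qs (\<beta> \<bullet> \<alpha>) = rwhisk ys zs qs \<beta> \<bullet> rwhisk xs ys qs \<alpha>"
proof (cases "qs = []")
  case False
  note s = pcl_simps[OF assms(1)] pcl_simps[OF assms(2)]
  have "ok (ys @ qs)" "ok (zs @ qs)" "ok qs" "src C (last xs) = tgt C (hd qs)"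
    using assms s False by (auto simp: ok_append)
  note o = this False s assms(3)
  have "(\<beta> \<bullet> \<alpha>) \<star> id2 C (path qs) = (\<beta> \<star> id2 C (path qs)) \<bullet> (\<alpha> \<star> id2 C (path qs))"
    using o by (simp add: hcomp_vcomp)
  then show ?thesis using o by (simp add: rwhisk_def)
qed (simp add: rwhisk_def)

lemma rwhisk_id2:
  assumes "ok (xs @ qs)" "xs \<noteq> []"
  shows "rwhisk xs xs qs (id2 C (path xs)) = id2 C (path (xs @ qs))"
proof (cases "qs = []")
  case False
  then have "ok xs" "ok qs" "src C (last xs) = tgt C (hd qs)" using assms by (auto simp: ok_append)
  then show ?thesis using assms False by (simp add: rwhisk_def)
qed (simp add: rwhisk_def)

text \<open>Left and right whiskering commute by naturality of the associator in its middle
  argument: the associators that \<open>unbr\<close> acquires from the letter \<open>p\<close> on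
  both sides cancel.\<close>

lemma rwhisk_lwh1:
  assumes "pcl xs ys \<alpha>" "ok (p # xs @ qs)"
  shows "rwhisk (p # xs) (p # ys) qs (id2 C p \<star> \<alpha>) = id2 C p \<star> rwhisk xs ys qs \<alpha>"
proof (cases "qs = []")
  case False
  let ?i = "id2 C (path qs)"
  note s = pcl_simps[OF assms(1)]
  have "ok (xs @ qs)" "ok (ys @ qs)" "ok qs" "src C (last xs) = tgt C (hd qs)" "p \<in> Mor C"
      "src C p = tgt C (hd xs)"
    using assms s False by (auto simp: ok_append ok_Cons)
  note o = this False s assms(2)
  have "rwhisk (p # xs) (p # ys) qs (id2 C p \<star> \<alpha>) =
    (id2 C p \<star> unbr ys qs) \<bullet> inv2 (assoc C p (path ys) (path qs)) \<bullet> ((id2 C p \<star> \<alpha>) \<star> ?i) \<bullet>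
    assoc C p (path xs) (path qs) \<bullet> (id2 C p \<star> inv2 (unbr xs qs))"
    using o by (simp add: rwhisk_def unbr_Cons inv2_vcomp inv2_hcomp is_inverse_inv2[THEN inv2_eq])
  also have "\<dots> = (id2 C p \<star> unbr ys qs) \<bullet> (id2 C p \<star> (\<alpha> \<star> ?i)) \<bullet> inv2 (assoc C p (path xs) (path qs)) \<bullet>
    assoc C p (path xs) (path qs) \<bullet> (id2 C p \<star> inv2 (unbr xs qs))"
  proof -
    have "inv2 (assoc C p (path ys) (path qs)) \<bullet> ((id2 C p \<star> \<alpha>) \<star> ?i) =
        (id2 C p \<star> (\<alpha> \<star> ?i)) \<bullet> inv2 (assoc C p (path xs) (path qs))"
      using o assoc_natural'[of ?i \<alpha> "id2 C p"] by simp
    from vcomp_reassoc[OF this] show ?thesis using o by simp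
  qed
  also have "\<dots> = id2 C p \<star> rwhisk xs ys qs \<alpha>"
    using o by (simp add: rwhisk_def hcomp_vcomp)
  finally show ?thesis .
qed (simp add: rwhisk_def)

lemma rwhisk_lwh:
  "pcl xs ys \<alpha> \<Longrightarrow> ok (ps @ xs @ qs) \<Longrightarrow>
    rwhisk (ps @ xs) (ps @ ys) qs (lwh ps \<alpha>) = lwh ps (rwhisk xs ys qs \<alpha>)"
proof (induction ps)
  case (Cons p ps)
  have "xs \<noteq> []" using pcl_simps[OF Cons.prems(1)] by simp
  then have "ok (ps @ xs @ qs)" using Cons.prems by (auto simp: ok_Cons)
  then show ?case using Cons rwhisk_lwh1[OF pcl_lwh, of xs ys \<alpha> ps p qs] ok_appendD1[of "ps @ xs" qs] \<open>xs
      \<noteq> []\<close>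
    by simp
qed simp

text \<open>\<open>unbr_unbr\<close> is applied at the target and, inverted, at the source. What
  remains in the middle is naturality of the associator, after which the two copies of
  \<open>unbr qs rs\<close> cancel against each other.\<close>

lemma rwhisk_rwhisk:
  assumes "pcl xs ys \<alpha>" "ok (xs @ qs @ rs)"
  shows "rwhisk (xs @ qs) (ys @ qs) rs (rwhisk xs ys qs \<alpha>) = rwhisk xs ys (qs @ rs) \<alpha>"
proof (cases "qs = [] \<or> rs = []")
  case False
  let ?q = "path qs" and ?r = "path rs" let ?i = "id2 C ?q"
      and ?j = "id2 C ?r" let ?a = "\<lambda>x. inv2 (assoc C x ?q ?r)"
  note s = pcl_simps[OF assms(1)]
  have "ok (xs @ qs)" "ok (ys @ qs)" "ok (qs @ rs)" "ok qs" "ok rs" "src C (last xs) = tgt C (hd qs)"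
    "src C (last qs) = tgt C (hd rs)" "ok (ys @ qs @ rs)"
    using assms s False by (auto simp: ok_append)
  note o = this False s assms(2)
  have U: "unbr (zs @ qs) rs \<bullet> (unbr zs qs \<star> ?j) = unbr zs (qs @ rs) \<bullet> (id2 C (path zs) \<star> unbr qs rs) \<bullet>
      ?a (path zs)"
    if "zs = xs \<or> zs = ys" for zs using unbr_unbr[of zs qs rs] o that by blast
  have Ui: "(inv2 (unbr xs qs) \<star> ?j) \<bullet> inv2 (unbr (xs @ qs) rs) =
      assoc C (path xs) ?q ?r \<bullet> (id2 C (path xs) \<star> inv2 (unbr qs rs)) \<bullet> inv2 (unbr xs (qs @ rs))"
    using arg_cong[OF U[of xs], of inv2] o by (simp add: inv2_vcomp inv2_hcomp is_inverse_inv2[THEN inv2_eq])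
  have "rwhisk (xs @ qs) (ys @ qs) rs (rwhisk xs ys qs \<alpha>) =
    unbr (ys @ qs) rs \<bullet> ((unbr ys qs \<bullet> (\<alpha> \<star> ?i) \<bullet> inv2 (unbr xs qs)) \<star> ?j) \<bullet> inv2 (unbr (xs @ qs) rs)"
    using o by (simp add: rwhisk_def)
  also have "(unbr ys qs \<bullet> (\<alpha> \<star> ?i) \<bullet> inv2 (unbr xs qs)) \<star> ?j =
    (unbr ys qs \<star> ?j) \<bullet> ((\<alpha> \<star> ?i) \<star> ?j) \<bullet> (inv2 (unbr xs qs) \<star> ?j)"
    using o by (simp add: hcomp_vcomp)
  also have "unbr (ys @ qs) rs \<bullet> \<dots> \<bullet> inv2 (unbr (xs @ qs) rs) =
    (unbr (ys @ qs) rs \<bullet> (unbr ys qs \<star> ?j)) \<bullet> ((\<alpha> \<star> ?i) \<star> ?j) \<bullet> ((inv2 (unbr xs qs) \<star> ?j) \<bullet> inv2 (unbr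
        (xs @ qs) rs))"
    using o by simp
  also have "\<dots> = unbr ys (qs @ rs) \<bullet> (id2 C (path ys) \<star> unbr qs rs) \<bullet> (?a (path ys) \<bullet> ((\<alpha> \<star> ?i) \<star> ?j)) \<bullet>
      assoc C (path xs) ?q ?r \<bullet> (id2 C (path xs) \<star> inv2 (unbr qs rs)) \<bullet> inv2 (unbr xs (qs @ rs))"
    unfolding Ui using U[of ys] o by simp
  also have "?a (path ys) \<bullet> ((\<alpha> \<star> ?i) \<star> ?j) = (\<alpha> \<star> (?i \<star> ?j)) \<bullet> ?a (path xs)"
    using assoc_natural'[of ?j ?i \<alpha>] o by simp
  also have "unbr ys (qs @ rs) \<bullet> (id2 C (path ys) \<star> unbr qs rs) \<bullet> \<dots> \<bullet>
      assoc C (path xs) ?q ?r \<bullet> (id2 C (path xs) \<star> inv2 (unbr qs rs)) \<bullet> inv2 (unbr xs (qs @ rs)) =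
    unbr ys (qs @ rs) \<bullet> ((id2 C (path ys) \<star> unbr qs rs) \<bullet> (\<alpha> \<star> (?i \<star> ?j)) \<bullet>
      (id2 C (path xs) \<star> inv2 (unbr qs rs))) \<bullet> inv2 (unbr xs (qs @ rs))"
    using o by simp
  also have "(id2 C (path ys) \<star> unbr qs rs) \<bullet> (\<alpha> \<star> (?i \<star> ?j)) \<bullet> (id2 C (path xs) \<star> inv2 (unbr qs rs)) =
    \<alpha> \<star> id2 C (path (qs @ rs))"
    using o by (simp add: hcomp_vcomp)
  finally show ?thesis using o by (simp add: rwhisk_def)
qed (auto simp: rwhisk_def)

text \<open>Naturality of the rebracketing cell in its second segment. It identifies iterated left
  whiskering with one horizontal composition by the identity of \<open>path us\<close>.\<close>

lemma lwh_unbr: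
  "pcl xs ys \<alpha> \<Longrightarrow> ok (us @ xs) \<Longrightarrow> us \<noteq> [] \<Longrightarrow>
    lwh us \<alpha> \<bullet> unbr us xs = unbr us ys \<bullet> (id2 C (path us) \<star> \<alpha>)"
proof (induction us)
  case (Cons u us)
  note s = pcl_simps[OF Cons.prems(1)]
  have "u \<in> Mor C" "src C u = tgt C (hd (us @ xs))" "ok (us @ xs)" using Cons.prems s by (auto simp: ok_Cons)
  note o = this s
  show ?case
  proof (cases "us = []")
    case False
    have "ok us" "src C (last us) = tgt C (hd xs)" "ok (us @ ys)" using o False by (auto simp: ok_append)
    note o = this o False
    have t: "pcl (us @ xs) (us @ ys) (lwh us \<alpha>)" using pcl_lwh Cons.prems o by blast
    have "lwh (u # us) \<alpha> \<bullet> unbr (u # us) xs =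
      (id2 C u \<star> (lwh us \<alpha> \<bullet> unbr us xs)) \<bullet> inv2 (assoc C u (path us) (path xs))"
      using o pcl_simps[OF t] by (simp add: unbr_Cons hcomp_vcomp flip: vcomp_vcomp)
    also have "\<dots> = (id2 C u \<star> unbr us ys) \<bullet> (id2 C u \<star> (id2 C (path us) \<star> \<alpha>)) \<bullet>
        inv2 (assoc C u (path us) (path xs))"
      using Cons.IH[OF Cons.prems(1)] o by (simp add: hcomp_vcomp flip: vcomp_vcomp)
    also have "\<dots> = unbr (u # us) ys \<bullet> (id2 C (path (u # us)) \<star> \<alpha>)"
      using o assoc_natural'[of \<alpha> "id2 C (path us)" "id2 C u"] by (simp add: unbr_Cons path_Cons)
    finally show ?thesis .
  qed (use o in simp)
qed simp

text \<open>After conjugation by \<open>unbr\<close>, both whiskerings are horizontal compositions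
  with a single identity, and the law becomes the interchange axiom.\<close>

lemma whisk_interchange:
  assumes "pcl xs ys \<alpha>" "pcl us vs \<beta>" "ok (us @ xs)"
  shows "rwhisk us vs ys \<beta> \<bullet> lwh us \<alpha> = lwh vs \<alpha> \<bullet> rwhisk us vs xs \<beta>"
proof -
  note s = pcl_simps[OF assms(1)] pcl_simps[OF assms(2)]
  have "ok (us @ ys)" "ok (vs @ xs)" "ok (vs @ ys)" "src C (last us) = tgt C (hd xs)"
    using assms s by (auto simp: ok_append)
  note o = this s assms(3)
  have l: "lwh zs \<alpha> = unbr zs ys \<bullet> (id2 C (path zs) \<star> \<alpha>) \<bullet> inv2 (unbr zs xs)" if "zs = us \<or> zs = vs" for zs
  proof -
    have z: "ok (zs @ xs)" "zs \<noteq> []" "ok (zs @ ys)" "ok zs" "src C (last zs) = tgt C (hd xs)" using that o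
        by auto
    have t: "pcl (zs @ xs) (zs @ ys) (lwh zs \<alpha>)" using pcl_lwh assms z by blast
    have "lwh zs \<alpha> = (lwh zs \<alpha> \<bullet> unbr zs xs) \<bullet> inv2 (unbr zs xs)" using z o pcl_simps[OF t] by simp
    then show ?thesis using lwh_unbr[OF assms(1) z(1,2)] z o by simp
  qed
  have "rwhisk us vs ys \<beta> \<bullet> lwh us \<alpha> =
    unbr vs ys \<bullet> ((\<beta> \<star> id2 C (path ys)) \<bullet> (id2 C (path us) \<star> \<alpha>)) \<bullet> inv2 (unbr us xs)"
    using o by (simp add: rwhisk_def l)
  also have "(\<beta> \<star> id2 C (path ys)) \<bullet> (id2 C (path us) \<star> \<alpha>) = (id2 C (path vs) \<star> \<alpha>) \<bullet> (\<beta> \<star> id2 C (path xs))"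
    using o by (simp add: hcomp_vcomp)
  finally show ?thesis using o by (simp add: rwhisk_def l)
qed

end

section \<open>The strict calculus of cells between paths\<close>

text \<open>Cells carry the paths they are taken between; all operations are total and return the
  ill-formed cell \<open>bad\<close> when they are undefined, so that the laws of a strict 2-category (without
  identity 1-morphisms: the empty path occurs only as trivial whiskering) hold unconditionally.\<close>

datatype ('m, 'c) pcell = Pcell (psrc: "'m list") (ptgt: "'m list") (pval: 'c)

context bicategory
begin

definition pwf :: "('m, 'c) pcell \<Rightarrow> bool" where
  "pwf a \<longleftrightarrow> pcl (psrc a) (ptgt a) (pval a)"

definition bad :: "('m, 'c) pcell" where
  "bad = Pcell [] [] undefined"

definition pvcomp :: "('m, 'c) pcell \<Rightarrow> ('m, 'c) pcell \<Rightarrow> ('m, 'c) pcell" (infixr "\<cdot>" 65) where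
  "b \<cdot> a = (if pwf a \<and> pwf b \<and> psrc b = ptgt a then Pcell (psrc a) (ptgt b) (pval b \<bullet> pval a) else bad)"

text \<open>The clause for the empty list precedes the test of well-formedness, so that whiskering
  by \<open>[]\<close> changes nothing even for ill-formed cells; the same is done on the
  right.\<close>

definition plwhisk :: "'m list \<Rightarrow> ('m, 'c) pcell \<Rightarrow> ('m, 'c) pcell" (infixr "\<rhd>" 75) where
  "ps \<rhd> a = (if ps = [] then a else if pwf a \<and> ok (ps @ psrc a)
     then Pcell (ps @ psrc a) (ps @ ptgt a) (lwh ps (pval a)) else bad)"

definition prwhisk :: "('m, 'c) pcell \<Rightarrow> 'm list \<Rightarrow> ('m, 'c) pcell" (infixl "\<lhd>" 76) where
  "a \<lhd> qs = (if qs = [] then a else if pwf a \<and> ok (psrc a @ qs)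
     then Pcell (psrc a @ qs) (ptgt a @ qs) (rwhisk (psrc a) (ptgt a) qs (pval a)) else bad)"

definition pid :: "'m list \<Rightarrow> ('m, 'c) pcell" where
  "pid xs = Pcell xs xs (id2 C (path xs))"

definition piso :: "('m, 'c) pcell \<Rightarrow> bool" where
  "piso a \<longleftrightarrow> pwf a \<and> invertible (pval a)"

definition piv :: "('m, 'c) pcell \<Rightarrow> ('m, 'c) pcell" where
  "piv a = (if piso a then Pcell (ptgt a) (psrc a) (inv2 (pval a)) else bad)"

text \<open>An identity 2-cell, read as a cell from a one-letter path to the path it abbreviates.
  Whiskered on the right it becomes the rebracketing \<open>unbr\<close>, so every rebracketing is a
  cell of the calculus and obeys interchange like any other.\<close>

definition pcol :: "'m list \<Rightarrow> ('m, 'c) pcell" where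
  "pcol xs = Pcell [path xs] xs (id2 C (path xs))"

lemma pwf_ok:
  assumes "pwf a"
  shows "ok (psrc a)" "ok (ptgt a)" "psrc a \<noteq> []" "ptgt a \<noteq> []"
    "src C (last (ptgt a)) = src C (last (psrc a))" "tgt C (hd (ptgt a)) = tgt C (hd (psrc a))"
    "pval a \<in> Cell C" "src2 C (pval a) = path (psrc a)" "tgt2 C (pval a) = path (ptgt a)"
  using assms pcl_simps by (auto simp: pwf_def)

section \<open>Unconditional laws of composition and whiskering\<close>

lemma not_pwf_bad [simp]: "\<not> pwf bad"
  by (simp add: pwf_def bad_def pcl_def)

lemma pwf_pvcomp [simp]: "pwf (b \<cdot> a) \<longleftrightarrow> pwf a \<and> pwf b \<and> psrc b = ptgt a"
  by (auto simp: pvcomp_def pwf_def[of "Pcell _ _ _"] intro!: pcl_vcomp) (auto simp: pwf_def)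

lemma pvcomp_bad: "\<not> (pwf a \<and> pwf b \<and> psrc b = ptgt a) \<Longrightarrow> b \<cdot> a = bad"
  by (simp only: pvcomp_def if_False)

lemma psrc_pvcomp [simp]:
  assumes "pwf a" "pwf b" "psrc b = ptgt a"
  shows "psrc (b \<cdot> a) = psrc a" "ptgt (b \<cdot> a) = ptgt b" "pval (b \<cdot> a) = pval b \<bullet> pval a"
  using assms by (simp_all add: pvcomp_def)

lemma pwf_plwhisk [simp]: "pwf (ps \<rhd> a) \<longleftrightarrow> pwf a \<and> ok (ps @ psrc a)"
  using pwf_ok[of a] by (auto simp: plwhisk_def pwf_def[of "Pcell _ _ _"] intro!: pcl_lwh) (auto
      simp: pwf_def)

lemma psrc_plwhisk [simp]:
  assumes "pwf a" "ok (ps @ psrc a)"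
  shows "psrc (ps \<rhd> a) = ps @ psrc a" "ptgt (ps \<rhd> a) = ps @ ptgt a"
  using assms by (simp_all add: plwhisk_def)

lemma pwf_prwhisk [simp]: "pwf (a \<lhd> qs) \<longleftrightarrow> pwf a \<and> ok (psrc a @ qs)"
  using pwf_ok[of a] by (auto simp: prwhisk_def pwf_def[of "Pcell _ _ _"] intro!: pcl_rwhisk) (auto
      simp: pwf_def)

lemma psrc_prwhisk [simp]:
  assumes "pwf a" "ok (psrc a @ qs)"
  shows "psrc (a \<lhd> qs) = psrc a @ qs" "ptgt (a \<lhd> qs) = ptgt a @ qs"
  using assms by (simp_all add: prwhisk_def)

lemma pval_plwhisk: "pwf a \<Longrightarrow> ok (ps @ psrc a) \<Longrightarrow> pval (ps \<rhd> a) = lwh ps (pval a)"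
  by (simp add: plwhisk_def)

lemma pval_prwhisk: "pwf a \<Longrightarrow> ok (psrc a @ qs) \<Longrightarrow> pval (a \<lhd> qs) = rwhisk (psrc a) (ptgt a) qs (pval a)"
  by (simp add: prwhisk_def rwhisk_def)

lemma ok_ptgt_prwhisk: "pwf a \<Longrightarrow> ok (ptgt a @ qs) \<longleftrightarrow> ok (psrc a @ qs)"
  using pwf_ok[of a] by (auto simp: ok_append_iff)

lemma ok_ptgt_plwhisk: "pwf a \<Longrightarrow> ok (ps @ ptgt a) \<longleftrightarrow> ok (ps @ psrc a)"
  using pwf_ok[of a] by (auto simp: ok_append_iff)

lemma pcell_eqI: "psrc a = psrc b \<Longrightarrow> ptgt a = ptgt b \<Longrightarrow> pval a = pval b \<Longrightarrow> a = b"
  by (cases a; cases b) simp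

lemma pval_whisk:
  assumes "pwf a" "ok (ps @ psrc a @ qs)"
  shows "pval (ps \<rhd> (a \<lhd> qs)) = whisk ps (psrc a) (ptgt a) qs (pval a)"
proof -
  have "ok (psrc a @ qs)" using ok_appendD2[OF assms(2)] pwf_ok[OF assms(1)] by simp
  then show ?thesis using assms by (simp add: pval_plwhisk pval_prwhisk whisk_def)
qed

lemma plwhisk_Nil [simp]: "[] \<rhd> a = a"
  by (simp add: plwhisk_def)

lemma prwhisk_Nil [simp]: "a \<lhd> [] = a"
  by (simp add: prwhisk_def)

lemma plwhisk_bad: "\<not> (pwf a \<and> ok (ps @ psrc a)) \<Longrightarrow> ps \<noteq> [] \<Longrightarrow> ps \<rhd> a = bad"
  by (simp only: plwhisk_def if_False)

lemma prwhisk_bad: "\<not> (pwf a \<and> ok (psrc a @ qs)) \<Longrightarrow> qs \<noteq> [] \<Longrightarrow> a \<lhd> qs = bad"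
  by (simp only: prwhisk_def if_False)

text \<open>Both sides are well-formed under the same conditions, where the law is that of the raw
  cells; otherwise both equal \<open>bad\<close>. The laws of whiskering below follow the same
  split.\<close>

lemma pvcomp_assoc [simp]: "(c \<cdot> b) \<cdot> a = c \<cdot> b \<cdot> a"
proof (cases "pwf ((c \<cdot> b) \<cdot> a)")
  case True
  then have w: "pwf a" "pwf b" "pwf c" "psrc c = ptgt b" "psrc b = ptgt a" by auto
  then show ?thesis using pwf_ok by (intro pcell_eqI) auto
next
  case False
  then have "\<not> pwf (c \<cdot> b \<cdot> a)" by auto
  with False show ?thesis by (metis pvcomp_bad pwf_pvcomp)
qed

lemma plwhisk_pvcomp [simp]: "ps \<rhd> (b \<cdot> a) = ps \<rhd> b \<cdot> ps \<rhd> a"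
proof (cases "ps = []")
  case ne: False
  show ?thesis
  proof (cases "pwf (ps \<rhd> (b \<cdot> a))")
    case True
    then have w: "pwf a" "pwf b" "psrc b = ptgt a" "ok (ps @ psrc a)" by auto
    moreover have "ok (ps @ ptgt a)" using w ok_ptgt_plwhisk by blast
    moreover have "lwh ps (pval b \<bullet> pval a) = lwh ps (pval b) \<bullet> lwh ps (pval a)"
      using lwh_vcomp[of "psrc a" "ptgt a" "pval a" "ptgt b" "pval b" ps] w by (simp add: pwf_def)
    ultimately show ?thesis using ne by (intro pcell_eqI) (simp_all add: pval_plwhisk pval_prwhisk)
  next
    case False
    have "\<not> pwf (ps \<rhd> b \<cdot> ps \<rhd> a)"
    proof
      assume *: "pwf (ps \<rhd> b \<cdot> ps \<rhd> a)"
      then have "pwf a" "pwf b" "ok (ps @ psrc a)" "ok (ps @ psrc b)" by auto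
      with * False show False by auto
    qed
    with False ne show ?thesis by (metis pvcomp_bad pwf_pvcomp plwhisk_bad pwf_plwhisk)
  qed
qed simp

lemma prwhisk_pvcomp [simp]: "(b \<cdot> a) \<lhd> qs = b \<lhd> qs \<cdot> a \<lhd> qs"
proof (cases "qs = []")
  case ne: False
  show ?thesis
  proof (cases "pwf ((b \<cdot> a) \<lhd> qs)")
    case True
    then have w: "pwf a" "pwf b" "psrc b = ptgt a" "ok (psrc a @ qs)" by auto
    moreover have "ok (ptgt a @ qs)" using w ok_ptgt_prwhisk by blast
    moreover have "rwhisk (psrc a) (ptgt b) qs (pval b \<bullet> pval a) =
        rwhisk (ptgt a) (ptgt b) qs (pval b) \<bullet> rwhisk (psrc a) (ptgt a) qs (pval a)"
      using rwhisk_vcomp[of "psrc a" "ptgt a" "pval a" "ptgt b" "pval b" qs] w by (simp add: pwf_def)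
    ultimately show ?thesis using ne by (intro pcell_eqI) (simp_all add: pval_plwhisk pval_prwhisk)
  next
    case False
    have "\<not> pwf (b \<lhd> qs \<cdot> a \<lhd> qs)"
    proof
      assume *: "pwf (b \<lhd> qs \<cdot> a \<lhd> qs)"
      then have "pwf a" "pwf b" "ok (psrc a @ qs)" "ok (psrc b @ qs)" by auto
      with * False show False by auto
    qed
    with False ne show ?thesis by (metis pvcomp_bad pwf_pvcomp prwhisk_bad pwf_prwhisk)
  qed
qed simp

lemma plwhisk_plwhisk [simp]: "ps \<rhd> qs \<rhd> a = (ps @ qs) \<rhd> a"
proof (cases "ps = [] \<or> qs = []")
  case ne: False
  show ?thesis
  proof (cases "pwf a \<and> ok (ps @ qs @ psrc a)")
    case True
    moreover have "ok (qs @ psrc a)" using ok_appendD2[of ps "qs @ psrc a"] True ne by simp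
    ultimately show ?thesis using ne by (intro pcell_eqI) (simp_all add: pval_plwhisk pval_prwhisk)
  next
    case False
    then have "\<not> pwf (ps \<rhd> qs \<rhd> a)" by auto
    with False ne show ?thesis by (metis plwhisk_bad pwf_plwhisk append_assoc append_is_Nil_conv)
  qed
qed auto

lemma prwhisk_prwhisk [simp]: "a \<lhd> ps \<lhd> qs = a \<lhd> (ps @ qs)"
proof (cases "ps = [] \<or> qs = []")
  case ne: False
  show ?thesis
  proof (cases "pwf a \<and> ok (psrc a @ ps @ qs)")
    case True
    moreover have "ok (psrc a @ ps)" using ok_appendD1[of "psrc a @ ps" qs] True ne by simp
    moreover have "pwf a \<Longrightarrow> ok (psrc a @ ps @ qs) \<Longrightarrow> rwhisk (psrc a @ ps) (ptgt a @ ps) qs (rwhisk (psrc a)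
        (ptgt a) ps (pval a)) =
        rwhisk (psrc a) (ptgt a) (ps @ qs) (pval a)" unfolding pwf_def by (rule rwhisk_rwhisk)
    ultimately show ?thesis using ne
      by (intro pcell_eqI) (simp_all add: pval_plwhisk pval_prwhisk)
  next
    case False
    then have "\<not> pwf (a \<lhd> ps \<lhd> qs)" by auto
    with False ne show ?thesis by (metis prwhisk_bad pwf_prwhisk append_assoc append_is_Nil_conv)
  qed
qed auto

lemma prwhisk_plwhisk [simp]: "(ps \<rhd> a) \<lhd> qs = ps \<rhd> (a \<lhd> qs)"
proof (cases "ps = [] \<or> qs = []")
  case ne: False
  show ?thesis
  proof (cases "pwf a \<and> ok (ps @ psrc a @ qs)")
    case True
    moreover have "ok (psrc a @ qs)" "ok (ps @ psrc a)"
      using ok_appendD2[of ps "psrc a @ qs"] ok_appendD1[of "ps @ psrc a" qs] True ne by simp_all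
    moreover have "pwf a \<Longrightarrow> ok (ps @ psrc a @ qs) \<Longrightarrow> rwhisk (ps @ psrc a) (ps @ ptgt a) qs (lwh ps (pval a)) =
        lwh ps (rwhisk (psrc a) (ptgt a) qs (pval a))" unfolding pwf_def by (rule rwhisk_lwh)
    ultimately show ?thesis using ne
      by (intro pcell_eqI) (simp_all add: pval_plwhisk pval_prwhisk)
  next
    case False
    then have "\<not> pwf ((ps \<rhd> a) \<lhd> qs)" "\<not> pwf (ps \<rhd> (a \<lhd> qs))"
      using ok_appendD1[of "ps @ psrc a" qs] ok_appendD2[of ps "psrc a @ qs"] pwf_ok[of a] by auto
    with ne show ?thesis by (metis prwhisk_bad pwf_prwhisk plwhisk_bad pwf_plwhisk)
  qed
qed auto

text \<open>The one rule for moving cells past each other. With \<open>b\<close> a rebracketing, a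
  junction or an identification of a presentation, it serves as the naturality of that cell.\<close>

lemma pinterchange: "b \<lhd> ptgt a \<cdot> psrc b \<rhd> a = ptgt b \<rhd> a \<cdot> b \<lhd> psrc a"
proof (cases "pwf a \<and> pwf b \<and> ok (psrc b @ psrc a)")
  case True
  then have w: "pwf a" "pwf b" "ok (psrc b @ psrc a)" by auto
  have o: "ok (psrc b @ ptgt a)" "ok (ptgt b @ psrc a)" using w ok_ptgt_plwhisk ok_ptgt_prwhisk by blast+
  have "rwhisk (psrc b) (ptgt b) (ptgt a) (pval b) \<bullet> lwh (psrc b) (pval a) =
      lwh (ptgt b) (pval a) \<bullet> rwhisk (psrc b) (ptgt b) (psrc a) (pval b)"
    using whisk_interchange[of "psrc a" "ptgt a" "pval a" "psrc b" "ptgt b" "pval b"] w by (simp add: pwf_def)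
  then show ?thesis
    using w o pwf_ok[OF w(1)] pwf_ok[OF w(2)]
    by (intro pcell_eqI) (simp_all add: pval_plwhisk pval_prwhisk)
next
  case False
  then have "\<not> pwf (b \<lhd> ptgt a \<cdot> psrc b \<rhd> a)" by auto
  moreover have "\<not> pwf (ptgt b \<rhd> a \<cdot> b \<lhd> psrc a)"
    using False by auto
  ultimately show ?thesis by (metis pvcomp_bad pwf_pvcomp)
qed

section \<open>Identities and inverses of path cells\<close>

lemma pid_simps [simp]:
  "pwf (pid xs) \<longleftrightarrow> ok xs" "psrc (pid xs) = xs" "ptgt (pid xs) = xs"
  by (auto simp: pid_def pwf_def pcl_def)

lemma pvcomp_pid [simp]:
  "pwf a \<Longrightarrow> psrc a = xs \<Longrightarrow> a \<cdot> pid xs = a" "pwf a \<Longrightarrow> ptgt a = xs \<Longrightarrow> pid xs \<cdot> a = a"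
  using pwf_ok[of a] by (auto simp: pid_def intro!: pcell_eqI
      simp: pvcomp_def pwf_def[of "Pcell _ _ _"] pcl_def)

lemma pid_pvcomp2 [simp]: "pwf a \<Longrightarrow> psrc a = xs \<Longrightarrow> a \<cdot> pid xs \<cdot> b = a \<cdot> b"
  by (metis pvcomp_assoc pvcomp_pid(1))

lemma plwhisk_pid [simp]: "ok (ps @ xs) \<Longrightarrow> xs \<noteq> [] \<Longrightarrow> ps \<rhd> pid xs = pid (ps @ xs)"
  using lwh_id2[of ps xs] ok_appendD2[of ps xs]
  by (auto simp: plwhisk_def pid_def pwf_def pcl_def)

lemma prwhisk_pid [simp]: "ok (xs @ qs) \<Longrightarrow> xs \<noteq> [] \<Longrightarrow> pid xs \<lhd> qs = pid (xs @ qs)"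
  using rwhisk_id2[of xs qs] ok_appendD1[of xs qs]
  by (auto simp: prwhisk_def pid_def pwf_def pcl_def)

lemma piso_pwf [simp]: "piso a \<Longrightarrow> pwf a"
  by (simp add: piso_def)

lemma piso_pid [simp]: "piso (pid xs) \<longleftrightarrow> ok xs"
  by (auto simp: piso_def pid_def pwf_def pcl_def)

lemma piv_simps [simp]:
  assumes "piso a"
  shows "pwf (piv a)" "piso (piv a)" "psrc (piv a) = ptgt a" "ptgt (piv a) = psrc a"
    "piv a \<cdot> a = pid (psrc a)" "a \<cdot> piv a = pid (ptgt a)" "piv (piv a) = a"
proof -
  have i: "invertible (pval a)" "pwf a" and o: "ok (psrc a)" "ok (ptgt a)" using assms pwf_ok by (auto
      simp: piso_def)
  have v: "piv a = Pcell (ptgt a) (psrc a) (inv2 (pval a))" using assms by (simp add: piv_def)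
  show w: "pwf (piv a)" using i pwf_ok[OF i(2)] by (simp add: v pwf_def pcl_def)
  show iso: "piso (piv a)" using w i by (simp add: piso_def v)
  show "psrc (piv a) = ptgt a" "ptgt (piv a) = psrc a" by (simp_all add: v)
  show "piv a \<cdot> a = pid (psrc a)" "a \<cdot> piv a = pid (ptgt a)"
    using w i pwf_ok[OF i(2)] by (simp_all add: pvcomp_def) (simp_all add: v pid_def)
  show "piv (piv a) = a"
    using iso i by (simp add: piv_def v assms is_inverse_inv2[THEN inv2_eq])
qed

lemma pval_piv: "piso a \<Longrightarrow> pval (piv a) = inv2 (pval a)"
  by (simp add: piv_def)

lemma piv_cancel [simp]:
  "piso a \<Longrightarrow> pwf b \<Longrightarrow> ptgt b = psrc a \<Longrightarrow> piv a \<cdot> a \<cdot> b = b"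
  "piso a \<Longrightarrow> pwf b \<Longrightarrow> ptgt b = ptgt a \<Longrightarrow> a \<cdot> piv a \<cdot> b = b"
  by (simp_all flip: pvcomp_assoc)

lemma isocI: "pwf a \<Longrightarrow> pwf b \<Longrightarrow> psrc b = ptgt a \<Longrightarrow> ptgt b = psrc a \<Longrightarrow> b \<cdot> a = pid (psrc a) \<Longrightarrow>
    a \<cdot> b = pid (ptgt a) \<Longrightarrow> piso a \<and> piv a = b"
proof -
  assume a: "pwf a" "pwf b" "psrc b = ptgt a" "ptgt b = psrc a" "b \<cdot> a = pid (psrc a)" "a \<cdot> b = pid (ptgt a)"
  have "pval b \<bullet> pval a = id2 C (path (psrc a))" "pval a \<bullet> pval b = id2 C (path (ptgt a))"
    using arg_cong[OF a(5), of pval] arg_cong[OF a(6), of pval] a(1-4) by (simp_all add: pid_def)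
  then have "is_inverse (pval a) (pval b)" using a pwf_ok[OF a(1)] pwf_ok[OF a(2)] by (intro is_inverseI) auto
  then have "piso a" "inv2 (pval a) = pval b" using a inv2_eq by (auto simp: piso_def invertible_def)
  then show ?thesis using a by (auto simp: piv_def intro!: pcell_eqI)
qed

lemma piso_pvcomp_aux:
  assumes "piso a" "piso b" "psrc b = ptgt a"
  shows "piso (b \<cdot> a) \<and> piv (b \<cdot> a) = piv a \<cdot> piv b"
  using assms by (intro isocI) simp_all

lemma piso_pvcomp [simp]: "piso a \<Longrightarrow> piso b \<Longrightarrow> psrc b = ptgt a \<Longrightarrow> piso (b \<cdot> a)"
  using piso_pvcomp_aux by blast

lemma piv_pvcomp: "piso a \<Longrightarrow> piso b \<Longrightarrow> psrc b = ptgt a \<Longrightarrow> piv (b \<cdot> a) = piv a \<cdot> piv b"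
  using piso_pvcomp_aux by blast

lemma piso_plwhisk_aux:
  assumes "piso a" "ok (ps @ psrc a)"
  shows "piso (ps \<rhd> a) \<and> piv (ps \<rhd> a) = ps \<rhd> piv a"
proof (intro isocI)
  have o: "ok (ps @ ptgt a)" using assms ok_ptgt_plwhisk[of a ps] by simp
  note w = pwf_ok[OF piso_pwf[OF assms(1)]]
  show "ps \<rhd> piv a \<cdot> ps \<rhd> a = pid (psrc (ps \<rhd> a))" "ps \<rhd> a \<cdot> ps \<rhd> piv a = pid (ptgt (ps \<rhd> a))"
    using assms o w by (simp_all flip: plwhisk_pvcomp)
qed (use assms ok_ptgt_plwhisk[of a ps] in simp_all)

lemma piso_prwhisk_aux:
  assumes "piso a" "ok (psrc a @ qs)"
  shows "piso (a \<lhd> qs) \<and> piv (a \<lhd> qs) = piv a \<lhd> qs"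
proof (intro isocI)
  have o: "ok (ptgt a @ qs)" using assms ok_ptgt_prwhisk[of a qs] by simp
  note w = pwf_ok[OF piso_pwf[OF assms(1)]]
  show "piv a \<lhd> qs \<cdot> a \<lhd> qs = pid (psrc (a \<lhd> qs))" "a \<lhd> qs \<cdot> piv a \<lhd> qs = pid (ptgt (a \<lhd> qs))"
    using assms o w by (simp_all flip: prwhisk_pvcomp)
qed (use assms ok_ptgt_prwhisk[of a qs] in simp_all)

lemma piso_whisk [simp]:
  "piso a \<Longrightarrow> ok (ps @ psrc a) \<Longrightarrow> piso (ps \<rhd> a)" "piso a \<Longrightarrow> ok (psrc a @ qs) \<Longrightarrow> piso (a \<lhd> qs)"
  using piso_plwhisk_aux piso_prwhisk_aux by blast+

lemma piv_whisk:
  "piso a \<Longrightarrow> ok (ps @ psrc a) \<Longrightarrow> piv (ps \<rhd> a) = ps \<rhd> piv a"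
  "piso a \<Longrightarrow> ok (psrc a @ qs) \<Longrightarrow> piv (a \<lhd> qs) = piv a \<lhd> qs"
  using piso_plwhisk_aux piso_prwhisk_aux by blast+

lemma piso_mono:
  assumes "piso a" "pwf x" "pwf y" "ptgt x = psrc a" "ptgt y = psrc a" "a \<cdot> x = a \<cdot> y"
  shows "x = y"
  by (metis assms piv_cancel(1))

lemma piso_epi:
  assumes "piso a" "pwf x" "pwf y" "psrc x = ptgt a" "psrc y = ptgt a" "x \<cdot> a = y \<cdot> a"
  shows "x = y"
proof -
  have "x = (x \<cdot> a) \<cdot> piv a" using assms(1-5) by simp
  also have "\<dots> = y" unfolding assms(6) using assms(1-5) by simp
  finally show ?thesis .
qed

lemma pcol_simps [simp]:
  "ok xs \<Longrightarrow> piso (pcol xs)" "psrc (pcol xs) = [path xs]" "ptgt (pcol xs) = xs"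
  by (auto simp: pcol_def piso_def pwf_def pcl_def)

section \<open>Translation between raw formulas and path cells\<close>

lemma whisk_pval:
  "pwf (Pcell xs ys \<alpha>) \<Longrightarrow> ok (ps @ xs @ qs) \<Longrightarrow> whisk ps xs ys qs \<alpha> = pval (ps \<rhd> (Pcell xs ys \<alpha> \<lhd> qs))"
  by (subst pval_whisk) simp_all

lemma pval_pvcomp: "pwf (b \<cdot> a) \<Longrightarrow> pval b \<bullet> pval a = pval (b \<cdot> a)"
  by simp

lemma piv_Pcell: "piso (Pcell xs ys \<alpha>) \<Longrightarrow> Pcell ys xs (inv2 \<alpha>) = piv (Pcell xs ys \<alpha>)"
  by (simp add: piv_def)

text \<open>The outer rebracketing factors in the definitions of the operations become whiskered
  copies of \<open>pcol\<close>, and can then be moved by interchange.\<close>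

lemma unbr_pval:
  assumes "ok (xs @ ys)" "xs \<noteq> []" "ys \<noteq> []"
  shows "unbr xs ys = pval (pcol xs \<lhd> ys)"
proof -
  have o: "ok xs" "ok ys" "src C (last xs) = tgt C (hd ys)" using assms by (auto simp: ok_append)
  moreover have "unbr [path xs] ys = id2 C (path xs \<odot> path ys)" by simp
  ultimately show ?thesis using assms o by (simp add: pval_prwhisk rwhisk_def ok_Cons) (simp add: pcol_def)
qed

lemma Pcell_cell: "ok xs \<Longrightarrow> ok ys \<Longrightarrow> pwf (Pcell xs ys \<alpha>) \<longleftrightarrow> cell xs ys \<alpha>"
  by (auto simp: pwf_def pcl_def cell_def hom2_def)

lemma Pcell_iso: "ok xs \<Longrightarrow> ok ys \<Longrightarrow> piso (Pcell xs ys \<alpha>) \<longleftrightarrow> iso xs ys \<alpha>"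
  by (auto simp: piso_def pwf_def pcl_def iso_def hom2_def)

lemma pwf_parallel: "pwf a \<Longrightarrow> psrc a = xs \<Longrightarrow> ptgt a = ys \<Longrightarrow> src C (last ys) = src C (last xs)"
  using pwf_ok by blast

lemma pvcomp_reassoc:
  assumes "b \<cdot> a = b' \<cdot> a'"
  shows "b \<cdot> a \<cdot> c = b' \<cdot> a' \<cdot> c"
  using arg_cong[OF assms, of "\<lambda>x. x \<cdot> c"] by simp

lemma paste_squares:
  assumes "j' \<cdot> x = y \<cdot> j" "j'' \<cdot> x' = y' \<cdot> j'"
  shows "j'' \<cdot> x' \<cdot> x = y' \<cdot> y \<cdot> j"
  using pvcomp_reassoc[OF assms(2), of x] assms(1) by simp

text \<open>Simplification distributes whiskering over composites, so a pair that should cancel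
  appears with each member whiskered separately. Hence cancellation in whiskered form, here and in
  the next two lemmas.\<close>

lemma piv_cancel_right [simp]:
  assumes "piso a" "ok (psrc a @ qs)"
  shows "piv a \<lhd> qs \<cdot> a \<lhd> qs = pid (psrc a @ qs)" "a \<lhd> qs \<cdot> piv a \<lhd> qs = pid (ptgt a @ qs)"
    "pwf b \<Longrightarrow> ptgt b = psrc a @ qs \<Longrightarrow> piv a \<lhd> qs \<cdot> a \<lhd> qs \<cdot> b = b"
    "pwf b \<Longrightarrow> ptgt b = ptgt a @ qs \<Longrightarrow> a \<lhd> qs \<cdot> piv a \<lhd> qs \<cdot> b = b"
  using piv_simps(5,6)[of "a \<lhd> qs"] piv_cancel[of "a \<lhd> qs" b] assms by (simp_all add: piv_whisk)

lemma piv_cancel_left [simp]: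
  assumes "piso a" "ok (ps @ psrc a)"
  shows "ps \<rhd> piv a \<cdot> ps \<rhd> a = pid (ps @ psrc a)" "ps \<rhd> a \<cdot> ps \<rhd> piv a = pid (ps @ ptgt a)"
    "pwf b \<Longrightarrow> ptgt b = ps @ psrc a \<Longrightarrow> ps \<rhd> piv a \<cdot> ps \<rhd> a \<cdot> b = b"
    "pwf b \<Longrightarrow> ptgt b = ps @ ptgt a \<Longrightarrow> ps \<rhd> a \<cdot> ps \<rhd> piv a \<cdot> b = b"
  using piv_simps(5,6)[of "ps \<rhd> a"] piv_cancel[of "ps \<rhd> a" b] assms by (simp_all add: piv_whisk)

lemma piv_cancel_both [simp]:
  assumes "piso a" "ok (ps @ psrc a @ qs)"
  shows "ps \<rhd> (piv a \<lhd> qs) \<cdot> ps \<rhd> (a \<lhd> qs) = pid (ps @ psrc a @ qs)"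
    "ps \<rhd> (a \<lhd> qs) \<cdot> ps \<rhd> (piv a \<lhd> qs) = pid (ps @ ptgt a @ qs)"
    "pwf b \<Longrightarrow> ptgt b = ps @ psrc a @ qs \<Longrightarrow> ps \<rhd> (piv a \<lhd> qs) \<cdot> ps \<rhd> (a \<lhd> qs) \<cdot> b = b"
    "pwf b \<Longrightarrow> ptgt b = ps @ ptgt a @ qs \<Longrightarrow> ps \<rhd> (a \<lhd> qs) \<cdot> ps \<rhd> (piv a \<lhd> qs) \<cdot> b = b"
proof -
  have "psrc a \<noteq> []" using pwf_ok[of a] assms by auto
  then have o: "ok (psrc a @ qs)" using ok_appendD2 assms by blast
  show "ps \<rhd> (piv a \<lhd> qs) \<cdot> ps \<rhd> (a \<lhd> qs) = pid (ps @ psrc a @ qs)"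
    "ps \<rhd> (a \<lhd> qs) \<cdot> ps \<rhd> (piv a \<lhd> qs) = pid (ps @ ptgt a @ qs)"
    "pwf b \<Longrightarrow> ptgt b = ps @ psrc a @ qs \<Longrightarrow> ps \<rhd> (piv a \<lhd> qs) \<cdot> ps \<rhd> (a \<lhd> qs) \<cdot> b = b"
    "pwf b \<Longrightarrow> ptgt b = ps @ ptgt a @ qs \<Longrightarrow> ps \<rhd> (a \<lhd> qs) \<cdot> ps \<rhd> (piv a \<lhd> qs) \<cdot> b = b"
    using piv_cancel_left(1,2)[of "a \<lhd> qs" ps] piv_cancel_left(3,4)[of "a \<lhd> qs" ps b] assms o by
        (simp_all add: piv_whisk)
qed

text \<open>The lifts in (BF4) are only defined after a refinement \<open>d\<close>, while the auxiliary data are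
  single 1-morphisms: \<open>shrink d c\<close> restricts \<open>c\<close> along \<open>d\<close> and absorbs \<open>d\<close> into the last 1-morphism
  of each path.\<close>

definition shrink :: "'m list \<Rightarrow> ('m, 'c) pcell \<Rightarrow> ('m, 'c) pcell" where
  "shrink d c = butlast (ptgt c) \<rhd> piv (pcol (last (ptgt c) # d)) \<cdot> c \<lhd> d \<cdot>
     butlast (psrc c) \<rhd> pcol (last (psrc c) # d)"

lemma ok_butlast_last:
  assumes "ok (xs @ d)" "xs \<noteq> []" "d \<noteq> []"
  shows "ok (last xs # d)" "ok (butlast xs @ last xs # d)" "ok (butlast xs @ [path (last xs # d)])"
proof -
  have e: "xs = butlast xs @ [last xs]" using assms by simp
  show 2: "ok (butlast xs @ last xs # d)" using assms by (metis e append_Cons append_Nil append_assoc)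
  then show 1: "ok (last xs # d)" using ok_appendD2 by blast
  show "ok (butlast xs @ [path (last xs # d)])"
    using 1 2 ok_append[of "butlast xs" "last xs # d"] ok_append[of "butlast xs" "[path (last xs # d)]"]
    by (cases "butlast xs = []") auto
qed

lemma shrink_simps:
  assumes "pwf c" "ok (psrc c @ d)" "d \<noteq> []"
  shows "pwf (shrink d c)" "psrc (shrink d c) = butlast (psrc c) @ [path (last (psrc c) # d)]"
    "ptgt (shrink d c) = butlast (ptgt c) @ [path (last (ptgt c) # d)]" "piso c \<Longrightarrow> piso (shrink d c)"
proof -
  note o = pwf_ok[OF assms(1)]
  have ot: "ok (ptgt c @ d)" using assms ok_ptgt_prwhisk by blast
  note 1 = ok_butlast_last[OF assms(2) o(3) assms(3)] ok_butlast_last[OF ot o(4) assms(3)]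
  have e: "butlast xs @ last xs # d = xs @ d" if "xs \<noteq> []" for xs :: "'m list"
    using that by (metis append_Cons append_Nil append_assoc append_butlast_last_id)
  show "pwf (shrink d c)" "psrc (shrink d c) = butlast (psrc c) @ [path (last (psrc c) # d)]"
    "ptgt (shrink d c) = butlast (ptgt c) @ [path (last (ptgt c) # d)]" "piso c \<Longrightarrow> piso (shrink d c)"
    unfolding shrink_def using assms 1 o ot by (simp_all add: e)
qed

lemma shrink_pvcomp:
  assumes "pwf a" "pwf b" "psrc b = ptgt a" "ok (psrc a @ d)" "d \<noteq> []"
  shows "shrink d (b \<cdot> a) = shrink d b \<cdot> shrink d a"
proof -
  note o = pwf_ok[OF assms(1)] pwf_ok[OF assms(2)]
  have ot: "ok (ptgt a @ d)" using assms ok_ptgt_prwhisk by blast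
  note 1 = ok_butlast_last[OF assms(4) o(3) assms(5)] ok_butlast_last[OF ot o(4) assms(5)]
  have e: "butlast xs @ last xs # d = xs @ d" if "xs \<noteq> []" for xs :: "'m list"
    using that by (metis append_Cons append_Nil append_assoc append_butlast_last_id)
  show ?thesis unfolding shrink_def using assms 1 o ot by (simp add: e)
qed

lemma shrink_plwhisk:
  assumes "pwf a" "ok (ps @ psrc a)"
  shows "shrink d (ps \<rhd> a) = ps \<rhd> shrink d a"
  using assms pwf_ok[OF assms(1)] by (simp add: shrink_def butlast_append)

text \<open>The rebracketing of the last letter slides past \<open>a\<close> by interchange and
  meets its inverse. Refining an equation between whiskered cells therefore preserves its shape and
  only lengthens the last letter.\<close>

lemma shrink_prwhisk:
  assumes "pwf a" "ok (psrc a @ zs @ x # d)" "d \<noteq> []"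
  shows "shrink d (a \<lhd> (zs @ [x])) = a \<lhd> (zs @ [path (x # d)])"
proof -
  note o = pwf_ok[OF assms(1)]
  have 1: "ok (psrc a @ zs @ [x])" using ok_appendD1[of "psrc a @ zs @ [x]" d] assms by simp
  have x: "ok (x # d)" using ok_appendD2[of "psrc a @ zs" "x # d"] assms by simp
  have ot: "ok (ptgt a @ zs @ x # d)" using assms ok_ptgt_prwhisk by blast
  have ox: "ok (zs @ x # d)" using ok_appendD2[OF assms(2)] by simp
  have ox2: "ok (zs @ [path (x # d)])" using ok_append[of zs "x # d"] ok_append[of zs "[path (x # d)]"] ox x
    by (cases "zs = []") auto
  have hd: "hd (zs @ [path (x # d)]) = hd (zs @ x # d) \<or> (zs = [])" by (cases zs) auto
  have op: "ok (psrc a @ zs @ [path (x # d)])"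
    using assms ox2 o hd x ok_append[of "psrc a" "zs @ x # d"] ok_append[of "psrc a"
        "zs @ [path (x # d)]"] by auto
  have opt: "ok (ptgt a @ zs @ [path (x # d)])" using op assms(1) ok_ptgt_prwhisk by blast
  have "a \<lhd> (zs @ x # d) \<cdot> (psrc a @ zs) \<rhd> pcol (x # d) = (ptgt a @ zs) \<rhd> pcol (x # d) \<cdot>
      a \<lhd> (zs @ [path (x # d)])"
    using pinterchange[of a "zs \<rhd> pcol (x # d)"] x ox2 by simp
  then have "shrink d (a \<lhd> (zs @ [x])) = (ptgt a @ zs) \<rhd> piv (pcol (x # d)) \<cdot>
      (ptgt a @ zs) \<rhd> pcol (x # d) \<cdot> a \<lhd> (zs @ [path (x # d)])"
    using 1 assms(1) by (simp add: shrink_def butlast_append)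
  also have "\<dots> = a \<lhd> (zs @ [path (x # d)])"
    by (rule piv_cancel_left(3)) (use assms(1) x op opt in simp_all)
  finally show ?thesis .
qed

lemma shrink_prwhisk2: "pwf a \<Longrightarrow> ok (psrc a @ [y, z, d]) \<Longrightarrow> shrink [d] (a \<lhd> [y, z]) = a \<lhd> [y, z \<odot> d]"
  using shrink_prwhisk[of a "[y]" z "[d]"] by simp

lemma shrink_prwhisk1: "pwf a \<Longrightarrow> ok (psrc a @ [z, d]) \<Longrightarrow> shrink [d] (a \<lhd> [z]) = a \<lhd> [z \<odot> d]"
  using shrink_prwhisk[of a "[]" z "[d]"] by simp

lemma piv_pid [simp]: "ok xs \<Longrightarrow> piv (pid xs) = pid xs"
  using isocI[of "pid xs" "pid xs"] by simp

end

section \<open>The conditions (BF) for paths\<close>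

context bicategory_BF
begin

section \<open>Paths whose composite lies in \<open>W\<close>, and lifting through them\<close>

definition Wl :: "'m list \<Rightarrow> bool" where
  "Wl xs \<longleftrightarrow> ok xs \<and> path xs \<in> W"

lemma Wl_ok [simp]: "Wl xs \<Longrightarrow> ok xs"
  by (simp add: Wl_def)

lemma Wl_nonempty: "Wl xs \<Longrightarrow> xs \<noteq> []"
  by (auto simp: Wl_def)

lemma W_Mor' [simp]: "w \<in> W \<Longrightarrow> w \<in> Mor C"
  using W_Mor by blast

lemma Wl_single [simp]: "Wl [w] \<longleftrightarrow> w \<in> W"
  by (auto simp: Wl_def)

lemma ok_Ob [simp]: "ok xs \<Longrightarrow> src C (last xs) \<in> Ob C" "ok xs \<Longrightarrow> tgt C (hd xs) \<in> Ob C"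
  using Mor_Ob[OF path_ok(1), of xs] by auto

lemma Wl_psrc:
  assumes "piso a" "Wl (ptgt a)"
  shows "Wl (psrc a)"
proof -
  have w: "pwf a" "invertible (pval a)" using assms by (auto simp: piso_def)
  have "hom2 (path (psrc a)) (path (ptgt a)) (pval a)"
    using pwf_ok[OF w(1)] by (simp add: hom2_def)
  then show ?thesis using BF5 w assms pwf_ok[OF w(1)] by (auto simp: Wl_def)
qed

lemma Wl_ptgt: "piso a \<Longrightarrow> Wl (psrc a) \<Longrightarrow> Wl (ptgt a)"
  using Wl_psrc[of "piv a"] by simp

lemma Wl_append:
  assumes "Wl xs" "Wl ys" "ok (xs @ ys)"
  shows "Wl (xs @ ys)"
proof -
  have ne: "xs \<noteq> []" "ys \<noteq> []" using assms Wl_nonempty by auto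
  then have o: "ok xs" "ok ys" "src C (last xs) = tgt C (hd ys)" using assms by (auto simp: ok_append)
  have "path xs \<odot> path ys \<in> W"
    by (rule BF2[of "src C (path ys)" "tgt C (path ys)" _ "tgt C (path xs)"])
      (use assms o in \<open>auto simp: hom_def Wl_def\<close>)
  then show ?thesis using BF5[of _ "path (xs @ ys)" "inv2 (unbr xs ys)"] assms ne
    by (auto simp: Wl_def hom2_def)
qed

lemma Wl_Cons: "x \<in> W \<Longrightarrow> Wl ys \<Longrightarrow> src C x = tgt C (hd ys) \<Longrightarrow> Wl (x # ys)"
  using Wl_append[of "[x]" ys] Wl_nonempty[of ys] by (simp add: ok_Cons)

lemma BF3l:
  assumes "Wl ws" "ok fs" "tgt C (hd ws) = tgt C (hd fs)"
  obtains s k \<rho> where "s \<in> W" "k \<in> Mor C" "tgt C s = src C (last fs)" "tgt C k = src C (last ws)"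
    "src C k = src C s" "piso \<rho>" "psrc \<rho> = fs @ [s]" "ptgt \<rho> = ws @ [k]"
proof -
  have w: "hom (src C (last ws)) (tgt C (hd ws)) (path ws)" "path ws \<in> W"
    and f: "hom (src C (last fs)) (tgt C (hd ws)) (path fs)"
    using assms Mor_Ob[of "path ws"] Mor_Ob[of "path fs"] by (simp_all add: hom_def Wl_def)
  have ne: "ws \<noteq> []" "fs \<noteq> []" using assms by (auto simp: Wl_nonempty)
  from BF3[OF w f] obtain D s k \<rho> where
    r: "hom D (src C (last fs)) s" "s \<in> W" "hom D (src C (last ws)) k" "iso [path fs, s] [path ws, k] \<rho>"
    by blast
  define \<rho>' where "\<rho>' = Pcell [path fs, s] [path ws, k] \<rho>"
  have o: "ok (fs @ [s])" "ok (ws @ [k])" "ok [path fs, s]" "ok [path ws, k]" using r assms ne by (auto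
      simp: hom_def ok_append)
  have \<rho>': "piso \<rho>'" "psrc \<rho>' = [path fs, s]" "ptgt \<rho>' = [path ws, k]"
    using r o assms by (auto simp: \<rho>'_def piso_def iso_def hom_def hom2_def pwf_def pcl_def)
  define \<rho>'' where "\<rho>'' = pcol ws \<lhd> [k] \<cdot> \<rho>' \<cdot> piv (pcol fs) \<lhd> [s]"
  have "piso \<rho>''" "psrc \<rho>'' = fs @ [s]" "ptgt \<rho>'' = ws @ [k]" using \<rho>' o assms by (auto simp: \<rho>''_def)
  with r show ?thesis by (intro that[of s k \<rho>'']) (auto simp: hom_def)
qed

text \<open>The rebracketing between a path cut into two segments and the two corresponding letters.
  Conjugation by it reduces a statement about paths to the two-letter form of (BF4).\<close>

lemma colla2:
  assumes "ok (ws @ f)" "ws \<noteq> []" "f \<noteq> []"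
  shows "piso (pcol ws \<lhd> f \<cdot> [path ws] \<rhd> pcol f)"
    "psrc (pcol ws \<lhd> f \<cdot> [path ws] \<rhd> pcol f) = [path ws, path f]"
    "ptgt (pcol ws \<lhd> f \<cdot> [path ws] \<rhd> pcol f) = ws @ f"
  using assms by (auto simp: ok_append ok_Cons)

text \<open>The cell is brought to two letters on each side, lifted there, and the lift is spread
  out again. Interchange shows that the spread-out lift still lies over the original cell.\<close>

lemma BF4l:
  assumes "Wl ws" "pwf \<alpha>" "psrc \<alpha> = ws @ f1" "ptgt \<alpha> = ws @ f2" "f1 \<noteq> []" "f2 \<noteq> []"
  obtains s \<beta> where "s \<in> W" "tgt C s = src C (last f1)" "pwf \<beta>" "psrc \<beta> = f1 @ [s]" "ptgt \<beta> = f2 @ [s]"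
    "\<alpha> \<lhd> [s] = ws \<rhd> \<beta>" "piso \<alpha> \<Longrightarrow> piso \<beta>"
proof -
  let ?w = "path ws" and ?f1 = "path f1" and ?f2 = "path f2"
  note wo = pwf_ok[OF assms(2)]
  have ne: "ws \<noteq> []" using assms by (auto simp: Wl_nonempty)
  have o: "ok (ws @ f1)" "ok (ws @ f2)" "ok ws" "ok f1" "ok f2" "src C (last f2) = src C (last f1)"
    "src C (last ws) = tgt C (hd f1)" "src C (last ws) = tgt C (hd f2)"
    using wo assms ne by (auto simp: ok_append)
  define E1 E2 where "E1 = pcol ws \<lhd> f1 \<cdot> [?w] \<rhd> pcol f1" and "E2 = pcol ws \<lhd> f2 \<cdot> [?w] \<rhd> pcol f2"
  have E1: "piso E1" "psrc E1 = [?w, ?f1]" "ptgt E1 = ws @ f1"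
    unfolding E1_def by (rule colla2; use o ne assms in simp)+
  have E2: "piso E2" "psrc E2 = [?w, ?f2]" "ptgt E2 = ws @ f2"
    unfolding E2_def by (rule colla2; use o ne assms in simp)+
  define \<alpha>' where "\<alpha>' = piv E2 \<cdot> \<alpha> \<cdot> E1"
  have \<alpha>': "pwf \<alpha>'" "psrc \<alpha>' = [?w, ?f1]" "ptgt \<alpha>' = [?w, ?f2]" "piso \<alpha> \<Longrightarrow> piso \<alpha>'"
    using assms E1 E2 by (auto simp: \<alpha>'_def)
  have c: "cell [?w, ?f1] [?w, ?f2] (pval \<alpha>')"
    using pwf_ok[OF \<alpha>'(1)] \<alpha>' by (simp add: cell_def hom2_def)
  have h: "hom (src C (last ws)) (tgt C (hd ws)) ?w" "hom (src C (last f1)) (src C (last ws)) ?f1"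
    "hom (src C (last f1)) (src C (last ws)) ?f2"
    using o Mor_Ob[OF path_ok(1)[OF o(3)]] Mor_Ob[OF path_ok(1)[OF o(4)]] by (simp_all add: hom_def)
  obtain D s \<beta> where s: "hom D (src C (last f1)) s" "s \<in> W" "cell [?f1, s] [?f2, s] \<beta>"
    "whisk [] [?w, ?f1] [?w, ?f2] [s] (pval \<alpha>') = whisk [?w] [?f1, s] [?f2, s] [] \<beta>"
    "invertible (pval \<alpha>') \<longrightarrow> invertible \<beta>"
    using BF4ab[OF h(1) _ h(2,3) c] assms(1) by (auto simp: Wl_def)
  define \<beta>' where "\<beta>' = Pcell [?f1, s] [?f2, s] \<beta>"
  have t: "s \<in> Mor C" "tgt C s = src C (last f1)" using s by (auto simp: hom_def)
  have os: "ok (f1 @ [s])" "ok (f2 @ [s])" "ok (ws @ f1 @ [s])" "ok (ws @ f2 @ [s])"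
    using t o ne assms by (auto simp: ok_append)
  have \<beta>': "pwf \<beta>'" "psrc \<beta>' = [?f1, s]" "ptgt \<beta>' = [?f2, s]"
    using s(3) t o by (auto simp: \<beta>'_def cell_def pwf_def pcl_def hom2_def)
  have "[] \<rhd> (\<alpha>' \<lhd> [s]) = [?w] \<rhd> (\<beta>' \<lhd> [])"
  proof (rule pcell_eqI)
    show "pval ([] \<rhd> (\<alpha>' \<lhd> [s])) = pval ([?w] \<rhd> (\<beta>' \<lhd> []))"
      using s(4) \<alpha>' \<beta>' t o by (subst (1 2) pval_whisk) (simp_all add: \<beta>'_def)
  qed (use \<alpha>' \<beta>' t o in simp_all)
  then have eq: "\<alpha>' \<lhd> [s] = [?w] \<rhd> \<beta>'" by simp
  define \<beta>'' where "\<beta>'' = pcol f2 \<lhd> [s] \<cdot> \<beta>' \<cdot> piv (pcol f1) \<lhd> [s]"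
  have \<beta>'': "pwf \<beta>''" "psrc \<beta>'' = f1 @ [s]" "ptgt \<beta>'' = f2 @ [s]" "piso \<beta>' \<Longrightarrow> piso \<beta>''"
    using \<beta>' t o os by (simp_all add: \<beta>''_def)
  have "\<alpha> = E2 \<cdot> \<alpha>' \<cdot> piv E1"
    using assms(2-4) E1 E2 by (simp add: \<alpha>'_def)
  then have "\<alpha> \<lhd> [s] = E2 \<lhd> [s] \<cdot> [?w] \<rhd> \<beta>' \<cdot> piv (E1 \<lhd> [s])"
    using E1 os o t by (simp add: eq piv_whisk)
  also have "\<dots> = (E2 \<lhd> [s] \<cdot> [?w] \<rhd> \<beta>') \<cdot> piv (E1 \<lhd> [s])" by simp
  \<comment> \<open>The lift passes through the collapse of \<open>ws\<close> by interchange, while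
    the collapses of \<open>f1\<close> and \<open>f2\<close> are absorbed into
    \<open>\<beta>''\<close>.\<close>
  also have "E2 \<lhd> [s] \<cdot> [?w] \<rhd> \<beta>' = ws \<rhd> \<beta>'' \<cdot> E1 \<lhd> [s]"
  proof -
    have 1: "[?w] \<rhd> pcol f2 \<lhd> [s] \<cdot> [?w] \<rhd> \<beta>' = [?w] \<rhd> \<beta>'' \<cdot> [?w] \<rhd> pcol f1 \<lhd> [s]"
      using \<beta>' o os t by (simp add: \<beta>''_def flip: plwhisk_pvcomp prwhisk_pvcomp)
    have "E2 \<lhd> [s] \<cdot> [?w] \<rhd> \<beta>' = pcol ws \<lhd> (f2 @ [s]) \<cdot> [?w] \<rhd> pcol f2 \<lhd> [s] \<cdot> [?w] \<rhd> \<beta>'"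
      by (simp add: E2_def)
    also have "\<dots> = (pcol ws \<lhd> (f2 @ [s]) \<cdot> [?w] \<rhd> \<beta>'') \<cdot> [?w] \<rhd> pcol f1 \<lhd> [s]"
      unfolding 1 by simp
    also have "pcol ws \<lhd> (f2 @ [s]) \<cdot> [?w] \<rhd> \<beta>'' = ws \<rhd> \<beta>'' \<cdot> pcol ws \<lhd> (f1 @ [s])"
      using pinterchange[of "pcol ws" \<beta>''] \<beta>'' by simp
    finally show ?thesis by (simp add: E1_def)
  qed
  also have "(ws \<rhd> \<beta>'' \<cdot> E1 \<lhd> [s]) \<cdot> piv (E1 \<lhd> [s]) = ws \<rhd> \<beta>'' \<cdot> E1 \<lhd> [s] \<cdot> piv (E1 \<lhd> [s])"
    by simp
  also have "E1 \<lhd> [s] \<cdot> piv (E1 \<lhd> [s]) = pid (ws @ f1 @ [s])"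
    using piv_simps(6)[of "E1 \<lhd> [s]"] E1 os t o by simp
  also have "ws \<rhd> \<beta>'' \<cdot> pid (ws @ f1 @ [s]) = ws \<rhd> \<beta>''" using \<beta>'' os by simp
  finally have "\<alpha> \<lhd> [s] = ws \<rhd> \<beta>''" .
  moreover have "piso \<beta>''" if "piso \<alpha>"
  proof -
    have "invertible (pval \<alpha>')" using \<alpha>'(4) that by (simp add: piso_def)
    then have "piso \<beta>'" using s(5) \<beta>' by (simp add: piso_def \<beta>'_def)
    then show ?thesis using \<beta>'' by simp
  qed
  ultimately show ?thesis using that[of s \<beta>''] s t \<beta>'' by blast
qed

lemma cell_pval: "pwf a \<Longrightarrow> cell (psrc a) (ptgt a) (pval a)"
  using pwf_ok[of a] by (simp add: cell_def hom2_def)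

text \<open>Both sides, restricted along an identity, solve the same lifting problem, so (BF4c)
  identifies them after refinement.\<close>

lemma W_faithful:
  assumes "Wl ws" "pwf \<alpha>" "pwf \<beta>" "psrc \<alpha> = psrc \<beta>" "ptgt \<alpha> = ptgt \<beta>" "ok (ws @ psrc \<alpha>)"
    and eq: "ws \<rhd> \<alpha> = ws \<rhd> \<beta>"
  obtains s where "Wl s" "ok (psrc \<alpha> @ s)" "\<alpha> \<lhd> s = \<beta> \<lhd> s"
proof -
  let ?f1 = "psrc \<beta>" and ?f2 = "ptgt \<beta>" let ?w = "path ws" let ?p1 = "path ?f1" and ?p2 = "path ?f2"
  note wo = pwf_ok[OF assms(3)]
  have ne: "ws \<noteq> []" using assms by (auto simp: Wl_nonempty)
  have o: "ok ws" "src C (last ws) = tgt C (hd ?f1)" using ne wo assms by (auto simp: ok_append)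
  \<comment> \<open>\<open>c\<close> collapses source and target to one letter each, as the axiom
    expects.\<close>
  define c where "c \<gamma> = piv (pcol ?f2) \<cdot> \<gamma> \<cdot> pcol ?f1" for \<gamma>
  have c: "pwf (c \<gamma>) \<and> psrc (c \<gamma>) = [?p1] \<and> ptgt (c \<gamma>) = [?p2]" if "\<gamma> = \<alpha> \<or> \<gamma> = \<beta>" for \<gamma>
    using that assms wo by (auto simp: c_def)
  have cw: "[?w] \<rhd> \<gamma> = piv (pcol ws \<lhd> ?f2) \<cdot> ws \<rhd> \<gamma> \<cdot> pcol ws \<lhd> ?f1" if "\<gamma> = \<alpha> \<or> \<gamma> = \<beta>" for \<gamma>
  proof -
    have "ws \<rhd> \<gamma> \<cdot> pcol ws \<lhd> ?f1 = pcol ws \<lhd> ?f2 \<cdot> [?w] \<rhd> \<gamma>"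
      using pinterchange[of "pcol ws" \<gamma>] that assms by auto
    moreover have "piv (pcol ws \<lhd> ?f2) \<cdot> pcol ws \<lhd> ?f2 \<cdot> [?w] \<rhd> \<gamma> = [?w] \<rhd> \<gamma>"
      using that assms o wo by (intro piv_cancel) (auto simp: ok_append ok_Cons)
    ultimately show ?thesis by simp
  qed
  have "[?w] \<rhd> \<alpha> = [?w] \<rhd> \<beta>" unfolding cw[OF disjI1, OF refl] cw[OF disjI2, OF refl] eq ..
  then have eq': "[?w] \<rhd> c \<alpha> = [?w] \<rhd> c \<beta>" by (simp add: c_def)
  define a b where "a = c \<alpha>" and "b = c \<beta>"
  have a: "pwf a" "psrc a = [?p1]" "ptgt a = [?p2]" and b: "pwf b" "psrc b = [?p1]" "ptgt b = [?p2]"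
    using c by (auto simp: a_def b_def)
  define A where "A = src C (last ?f1)"
  have A: "A \<in> Ob C" using Mor_Ob(1)[OF path_ok(1)[OF wo(1)]] wo by (simp add: A_def)
  let ?i = "id1 C A"
  have i: "hom A A ?i" "?i \<in> W" "?i \<in> Mor C" "src C ?i = A" "tgt C ?i = A"
    using A BF1 by (auto simp: hom_def)
  have h: "hom (src C (last ws)) (tgt C (hd ws)) ?w" "hom A (src C (last ws)) ?p1"
      "hom A (src C (last ws)) ?p2"
    using o wo Mor_Ob[OF path_ok(1)[OF o(1)]] A by (simp_all add: hom_def A_def)
  have ok2: "ok [?w, ?p1]" "ok [?w, ?p2]" "ok [?p1, ?i]" "ok [?p2, ?i]" "ok [?w, ?p1, ?i]"
    using o wo i by (simp_all add: A_def)
  have cell: "cell [?w, ?p1] [?w, ?p2] (pval ([?w] \<rhd> a))"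
    "cell [?p1, ?i] [?p2, ?i] (pval (a \<lhd> [?i]))" "cell [?p1, ?i] [?p2, ?i] (pval (b \<lhd> [?i]))"
    using cell_pval[of "[?w] \<rhd> a"] cell_pval[of "a \<lhd> [?i]"] cell_pval[of "b \<lhd> [?i]"] a b ok2 by simp_all
  have wh: "whisk [] [?w, ?p1] [?w, ?p2] [?i] (pval ([?w] \<rhd> x)) =
      whisk [?w] [?p1, ?i] [?p2, ?i] [] (pval (x \<lhd> [?i]))"
    if "x = a \<or> x = b" for x
  proof -
    have x: "pwf x" "psrc x = [?p1]" "ptgt x = [?p2]" using that a b by auto
    have "[] \<rhd> (([?w] \<rhd> x) \<lhd> [?i]) = [?w] \<rhd> ((x \<lhd> [?i]) \<lhd> [])" by simp
    then have "pval ([] \<rhd> (([?w] \<rhd> x) \<lhd> [?i])) = pval ([?w] \<rhd> ((x \<lhd> [?i]) \<lhd> []))" by simp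
    moreover have "pval ([] \<rhd> (([?w] \<rhd> x) \<lhd> [?i])) = whisk [] [?w, ?p1] [?w, ?p2] [?i] (pval ([?w] \<rhd> x))"
      using x ok2 by (subst pval_whisk) simp_all
    moreover have "pval ([?w] \<rhd> ((x \<lhd> [?i]) \<lhd> [])) = whisk [?w] [?p1, ?i] [?p2, ?i] [] (pval (x \<lhd> [?i]))"
      using x ok2 by (subst pval_whisk) simp_all
    ultimately show ?thesis by simp
  qed
  obtain G u u' \<zeta> where u: "hom G A u" "hom G A u'" "iso [?i, u] [?i, u'] \<zeta>" "?i \<odot> u \<in> W"
    "whisk [] [?p1, ?i] [?p2, ?i] [u'] (pval (b \<lhd> [?i])) \<bullet> whisk [?p1] [?i, u] [?i, u'] [] \<zeta> =
     whisk [?p2] [?i, u] [?i, u'] [] \<zeta> \<bullet> whisk [] [?p1, ?i] [?p2, ?i] [u] (pval (a \<lhd> [?i]))"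
  proof -
    have "path ws \<in> W" using assms(1) by (simp add: Wl_def)
    moreover have "whisk [] [?w, ?p1] [?w, ?p2] [?i] (pval ([?w] \<rhd> a)) =
        whisk [?w] [?p1, ?i] [?p2, ?i] [] (pval (b \<lhd> [?i]))"
      using wh[of b] eq' by (simp only: a_def b_def simp_thms)
    ultimately show ?thesis
      using BF4c[OF h(1) _ h(2,3) cell(1) i(1,2) cell(2) _ i(1,2) cell(3)] wh[of a] that by blast
  qed
  define z where "z = Pcell [?i, u] [?i, u'] \<zeta>"
  have um: "u \<in> Mor C" "u' \<in> Mor C" "tgt C u = A" "tgt C u' = A" using u by (auto simp: hom_def)
  have z: "piso z" "psrc z = [?i, u]" "ptgt z = [?i, u']"
    using u(3) um i by (auto simp: z_def piso_def pwf_def pcl_def iso_def hom2_def)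
  have pz: "pval z = \<zeta>" by (simp add: z_def)
  \<comment> \<open>The axiom places \<open>?i \<odot> u\<close> in \<open>W\<close>, but the
    refinement used below ends in \<open>u'\<close>; the invertible \<open>z\<close> carries
    membership across.\<close>
  have Ws: "Wl [?i, u']" using Wl_ptgt[OF z(1)] z u(4) um i by (simp add: Wl_def)
  have ok3: "ok [?p1, ?i, u]" "ok [?p2, ?i, u]" "ok [?p1, ?i, u']" "ok [?p2, ?i, u']" using ok2 um i by
      simp_all
  have "[] \<rhd> ((b \<lhd> [?i]) \<lhd> [u']) \<cdot> [?p1] \<rhd> (z \<lhd> []) = [?p2] \<rhd> (z \<lhd> []) \<cdot> [] \<rhd> ((a \<lhd> [?i]) \<lhd> [u])"
  proof (rule pcell_eqI)
    show "pval ([] \<rhd> ((b \<lhd> [?i]) \<lhd> [u']) \<cdot> [?p1] \<rhd> (z \<lhd> [])) = pval ([?p2] \<rhd> (z \<lhd> []) \<cdot>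
        [] \<rhd> ((a \<lhd> [?i]) \<lhd> [u]))"
    proof -
      have 1: "pval ([] \<rhd> ((x \<lhd> [?i]) \<lhd> [v])) = whisk [] [?p1, ?i] [?p2, ?i] [v] (pval (x \<lhd> [?i]))"
        if "(x = a \<or> x = b) \<and> (v = u \<or> v = u')" for x v
      proof -
        have "pwf x" "psrc x = [?p1]" "ptgt x = [?p2]" "ok [?p1, ?i, v]" using that a b ok3 by auto
        then show ?thesis using ok2 by (subst pval_whisk) simp_all
      qed
      have 2: "pval ([p] \<rhd> (z \<lhd> [])) = whisk [p] [?i, u] [?i, u'] [] \<zeta>" if "p = ?p1 \<or> p = ?p2" for p
        using that z ok3 pz by (subst pval_whisk) auto
      have "pval ([] \<rhd> ((b \<lhd> [?i]) \<lhd> [u'])) \<bullet> pval ([?p1] \<rhd> (z \<lhd> [])) =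
          pval ([?p2] \<rhd> (z \<lhd> [])) \<bullet> pval ([] \<rhd> ((a \<lhd> [?i]) \<lhd> [u]))"
        using 1[of b u'] 1[of a u] 2[of ?p1] 2[of ?p2] u(5) by simp
      then show ?thesis using a b z ok3 by simp
    qed
  qed (use a b z ok3 in simp_all)
  then have "b \<lhd> [?i, u'] \<cdot> [?p1] \<rhd> z = [?p2] \<rhd> z \<cdot> a \<lhd> [?i, u]" by simp
  also have "\<dots> = a \<lhd> [?i, u'] \<cdot> [?p1] \<rhd> z"
    using pinterchange[of a z] a z by simp
  finally have "b \<lhd> [?i, u'] = a \<lhd> [?i, u']"
    by - (rule piso_epi[of "[?p1] \<rhd> z"], use a b z ok3 in simp_all)
  then have "(pcol ?f2 \<cdot> b \<cdot> piv (pcol ?f1)) \<lhd> [?i, u'] = (pcol ?f2 \<cdot> a \<cdot> piv (pcol ?f1)) \<lhd> [?i, u']"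
    by simp
  moreover have "pcol ?f2 \<cdot> a \<cdot> piv (pcol ?f1) = \<alpha>" "pcol ?f2 \<cdot> b \<cdot> piv (pcol ?f1) = \<beta>"
    using assms(2-5) wo unfolding a_def b_def c_def by simp_all
  ultimately have "\<alpha> \<lhd> [?i, u'] = \<beta> \<lhd> [?i, u']" by (simp only:)
  moreover have "ok (psrc \<alpha> @ [?i, u'])" using assms wo um i by (simp add: ok_append A_def)
  ultimately show ?thesis using that Ws by blast
qed

text \<open>A weak form of cancellation in \<open>W\<close>. (BF3) gives an isomorphism between
  \<open>ws s\<close> and \<open>ws z k\<close> with \<open>s\<close> in \<open>W\<close>, and (BF4)
  lifts it through \<open>ws\<close> after a refinement \<open>d\<close>; so \<open>z k d\<close> is
  isomorphic to \<open>s d\<close>, which lies in \<open>W\<close>.\<close>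

lemma Wl_right_cancel:
  assumes "Wl ws" "Wl (ws @ z)"
  obtains k where "k \<noteq> []" "ok (ws @ z @ k)" "Wl (z @ k)"
proof -
  have ne: "ws \<noteq> []" using assms by (auto simp: Wl_nonempty)
  obtain s k \<rho> where r: "s \<in> W" "k \<in> Mor C" "tgt C s = src C (last ws)" "tgt C k = src C (last (ws @ z))"
    "src C k = src C s" "piso \<rho>" "psrc \<rho> = ws @ [s]" "ptgt \<rho> = (ws @ z) @ [k]"
    using BF3l[OF assms(2), of ws] assms ne by auto
  obtain d \<beta> where d: "d \<in> W" "tgt C d = src C (last [s])" "pwf \<beta>" "psrc \<beta> = [s] @ [d]"
      "ptgt \<beta> = (z @ [k]) @ [d]"
    "\<rho> \<lhd> [d] = ws \<rhd> \<beta>" "piso \<rho> \<Longrightarrow> piso \<beta>"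
    using BF4l[OF assms(1), of \<rho> "[s]" "z @ [k]"] r by auto
  have "Wl [s, d]" using r d Wl_Cons[of s "[d]"] by simp
  then have w: "Wl (z @ [k, d])" using Wl_ptgt[of \<beta>] d r by simp
  moreover have "ok (ws @ z @ [k, d])"
    using ok_append[of "ws @ z @ [k]" "[d]"] pwf_ok(2)[of \<rho>] r d by simp
  ultimately show ?thesis using that[of "[k, d]"] by blast
qed

text \<open>Lifting with the refinement absorbed into the last letters, so that the lift has the
  number of 1-morphisms prescribed for the auxiliary data.\<close>

lemma BF4_shrink:
  assumes "Wl ws" "pwf \<theta>" "psrc \<theta> = ws @ xs @ [x]" "ptgt \<theta> = ws @ ys @ [y]"
  obtains d \<kappa> where "d \<in> W" "tgt C d = src C x" "pwf \<kappa>" "psrc \<kappa> = xs @ [x \<odot> d]" "ptgt \<kappa> = ys @ [y \<odot> d]"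
    "ws \<rhd> \<kappa> = shrink [d] \<theta>" "piso \<theta> \<Longrightarrow> piso \<kappa>"
proof -
  obtain d \<kappa> where d: "d \<in> W" "tgt C d = src C (last (xs @ [x]))" "pwf \<kappa>" "psrc \<kappa> = (xs @ [x]) @ [d]"
      "ptgt \<kappa> = (ys @ [y]) @ [d]"
    "\<theta> \<lhd> [d] = ws \<rhd> \<kappa>" "piso \<theta> \<Longrightarrow> piso \<kappa>"
    by (rule BF4l[OF assms(1), of \<theta> "xs @ [x]" "ys @ [y]"]) (use assms that in auto)
  note o = pwf_ok[OF d(3)]
  have o1: "ok (xs @ [x, d])" "ok (ys @ [y, d])" using o d by simp_all
  note o2 = ok_butlast_last[of "xs @ [x]" "[d]"] ok_butlast_last[of "ys @ [y]" "[d]"]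
  have o3: "ok [x, d]" "ok (xs @ [x \<odot> d])" "ok [y, d]" "ok (ys @ [y \<odot> d])" using o2 o1 by simp_all
  define \<kappa>' where "\<kappa>' = ys \<rhd> piv (pcol [y, d]) \<cdot> \<kappa> \<cdot> xs \<rhd> pcol [x, d]"
  have "pwf \<kappa>'" "psrc \<kappa>' = xs @ [x \<odot> d]" "ptgt \<kappa>' = ys @ [y \<odot> d]" "piso \<theta> \<Longrightarrow> piso \<kappa>'"
    using d o1 o3 by (simp_all add: \<kappa>'_def)
  moreover have "ws \<rhd> \<kappa>' = shrink [d] \<theta>"
    using assms d(6) by (simp add: \<kappa>'_def shrink_def butlast_append)
  ultimately show ?thesis using that d by simp
qed

text \<open>The leg \<open>p\<close> of a representative need not lie in \<open>W\<close>, only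
  \<open>w p\<close> does. A square is therefore formed for \<open>w q\<close> against
  \<open>w p\<close> and then lifted through \<open>w\<close>.\<close>

lemma ore_square:
  assumes "w \<in> W" "Wl [w, p]" "ok [w, q]"
  obtains t k \<rho> where "t \<in> W" "k \<in> Mor C" "tgt C t = src C q" "tgt C k = src C p" "src C k = src C t"
    "piso \<rho>" "psrc \<rho> = [q, t]" "ptgt \<rho> = [p, k]"
proof -
  obtain s k \<rho> where r: "s \<in> W" "k \<in> Mor C" "tgt C s = src C (last [w, q])" "tgt C k = src C (last [w, p])"
    "src C k = src C s" "piso \<rho>" "psrc \<rho> = [w, q] @ [s]" "ptgt \<rho> = [w, p] @ [k]"
    by (rule BF3l[OF assms(2,3)]) (use that in auto)
  obtain d \<kappa> where d: "d \<in> W" "tgt C d = src C s" "pwf \<kappa>" "psrc \<kappa> = [q] @ [s \<odot> d]" "ptgt \<kappa> = [p] @ [k \<odot> d]"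
    "[w] \<rhd> \<kappa> = shrink [d] \<rho>" "piso \<rho> \<Longrightarrow> piso \<kappa>"
    by (rule BF4_shrink[of "[w]" \<rho> "[q]" s "[p]" k]) (use r assms that in auto)
  have "Wl [s, d]" using Wl_Cons[of s "[d]"] r d by simp
  then have "s \<odot> d \<in> W" by (simp add: Wl_def)
  then show ?thesis using that[of "s \<odot> d" "k \<odot> d" \<kappa>] r d by simp
qed

text \<open>The inverse of \<open>ws \<rhd> \<kappa>\<close> is lifted through \<open>ws\<close>.
  Its two composites with \<open>\<kappa>\<close> are identities only after applying
  \<open>ws\<close>, so each of them costs one further refinement by faithfulness.\<close>

lemma W_reflects_iso:
  assumes "Wl ws" "pwf \<kappa>" "piso (ws \<rhd> \<kappa>)"
  obtains s where "Wl s" "ok (psrc \<kappa> @ s)" "piso (\<kappa> \<lhd> s)"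
proof -
  note o = pwf_ok[OF assms(2)]
  have ow: "ok (ws @ psrc \<kappa>)" using piso_pwf[OF assms(3)] by simp
  have ow': "ok (ws @ ptgt \<kappa>)" using ow assms(2) ok_ptgt_plwhisk by blast
  obtain s \<mu> where s: "s \<in> W" "tgt C s = src C (last (ptgt \<kappa>))" "pwf \<mu>" "psrc \<mu> = ptgt \<kappa> @ [s]"
      "ptgt \<mu> = psrc \<kappa> @ [s]"
    "piv (ws \<rhd> \<kappa>) \<lhd> [s] = ws \<rhd> \<mu>" "piso (piv (ws \<rhd> \<kappa>)) \<Longrightarrow> piso \<mu>"
    by (rule BF4l[OF assms(1), of "piv (ws \<rhd> \<kappa>)" "ptgt \<kappa>" "psrc \<kappa>"]) (use assms ow o that in simp_all)
  have os: "ok (psrc \<kappa> @ [s])" "ok (ptgt \<kappa> @ [s])" using pwf_ok[OF s(3)] s by auto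
  have ows: "ok (ws @ psrc \<kappa> @ [s])" "ok (ws @ ptgt \<kappa> @ [s])"
    using ok_append[of "ws @ psrc \<kappa>" "[s]"] ok_append[of "ws @ ptgt \<kappa>" "[s]"] ow ow' s o by simp_all
  have 1: "ws \<rhd> (\<mu> \<cdot> \<kappa> \<lhd> [s]) = ws \<rhd> pid (psrc \<kappa> @ [s])"
  proof -
    have "ws \<rhd> (\<mu> \<cdot> \<kappa> \<lhd> [s]) = (piv (ws \<rhd> \<kappa>) \<cdot> ws \<rhd> \<kappa>) \<lhd> [s]" using s(6) by simp
    also have "\<dots> = ws \<rhd> pid (psrc \<kappa> @ [s])" using assms ow ows o by (subst piv_simps) simp_all
    finally show ?thesis .
  qed
  have 2: "ws \<rhd> (\<kappa> \<lhd> [s] \<cdot> \<mu>) = ws \<rhd> pid (ptgt \<kappa> @ [s])"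
  proof -
    have "ws \<rhd> (\<kappa> \<lhd> [s] \<cdot> \<mu>) = (ws \<rhd> \<kappa> \<cdot> piv (ws \<rhd> \<kappa>)) \<lhd> [s]" using s(6) by simp
    also have "\<dots> = ws \<rhd> pid (ptgt \<kappa> @ [s])" using assms ow ow' ows o by (subst piv_simps) simp_all
    finally show ?thesis .
  qed
  obtain g where g: "Wl g" "ok (psrc (\<mu> \<cdot> \<kappa> \<lhd> [s]) @ g)" "(\<mu> \<cdot> \<kappa> \<lhd> [s]) \<lhd> g = pid (psrc \<kappa> @ [s]) \<lhd> g"
    by (rule W_faithful[OF assms(1) _ _ _ _ _ 1]) (use assms(2) s os ows in simp_all)
  have gn: "g \<noteq> []" using g Wl_nonempty by blast
  have og: "ok (psrc \<kappa> @ s # g)" using g(2) assms(2) s os by simp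
  then have og': "ok (ptgt \<kappa> @ s # g)" using ok_ptgt_prwhisk[OF assms(2), of "s # g"] by simp
  have owg: "ok (ws @ ptgt \<kappa> @ s # g)" using ok_append[of ws "ptgt \<kappa> @ s # g"] ok_append[of ws
      "ptgt \<kappa>"] og' ow' o assms(1) Wl_nonempty by simp
  obtain h where h: "Wl h" "ok (psrc ((\<kappa> \<lhd> [s] \<cdot> \<mu>) \<lhd> g) @ h)"
      "(\<kappa> \<lhd> [s] \<cdot> \<mu>) \<lhd> g \<lhd> h = pid (ptgt \<kappa> @ [s]) \<lhd> g \<lhd> h"
  proof (rule W_faithful[OF assms(1), of "(\<kappa> \<lhd> [s] \<cdot> \<mu>) \<lhd> g" "pid (ptgt \<kappa> @ [s]) \<lhd> g"])
    show "ws \<rhd> (\<kappa> \<lhd> [s] \<cdot> \<mu>) \<lhd> g = ws \<rhd> pid (ptgt \<kappa> @ [s]) \<lhd> g"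
      using arg_cong[OF 2, of "\<lambda>c. c \<lhd> g"] by simp
  qed (use assms(2) s os og og' owg that in simp_all)
  \<comment> \<open>\<open>s\<close> makes the lifted inverse exist, \<open>g\<close> makes it a
    left inverse and \<open>h\<close> a right inverse.\<close>
  let ?S = "s # g @ h"
  have oh: "ok (ptgt \<kappa> @ ?S)" using h(2) assms(2) s os og og' by simp
  have oh': "ok (psrc \<kappa> @ ?S)" using oh ok_ptgt_prwhisk[OF assms(2), of ?S] by simp
  have "piso (\<kappa> \<lhd> ?S) \<and> piv (\<kappa> \<lhd> ?S) = \<mu> \<lhd> (g @ h)"
  proof (rule isocI)
    show "\<mu> \<lhd> (g @ h) \<cdot> \<kappa> \<lhd> ?S = pid (psrc (\<kappa> \<lhd> ?S))"
      using arg_cong[OF g(3), of "\<lambda>c. c \<lhd> h"] assms(2) oh' og os by simp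
    show "\<kappa> \<lhd> ?S \<cdot> \<mu> \<lhd> (g @ h) = pid (ptgt (\<kappa> \<lhd> ?S))"
      using h(3) assms(2) oh oh' og og' os by simp
  qed (use assms(2) s oh oh' in simp_all)
  moreover have "Wl ?S"
  proof -
    have "Wl (g @ h)"
      by (rule Wl_append[OF g(1) h(1)]) (use ok_appendD2[of "ptgt \<kappa> @ [s]" "g @ h"] oh gn in simp)
    then show ?thesis using Wl_append[of "[s]" "g @ h"] ok_appendD2[OF oh] s by simp
  qed
  ultimately show ?thesis using that[of ?S] oh' by blast
qed

end

section \<open>Representatives and existence of auxiliary data\<close>

context bicategory_of_fractions
begin

section \<open>Choices and representatives in the strict calculus\<close>

lemma iso_pval: "piso a \<Longrightarrow> psrc a = xs \<Longrightarrow> ptgt a = ys \<Longrightarrow> iso xs ys (pval a)"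
  using pwf_ok[of a] by (auto simp: iso_def piso_def hom2_def)

lemma W_comp: "f \<in> W \<Longrightarrow> g \<in> W \<Longrightarrow> src C g = tgt C f \<Longrightarrow> g \<odot> f \<in> W"
  using BF2[of "src C f" "tgt C f" f "tgt C g" g] by (simp add: hom_def)

lemma Pcell_pval: "psrc a = xs \<Longrightarrow> ptgt a = ys \<Longrightarrow> Pcell xs ys (pval a) = a"
  by (auto intro!: pcell_eqI)

lemma choice_cell:
  assumes "f \<in> Mor C" "v \<in> W" "tgt C f = tgt C v" "choice f v = (D, v', f', \<rho>)"
  shows "v' \<in> W" "f' \<in> Mor C" "tgt C v' = src C f" "tgt C f' = src C v" "src C v' = D" "src C f' = D"
    "piso (Pcell [f, v'] [v, f'] \<rho>)"
proof -
  have h: "hom (src C f) (tgt C v) f" "hom (src C v) (tgt C v) v" using assms by (auto simp: hom_def)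
  have "hom D (src C f) v' \<and> v' \<in> W \<and> hom D (src C v) f' \<and> iso [f, v'] [v, f'] \<rho>"
    using choice[OF h assms(2,4)] .
  then show "v' \<in> W" "f' \<in> Mor C" "tgt C v' = src C f" "tgt C f' = src C v" "src C v' = D" "src C f' = D"
    "piso (Pcell [f, v'] [v, f'] \<rho>)" using assms by (auto simp: hom_def Pcell_iso)
qed

lemmas to_pval = whisk_pval unbr_pval pval_piv[symmetric] piv_Pcell pval_pvcomp

lemma pval_pcol:
  assumes "ok q" "w \<in> Mor C" "src C w = tgt C (hd q)"
  shows "pval ([w] \<rhd> pcol q) = id2 C (w \<odot> path q)" "pval ([w] \<rhd> piv (pcol q)) = id2 C (w \<odot> path q)"
proof -
  have q: "q \<noteq> []" using assms by auto
  have "ok [w, path q]" "ok (w # q)" using assms q by (auto simp: ok_Cons)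
  then show "pval ([w] \<rhd> pcol q) = id2 C (w \<odot> path q)" "pval ([w] \<rhd> piv (pcol q)) = id2 C (w \<odot> path q)"
    using assms by (simp_all add: pval_plwhisk pval_piv) (simp_all add: pcol_def)
qed

text \<open>Absorbing the tails into single letters changes only the paths a cell is taken between,
  not its value, because \<open>path (w # q)\<close> is already
  \<open>w \<odot> path q\<close>.\<close>

lemma Pcell_rebracket:
  assumes "pwf a" "psrc a = w # q" "ptgt a = w' # q'" "q \<noteq> []" "q' \<noteq> []"
  shows "Pcell [w, path q] [w', path q'] (pval a) = [w'] \<rhd> piv (pcol q') \<cdot> a \<cdot> [w] \<rhd> pcol q"
proof -
  note o = pwf_ok[OF assms(1)]
  have q: "ok q" "w \<in> Mor C" "src C w = tgt C (hd q)" "ok q'" "w' \<in> Mor C" "src C w' = tgt C (hd q')"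
    using o assms by (auto simp: ok_Cons)
  have o2: "ok (w # q)" "ok (w' # q')" "ok [w, path q]" "ok [w', path q']" using o assms q by auto
  have "pval ([w'] \<rhd> piv (pcol q') \<cdot> a \<cdot> [w] \<rhd> pcol q) = pval a"
    using assms q o o2 by (simp add: pval_pcol path_Cons)
  then show ?thesis using assms q o2 by (intro pcell_eqI) simp_all
qed

lemma is_frep_cells:
  assumes "is_frep (X, w, k) (X', w', k') (T, q, q', \<alpha>, \<beta>)"
  shows "piso (Pcell [w, q] [w', q'] \<alpha>)" "pwf (Pcell [k, q] [k', q'] \<beta>)" "Wl [w, q]"
    "w \<in> W" "w' \<in> W" "k \<in> Mor C" "k' \<in> Mor C" "q \<in> Mor C" "q' \<in> Mor C"
    "src C w = X" "src C k = X" "src C w' = X'" "src C k' = X'" "tgt C w' = tgt C w" "tgt C k' = tgt C k"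
    "src C q = T" "src C q' = T" "tgt C q = X" "tgt C q' = X'" "T \<in> Ob C"
  using assms by (auto simp: hom_def Pcell_iso Pcell_cell Wl_def)

text \<open>Carries the equivalence of representatives into the calculus, where the witnessing cells
  can be whiskered and composed freely.\<close>

lemma frep_equiv_iff:
  assumes "is_frep (X, w, k) (X', w', k') (T, q, q', \<alpha>, \<beta>)"
    and "is_frep (X, w, k) (X', w', k') (S, p, p', \<gamma>, \<delta>)"
  shows "frep_equiv (X, w, k) (X', w', k') (T, q, q', \<alpha>, \<beta>) (S, p, p', \<gamma>, \<delta>) \<longleftrightarrow>
    (\<exists>z z' \<sigma> \<tau>. piso \<sigma> \<and> psrc \<sigma> = [p, z'] \<and> ptgt \<sigma> = [q, z] \<and> piso \<tau> \<and> psrc \<tau> = [q', z] \<and> ptgt \<tau> = [p', z'] \<and>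
      Wl [w, q, z] \<and>
      [w'] \<rhd> \<tau> \<cdot> Pcell [w, q] [w', q'] \<alpha> \<lhd> [z] \<cdot> [w] \<rhd> \<sigma> = Pcell [w, p] [w', p'] \<gamma> \<lhd> [z'] \<and>
      [k'] \<rhd> \<tau> \<cdot> Pcell [k, q] [k', q'] \<beta> \<lhd> [z] \<cdot> [k] \<rhd> \<sigma> = Pcell [k, p] [k', p'] \<delta> \<lhd> [z'])"
    (is "?L \<longleftrightarrow> (\<exists>z z' \<sigma> \<tau>. ?R z z' \<sigma> \<tau>)")
proof -
  note a = is_frep_cells[OF assms(1)] and b = is_frep_cells[OF assms(2)]
  have eq: "whisk [m'] [q', z] [p', z'] [] \<tau> \<bullet> whisk [] [m, q] [m', q'] [z] \<epsilon> \<bullet>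
      whisk [m] [p, z'] [q, z] [] \<sigma> =
      whisk [] [m, p] [m', p'] [z'] \<zeta> \<longleftrightarrow>
      [m'] \<rhd> Pcell [q', z] [p', z'] \<tau> \<cdot> Pcell [m, q] [m', q'] \<epsilon> \<lhd> [z] \<cdot> [m] \<rhd> Pcell [p, z'] [q, z] \<sigma> =
      Pcell [m, p] [m', p'] \<zeta> \<lhd> [z']" (is "?l \<longleftrightarrow> ?a = ?b")
    if z: "z \<in> Mor C" "z' \<in> Mor C" "tgt C z = T" "tgt C z' = S" "src C z = src C z'"
      and c: "pwf (Pcell [p, z'] [q, z] \<sigma>)" "pwf (Pcell [q', z] [p', z'] \<tau>)"
      and m: "(m = w \<and> m' = w' \<and> \<epsilon> = \<alpha> \<and> \<zeta> = \<gamma>) \<or> (m = k \<and> m' = k' \<and> \<epsilon> = \<beta> \<and> \<zeta> = \<delta>)" for z z' \<sigma> \<tau> m m' \<epsilon> \<zeta>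
  proof -
    have w: "pwf (Pcell [m, q] [m', q'] \<epsilon>)" "pwf (Pcell [m, p] [m', p'] \<zeta>)" using m a b by auto
    have mm: "m \<in> Mor C" "m' \<in> Mor C" "src C m = X" "src C m' = X'" using m a b by auto
    have A: "whisk [m'] [q', z] [p', z'] [] \<tau> \<bullet> whisk [] [m, q] [m', q'] [z] \<epsilon> \<bullet>
        whisk [m] [p, z'] [q, z] [] \<sigma> = pval ?a"
      using a(8-) b(8-) z c w mm by (simp add: whisk_pval)
    have B: "whisk [] [m, p] [m', p'] [z'] \<zeta> = pval ?b"
      using a(8-) b(8-) z c w mm by (simp add: whisk_pval)
    have "psrc ?a = psrc ?b" "ptgt ?a = ptgt ?b"
      using a(8-) b(8-) z c w mm by simp_all
    then show ?thesis unfolding A B using pcell_eqI by auto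
  qed
  show ?thesis
  proof
    assume ?L
    then obtain A4 z z' \<sigma> \<tau> where r: "hom A4 T z" "hom A4 S z'"
        "iso [p, z'] [q, z] \<sigma>" "iso [q', z] [p', z'] \<tau>" "path [w, q, z] \<in> W"
        "whisk [w'] [q', z] [p', z'] [] \<tau> \<bullet> whisk [] [w, q] [w', q'] [z] \<alpha> \<bullet>
          whisk [w] [p, z'] [q, z] [] \<sigma> = whisk [] [w, p] [w', p'] [z'] \<gamma>"
        "whisk [k'] [q', z] [p', z'] [] \<tau> \<bullet> whisk [] [k, q] [k', q'] [z] \<beta> \<bullet>
          whisk [k] [p, z'] [q, z] [] \<sigma> = whisk [] [k, p] [k', p'] [z'] \<delta>"
      by auto
    have z: "z \<in> Mor C" "z' \<in> Mor C" "tgt C z = T" "tgt C z' = S" "src C z = src C z'"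
      using r by (auto simp: hom_def)
    have c: "piso (Pcell [p, z'] [q, z] \<sigma>)" "piso (Pcell [q', z] [p', z'] \<tau>)"
      using r z a b by (auto simp: Pcell_iso)
    have "?R z z' (Pcell [p, z'] [q, z] \<sigma>) (Pcell [q', z] [p', z'] \<tau>)"
      using eq[OF z c[THEN piso_pwf], of w w' \<alpha> \<gamma>] eq[OF z c[THEN piso_pwf], of k k' \<beta> \<delta>] r c a(8-) z
      by (simp add: Wl_def a)
    then show "\<exists>z z' \<sigma> \<tau>. ?R z z' \<sigma> \<tau>" by blast
  next
    assume "\<exists>z z' \<sigma> \<tau>. ?R z z' \<sigma> \<tau>"
    then obtain z z' \<sigma> \<tau> where r: "?R z z' \<sigma> \<tau>" by blast
    have P: "\<sigma> = Pcell [p, z'] [q, z] (pval \<sigma>)" "\<tau> = Pcell [q', z] [p', z'] (pval \<tau>)"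
      using r by (auto intro!: pcell_eqI)
    have o: "ok [p, z']" "ok [q, z]" "ok [q', z]" "ok [p', z']" using r pwf_ok[of \<sigma>] pwf_ok[of \<tau>] by auto
    have z: "z \<in> Mor C" "z' \<in> Mor C" "tgt C z = T" "tgt C z' = S" "src C z = src C z'"
      using o pwf_ok(5)[of \<sigma>] r a b by auto
    have h: "hom (src C z') T z" "hom (src C z') S z'" using z by (auto simp: hom_def a b)
    have c: "pwf (Pcell [p, z'] [q, z] (pval \<sigma>))" "pwf (Pcell [q', z] [p', z'] (pval \<tau>))"
      using r P by (metis piso_pwf)+
    have "iso [p, z'] [q, z] (pval \<sigma>)" "iso [q', z] [p', z'] (pval \<tau>)"
      using r P o by (metis Pcell_iso)+
    moreover have "path [w, q, z] \<in> W" using r unfolding Wl_def by blast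
    moreover have e: "[w'] \<rhd> Pcell [q', z] [p', z'] (pval \<tau>) \<cdot> Pcell [w, q] [w', q'] \<alpha> \<lhd> [z] \<cdot>
        [w] \<rhd> Pcell [p, z'] [q, z] (pval \<sigma>) =
      Pcell [w, p] [w', p'] \<gamma> \<lhd> [z']"
      "[k'] \<rhd> Pcell [q', z] [p', z'] (pval \<tau>) \<cdot> Pcell [k, q] [k', q'] \<beta> \<lhd> [z] \<cdot>
          [k] \<rhd> Pcell [p, z'] [q, z] (pval \<sigma>) =
      Pcell [k, p] [k', p'] \<delta> \<lhd> [z']"
      using r P by metis+
    note eq[OF z c, of w w' \<alpha> \<gamma>, THEN iffD2, OF _ e(1)] eq[OF z c, of k k' \<beta> \<delta>, THEN iffD2, OF _ e(2)]
    ultimately show ?L using h unfolding frep_equiv.simps by blast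
  qed
qed

lemma frep_equiv_refl:
  assumes "is_frep (X, w, k) (X', w', k') (T, q, q', \<alpha>, \<beta>)"
  shows "frep_equiv (X, w, k) (X', w', k') (T, q, q', \<alpha>, \<beta>) (T, q, q', \<alpha>, \<beta>)"
proof -
  note a = is_frep_cells[OF assms]
  let ?i = "id1 C T"
  have i: "?i \<in> Mor C" "src C ?i = T" "tgt C ?i = T" "?i \<in> W" using a BF1 by auto
  have "Wl [w, q, ?i]" using Wl_append[of "[w, q]" "[?i]"] a i by simp
  then show ?thesis unfolding frep_equiv_iff[OF assms assms] using a i
    by (intro exI[of _ ?i] exI[of _ "pid [q, ?i]"] exI[of _ "pid [q', ?i]"]) simp
qed

lemma is_frep_pval:
  assumes K: "is_fmor A B (X, w, k)" "is_fmor A B (X', w', k')"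
    and a: "piso a" "psrc a = w # q" "ptgt a = w' # q'" "pwf b" "psrc b = k # q" "ptgt b = k' # q'"
    and q: "Wl (w # q)" "q \<noteq> []" "q' \<noteq> []"
  shows "is_frep (X, w, k) (X', w', k') (src C (last q), path q, path q', pval a, pval b)"
proof -
  have wa: "pwf a" using a by simp
  note o = pwf_ok[OF wa] pwf_ok[OF a(4)]
  have h: "ok q" "ok q'" "src C w = tgt C (hd q)" "src C w' = tgt C (hd q')"
      "src C (last q') = src C (last q)"
    "src C k = tgt C (hd q)" "src C k' = tgt C (hd q')" "w \<in> Mor C" "w' \<in> Mor C" "k \<in> Mor C" "k' \<in> Mor C"
    using o a q by (auto simp: ok_Cons)
  have o2: "ok [w, path q]" "ok [w', path q']" "ok [k, path q]" "ok [k', path q']" using h by auto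
  have "piso (Pcell [w, path q] [w', path q'] (pval a))"
    using a h o o2 q by (simp add: Pcell_rebracket)
  moreover have "pwf (Pcell [k, path q] [k', path q'] (pval b))"
    using a h o o2 q by (simp add: Pcell_rebracket)
  moreover have "w \<odot> path q \<in> W" using q by (simp add: Wl_def path_Cons)
  ultimately show ?thesis
    using K h o2 by (auto simp: hom_def Pcell_iso Pcell_cell)
qed

section \<open>Existence of auxiliary data for the operations, so that the choices by
  \<open>SOME\<close> satisfy their relations\<close>

lemma fvcomp_rel_exists:
  assumes "is_fcell K K' \<Gamma>" "is_fcell K' K'' \<Delta>"
  shows "\<exists>\<Omega>. fvcomp_rel \<Gamma> \<Delta> \<Omega>"
proof -
  obtain X w k X' w' k' X'' w'' k'' where K: "K = (X, w, k)" "K' = (X', w', k')" "K'' = (X'', w'', k'')"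
    by (cases K; cases K'; cases K'') auto
  obtain T q q' \<alpha> \<beta> where f: "is_frep (X, w, k) (X', w', k') (T, q, q', \<alpha>, \<beta>)"
    "\<Gamma> = fclass (X, w, k) (X', w', k') (T, q, q', \<alpha>, \<beta>)"
    using assms(1) by (auto simp: is_fcell_def K simp del: is_frep.simps)
  obtain S p p' \<gamma> \<delta> where g: "is_frep (X', w', k') (X'', w'', k'') (S, p, p', \<gamma>, \<delta>)"
    "\<Delta> = fclass (X', w', k') (X'', w'', k'') (S, p, p', \<gamma>, \<delta>)"
    using assms(2) by (auto simp: is_fcell_def K simp del: is_frep.simps)
  note a = is_frep_cells[OF f(1)] and b = is_frep_cells[OF g(1)]
  \<comment> \<open>Only \<open>w' \<odot> p\<close> is known to lie in \<open>W\<close>, hence the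
    lifted square in place of plain (BF3).\<close>
  obtain t l \<rho> where t: "t \<in> W" "l \<in> Mor C" "tgt C t = src C q'" "tgt C l = src C p" "src C l = src C t"
    "piso \<rho>" "psrc \<rho> = [q', t]" "ptgt \<rho> = [p, l]"
    by (rule ore_square[OF b(4,3), of q']) (use a that in auto)
  have h: "hom (src C t) T t" "hom (src C t) S l" using t a b by (auto simp: hom_def)
  show ?thesis unfolding f(2) g(2)
    using fvcomp_rel.intros[OF f(1) g(1) h(1) t(1) h(2) iso_pval[OF t(6-8)] refl refl] by blast
qed

text \<open>The squares come from (BF3), and the cell \<Lambda> from lifting its prescribed
  whiskering through \<open>u\<close>. The lift exists only after a refinement, which is absorbed
  into the last 1-morphisms \<open>u7\<close> and \<open>u8\<close>.\<close>

lemma fwhisk_l_rel_exists: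
  assumes G: "is_fmor B E G" and K: "is_fmor A B K" "is_fmor A B K'" and \<Gamma>: "is_fcell K K' \<Gamma>"
  shows "\<exists>\<Omega>. fwhisk_l_rel G \<Gamma> \<Omega>"
proof -
  obtain A1 w1 f1 A2 w2 f2 B' u g where KK: "K = (A1, w1, f1)" "K' = (A2, w2, f2)" "G = (B', u, g)"
    by (cases K; cases K'; cases G) auto
  note G = G[unfolded KK] and K = K[unfolded KK]
  obtain A3 v1 v2 \<alpha> \<beta> where f: "is_frep (A1, w1, f1) (A2, w2, f2) (A3, v1, v2, \<alpha>, \<beta>)"
    "\<Gamma> = fclass (A1, w1, f1) (A2, w2, f2) (A3, v1, v2, \<alpha>, \<beta>)"
    using \<Gamma> by (auto simp: is_fcell_def KK simp del: is_frep.simps)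
  obtain D1 u1 h1 \<rho>1 D2 u2 h2 \<rho>2 where c: "choice f1 u = (D1, u1, h1, \<rho>1)" "choice f2 u = (D2, u2, h2, \<rho>2)"
    by (cases "choice f1 u"; cases "choice f2 u") auto
  note a = is_frep_cells[OF f(1)]
  have u: "u \<in> W" "tgt C f1 = tgt C u" "tgt C f2 = tgt C u" "src C u = B'" "g \<in> Mor C" "src C g = B'"
    using G K by (auto simp: hom_def)
  note c1 = choice_cell[OF a(6) u(1,2) c(1)] and c2 = choice_cell[OF a(7) u(1,3) c(2)]
  obtain u3 u4 \<eta>1 where e1: "u3 \<in> W" "u4 \<in> Mor C" "tgt C u3 = src C (last [v1])"
      "tgt C u4 = src C (last [u1])"
    "src C u4 = src C u3" "piso \<eta>1" "psrc \<eta>1 = [v1] @ [u3]" "ptgt \<eta>1 = [u1] @ [u4]"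
    by (rule BF3l[of "[u1]" "[v1]"]) (use a c1 that in auto)
  obtain u5 u6 \<eta>2 where e2: "u5 \<in> W" "u6 \<in> Mor C" "tgt C u5 = src C (last [v2])"
      "tgt C u6 = src C (last [u2])"
    "src C u6 = src C u5" "piso \<eta>2" "psrc \<eta>2 = [v2] @ [u5]" "ptgt \<eta>2 = [u2] @ [u6]"
    by (rule BF3l[of "[u2]" "[v2]"]) (use a c2 that in auto)
  obtain u7 u8 \<eta>3 where e3: "u7 \<in> W" "u8 \<in> Mor C" "tgt C u7 = src C (last [u3])"
      "tgt C u8 = src C (last [u5])"
    "src C u8 = src C u7" "piso \<eta>3" "psrc \<eta>3 = [u3] @ [u7]" "ptgt \<eta>3 = [u5] @ [u8]"
    by (rule BF3l[of "[u5]" "[u3]"]) (use a e1 e2 that in auto)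
  note M = e1(1-5) e2(1-5) e3(1-5) a(3-) c1(1-6) c2(1-6) u
  have ee: "psrc \<eta>1 = [v1, u3]" "ptgt \<eta>1 = [u1, u4]" "psrc \<eta>2 = [v2, u5]" "ptgt \<eta>2 = [u2, u6]"
      "psrc \<eta>3 = [u3, u7]" "ptgt \<eta>3 = [u5, u8]"
    using e1 e2 e3 by simp_all
  note cells = e1(6) e2(6) e3(6) ee a(1,2) c1(7) c2(7)
  let ?\<beta> = "Pcell [f1, v1] [f2, v2] \<beta>" and ?r1 = "Pcell [f1, u1] [u, h1] \<rho>1"
      and ?r2 = "Pcell [f2, u2] [u, h2] \<rho>2"
  \<comment> \<open>This is the value prescribed for \<open>u\<close> whiskered with \<Lambda>,
    before refinement.\<close>
  define \<theta> where "\<theta> = ?r2 \<lhd> [u6, u8] \<cdot> [f2] \<rhd> (\<eta>2 \<lhd> [u8]) \<cdot> [f2, v2] \<rhd> \<eta>3 \<cdot> ?\<beta> \<lhd> [u3, u7] \<cdot>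
      [f1] \<rhd> (piv \<eta>1 \<lhd> [u7]) \<cdot> piv ?r1 \<lhd> [u4, u7]"
  have \<theta>: "pwf \<theta>" "psrc \<theta> = [u] @ [h1, u4] @ [u7]" "ptgt \<theta> = [u] @ [h2, u6] @ [u8]"
    using cells M by (simp_all add: \<theta>_def)
  obtain d L where d: "d \<in> W" "tgt C d = src C u7" "pwf L" "psrc L = [h1, u4] @ [u7 \<odot> d]"
      "ptgt L = [h2, u6] @ [u8 \<odot> d]"
    "[u] \<rhd> L = shrink [d] \<theta>"
    by (rule BF4_shrink[OF _ \<theta>]) (use u that in auto)
  note M = M d(1,2)
  \<comment> \<open>Since \<open>d\<close> is absorbed into \<open>u7\<close> and \<open>u8\<close>,
    the cell \<open>\<eta>3\<close> between them has to be restricted as well.\<close>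
  let ?u7 = "u7 \<odot> d" and ?u8 = "u8 \<odot> d" and ?e3 = "shrink [d] \<eta>3"
  have e3': "piso ?e3" "psrc ?e3 = [u3, ?u7]" "ptgt ?e3 = [u5, ?u8]"
    using shrink_simps[of \<eta>3 "[d]"] cells M by simp_all
  have pr1: "shrink [d] (x \<lhd> [y, z]) = x \<lhd> [y, z \<odot> d]" if "pwf x" "ok (psrc x @ [y, z, d])" for x y z
    using shrink_prwhisk[of x "[y]" z "[d]"] that by simp
  have pr2: "shrink [d] (x \<lhd> [z]) = x \<lhd> [z \<odot> d]" if "pwf x" "ok (psrc x @ [z, d])" for x z
    using shrink_prwhisk[of x "[]" z "[d]"] that by simp
  have eq: "[u] \<rhd> L = ?r2 \<lhd> [u6, ?u8] \<cdot> [f2] \<rhd> (\<eta>2 \<lhd> [?u8]) \<cdot> [f2, v2] \<rhd> ?e3 \<cdot> ?\<beta> \<lhd> [u3, ?u7] \<cdot>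
      [f1] \<rhd> (piv \<eta>1 \<lhd> [?u7]) \<cdot> piv ?r1 \<lhd> [u4, ?u7]"
    unfolding d(6) \<theta>_def using cells M by (simp add: shrink_pvcomp shrink_plwhisk pr1 pr2)
  have h: "hom (src C u3) A3 u3" "hom (src C u5) A3 u5" "hom (src C u3) D1 u4" "hom (src C u5) D2 u6"
    "hom (src C d) (src C u3) ?u7" "hom (src C d) (src C u5) ?u8" "?u7 \<in> W"
    using M by (auto simp: hom_def W_comp)
  have i: "iso [v1, u3] [u1, u4] (pval \<eta>1)" "iso [v2, u5] [u2, u6] (pval \<eta>2)"
      "iso [u3, ?u7] [u5, ?u8] (pval ?e3)"
    using cells e3' by (simp_all add: iso_pval)
  have cl: "cell [h1, u4, ?u7] [h2, u6, ?u8] (pval L)" using cell_pval[OF d(3)] d by simp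
  have Pp: "Pcell [v1, u3] [u1, u4] (pval \<eta>1) = \<eta>1" "Pcell [v2, u5] [u2, u6] (pval \<eta>2) = \<eta>2"
      "Pcell [u3, ?u7] [u5, ?u8] (pval ?e3) = ?e3"
    "Pcell [h1, u4, ?u7] [h2, u6, ?u8] (pval L) = L" "Pcell [u1, u4] [v1, u3] (inv2 (pval \<eta>1)) = piv \<eta>1"
    using cells e3' d by (simp_all add: Pcell_pval) (simp add: piv_def)
  have raw: "whisk [u] [h1, u4, ?u7] [h2, u6, ?u8] [] (pval L) =
       whisk [] [f2, u2] [u, h2] [u6, ?u8] \<rho>2 \<bullet> whisk [f2] [v2, u5] [u2, u6] [?u8] (pval \<eta>2) \<bullet>
       whisk [f2, v2] [u3, ?u7] [u5, ?u8] [] (pval ?e3) \<bullet> whisk [] [f1, v1] [f2, v2] [u3, ?u7] \<beta> \<bullet>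
       whisk [f1] [u1, u4] [v1, u3] [?u7] (inv2 (pval \<eta>1)) \<bullet> whisk [] [u, h1] [f1, u1] [u4, ?u7] (inv2 \<rho>1)"
    using arg_cong[OF eq, of pval] cells e3' d M
    by (simp add: whisk_pval Pp piv_Pcell pval_pvcomp del: psrc_pvcomp(3))
  show ?thesis unfolding f(2) KK
    using fwhisk_l_rel.intros[OF G K f(1) c h(1) e1(1) h(2) e2(1) h(3,4) i(1,2) h(5,7,6) i(3) cl raw refl
        refl refl] by blast
qed

text \<open>Here the lift goes through the composite of \<open>v1\<close> and \<open>u1\<close>,
  which lies in \<open>W\<close> by the definition of a representative. The squares over
  \<open>u1\<close> and \<open>u2\<close> need \<open>ore_square\<close>, as these legs need not lie
  in \<open>W\<close>.\<close>

lemma fwhisk_r_rel_exists: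
  assumes K: "is_fmor A B K" and G: "is_fmor B E G" "is_fmor B E G'" and \<Delta>: "is_fcell G G' \<Delta>"
  shows "\<exists>\<Omega>. fwhisk_r_rel \<Delta> K \<Omega>"
proof -
  obtain A' w f B1 v1 g1 B2 v2 g2 where KK: "K = (A', w, f)" "G = (B1, v1, g1)" "G' = (B2, v2, g2)"
    by (cases K; cases G; cases G') auto
  note G = G[unfolded KK] and K = K[unfolded KK]
  obtain B3 u1 u2 \<alpha> \<beta> where ff: "is_frep (B1, v1, g1) (B2, v2, g2) (B3, u1, u2, \<alpha>, \<beta>)"
    "\<Delta> = fclass (B1, v1, g1) (B2, v2, g2) (B3, u1, u2, \<alpha>, \<beta>)"
    using \<Delta> by (auto simp: is_fcell_def KK simp del: is_frep.simps)
  obtain D1 w1 f1 \<rho>1 D2 w2 f2 \<rho>2 where c: "choice f v1 = (D1, w1, f1, \<rho>1)" "choice f v2 = (D2, w2, f2, \<rho>2)"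
    by (cases "choice f v1"; cases "choice f v2") auto
  note a = is_frep_cells[OF ff(1)]
  have u: "w \<in> W" "f \<in> Mor C" "tgt C f = tgt C v1" "tgt C f = tgt C v2" "src C w = A'" "src C f = A'"
    using G K by (auto simp: hom_def)
  note c1 = choice_cell[OF u(2) a(4) u(3) c(1)] and c2 = choice_cell[OF u(2) a(5) u(4) c(2)]
  note M = a(4-) c1(1-6) c2(1-6) u(1,2,5,6)
  obtain t1 h1 \<sigma>1 where e1: "t1 \<in> W" "h1 \<in> Mor C" "tgt C t1 = src C f1" "tgt C h1 = src C u1"
      "src C h1 = src C t1"
    "piso \<sigma>1" "psrc \<sigma>1 = [f1, t1]" "ptgt \<sigma>1 = [u1, h1]"
    by (rule ore_square[OF a(4,3), of f1]) (use M that in auto)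
  have "Wl [v2, u2]" using Wl_ptgt[OF a(1)] a(3) by simp
  then obtain t2 h2 \<sigma>2 where e2: "t2 \<in> W" "h2 \<in> Mor C" "tgt C t2 = src C f2" "tgt C h2 = src C u2"
      "src C h2 = src C t2"
    "piso \<sigma>2" "psrc \<sigma>2 = [f2, t2]" "ptgt \<sigma>2 = [u2, h2]"
    by (rule ore_square[OF a(5) _, of _ f2]) (use M that in auto)
  have "Wl [w2, t2]" using Wl_Cons[of w2 "[t2]"] M e2 by simp
  then obtain t3 t4 \<phi> where e3: "t3 \<in> W" "t4 \<in> Mor C" "tgt C t3 = src C (last [w1, t1])"
      "tgt C t4 = src C (last [w2, t2])"
    "src C t4 = src C t3" "piso \<phi>" "psrc \<phi> = [w1, t1] @ [t3]" "ptgt \<phi> = [w2, t2] @ [t4]"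
    by (rule BF3l[of _ "[w1, t1]"]) (use M e1 e2 that in auto)
  note M = M e1(1-5) e2(1-5) e3(1-5)
  have ph: "psrc \<phi> = [w1, t1, t3]" "ptgt \<phi> = [w2, t2, t4]" using e3 by simp_all
  note cells = e1(6-8) e2(6-8) e3(6) ph a(1,2) c1(7) c2(7)
  let ?\<alpha> = "Pcell [v1, u1] [v2, u2] \<alpha>" and ?r1 = "Pcell [f, w1] [v1, f1] \<rho>1"
      and ?r2 = "Pcell [f, w2] [v2, f2] \<rho>2"
  \<comment> \<open>All factors are invertible, so the lift is invertible too, as is demanded of
    \<delta>.\<close>
  define \<theta> where "\<theta> = piv ?\<alpha> \<lhd> [h2, t4] \<cdot> [v2] \<rhd> (\<sigma>2 \<lhd> [t4]) \<cdot> ?r2 \<lhd> [t2, t4] \<cdot> [f] \<rhd> \<phi> \<cdot>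
      piv ?r1 \<lhd> [t1, t3] \<cdot> [v1] \<rhd> (piv \<sigma>1 \<lhd> [t3])"
  have \<theta>: "piso \<theta>" "psrc \<theta> = [v1, u1] @ [h1] @ [t3]" "ptgt \<theta> = [v1, u1] @ [h2] @ [t4]"
    using cells M by (simp_all add: \<theta>_def)
  obtain d L where d: "d \<in> W" "tgt C d = src C t3" "pwf L" "psrc L = [h1] @ [t3 \<odot> d]"
      "ptgt L = [h2] @ [t4 \<odot> d]"
    "[v1, u1] \<rhd> L = shrink [d] \<theta>" "piso \<theta> \<Longrightarrow> piso L"
    by (rule BF4_shrink[OF a(3) piso_pwf[OF \<theta>(1)] \<theta>(2,3)]) (use that in auto)
  note M = M d(1,2)
  let ?t3 = "t3 \<odot> d" and ?t4 = "t4 \<odot> d" and ?p = "shrink [d] \<phi>"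
  have e3': "piso ?p" "psrc ?p = [w1, t1, ?t3]" "ptgt ?p = [w2, t2, ?t4]" "piso L" "psrc L = [h1, ?t3]"
      "ptgt L = [h2, ?t4]"
    using shrink_simps[of \<phi> "[d]"] cells M d \<theta> by simp_all
  have eq: "[v1, u1] \<rhd> L = piv ?\<alpha> \<lhd> [h2, ?t4] \<cdot> [v2] \<rhd> (\<sigma>2 \<lhd> [?t4]) \<cdot> ?r2 \<lhd> [t2, ?t4] \<cdot> [f] \<rhd> ?p \<cdot>
      piv ?r1 \<lhd> [t1, ?t3] \<cdot> [v1] \<rhd> (piv \<sigma>1 \<lhd> [?t3])"
    unfolding d(6) \<theta>_def using cells M by (simp add: shrink_pvcomp shrink_plwhisk shrink_prwhisk1
        shrink_prwhisk2)
  have h: "hom (src C t1) D1 t1" "hom (src C t2) D2 t2" "hom (src C t1) B3 h1" "hom (src C t2) B3 h2"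
    "hom (src C d) (src C t1) ?t3" "hom (src C d) (src C t2) ?t4" "?t3 \<in> W"
    using M by (auto simp: hom_def W_comp)
  have i: "iso [f1, t1] [u1, h1] (pval \<sigma>1)" "iso [f2, t2] [u2, h2] (pval \<sigma>2)"
      "iso [w1, t1, ?t3] [w2, t2, ?t4] (pval ?p)"
    "iso [h1, ?t3] [h2, ?t4] (pval L)"
    using cells e3' by (simp_all add: iso_pval)
  have Pp: "Pcell [f2, t2] [u2, h2] (pval \<sigma>2) = \<sigma>2" "Pcell [w1, t1, ?t3] [w2, t2, ?t4] (pval ?p) = ?p"
    "Pcell [h1, ?t3] [h2, ?t4] (pval L) = L" "Pcell [u1, h1] [f1, t1] (inv2 (pval \<sigma>1)) = piv \<sigma>1"
    using cells e3' by (simp_all add: Pcell_pval) (simp add: piv_def)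
  have raw: "whisk [v1, u1] [h1, ?t3] [h2, ?t4] [] (pval L) =
       whisk [] [v2, u2] [v1, u1] [h2, ?t4] (inv2 \<alpha>) \<bullet> whisk [v2] [f2, t2] [u2, h2] [?t4] (pval \<sigma>2) \<bullet>
       whisk [] [f, w2] [v2, f2] [t2, ?t4] \<rho>2 \<bullet> whisk [f] [w1, t1, ?t3] [w2, t2, ?t4] [] (pval ?p) \<bullet>
       whisk [] [v1, f1] [f, w1] [t1, ?t3] (inv2 \<rho>1) \<bullet> whisk [v1] [u1, h1] [f1, t1] [?t3] (inv2 (pval \<sigma>1))"
    using arg_cong[OF eq, of pval] cells e3' M
    by (simp add: whisk_pval Pp piv_Pcell pval_pvcomp del: psrc_pvcomp(3))
  show ?thesis unfolding ff(2) KK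
    using fwhisk_r_rel.intros[OF K G ff(1) c h(1) e1(1) h(2) e2(1) h(3,4) i(1,2) h(5,7,6) i(3,4) raw refl
        refl refl] by blast
qed

text \<open>Two lifts in succession: \<omega> through \<open>v\<close>, then \<rho> through
  \<open>w\<close>, where the second prescription involves the result of the first. Each costs a
  refinement.\<close>

lemma fassoc_rel_exists:
  assumes K: "is_fmor A B K" and G: "is_fmor B E G" and H: "is_fmor E D H"
  shows "\<exists>\<Omega>. fassoc_rel H G K \<Omega>"
proof -
  obtain A' u f B' v g E' w h where KK: "K = (A', u, f)" "G = (B', v, g)" "H = (E', w, h)"
    by (cases K; cases G; cases H) auto
  note K = K[unfolded KK] and G = G[unfolded KK] and H = H[unfolded KK]
  obtain A1 u1 f1 \<delta> where c1: "choice f v = (A1, u1, f1, \<delta>)" by (cases "choice f v") auto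
  obtain A2 u2 lf \<sigma> where c2: "choice (g \<odot> f1) w = (A2, u2, lf, \<sigma>)" by (cases "choice (g \<odot> f1) w") auto
  obtain B2 v1 g1 \<xi> where c3: "choice g w = (B2, v1, g1, \<xi>)" by (cases "choice g w") auto
  obtain A3 u3 f2 \<eta> where c4: "choice f (v \<odot> v1) = (A3, u3, f2, \<eta>)" by (cases "choice f (v \<odot> v1)") auto
  have M: "u \<in> W" "f \<in> Mor C" "src C u = A'" "src C f = A'" "v \<in> W" "g \<in> Mor C" "src C v = B'" "src C g = B'"
    "w \<in> W" "h \<in> Mor C" "src C w = E'" "src C h = E'" "tgt C f = B" "tgt C v = B" "tgt C g = E" "tgt C w = E"
    using K G H by (auto simp: hom_def)
  have cf: "v1 \<in> W" "g1 \<in> Mor C" "tgt C v1 = B'" "tgt C g1 = E'" "src C v1 = B2" "src C g1 = B2"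
      "piso (Pcell [g, v1] [w, g1] \<xi>)"
    "u1 \<in> W" "f1 \<in> Mor C" "tgt C u1 = A'" "tgt C f1 = B'" "src C u1 = A1" "src C f1 = A1"
        "piso (Pcell [f, u1] [v, f1] \<delta>)"
    using choice_cell[OF _ _ _ c3] choice_cell[OF _ _ _ c1] M by simp_all
  have "v \<odot> v1 \<in> W" using W_comp M cf by simp
  then have cf2: "u2 \<in> W" "lf \<in> Mor C" "tgt C u2 = A1" "tgt C lf = E'" "src C u2 = A2" "src C lf = A2"
      "piso (Pcell [g \<odot> f1, u2] [w, lf] \<sigma>)"
    "u3 \<in> W" "f2 \<in> Mor C" "tgt C u3 = A'" "tgt C f2 = B2" "src C u3 = A3" "src C f2 = A3"
        "piso (Pcell [f, u3] [v \<odot> v1, f2] \<eta>)"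
    using choice_cell[OF _ _ _ c2] choice_cell[OF _ _ _ c4] M cf by simp_all
  note M = M cf(1-6,8-13) cf2(1-6,8-13)
  let ?\<xi> = "Pcell [g, v1] [w, g1] \<xi>" and ?\<delta> = "Pcell [f, u1] [v, f1] \<delta>"
      and ?\<sigma> = "Pcell [g \<odot> f1, u2] [w, lf] \<sigma>"
    and ?\<eta> = "Pcell [f, u3] [v \<odot> v1, f2] \<eta>"
  obtain a4 a5 ga where r: "a4 \<in> W" "a5 \<in> Mor C" "tgt C a4 = src C (last [u1, u2])"
      "tgt C a5 = src C (last [u3])"
    "src C a5 = src C a4" "piso ga" "psrc ga = [u1, u2] @ [a4]" "ptgt ga = [u3] @ [a5]"
    by (rule BF3l[of "[u3]" "[u1, u2]"]) (use M that in auto)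
  define \<sigma>p \<eta>p where "\<sigma>p = ?\<sigma> \<cdot> piv (pcol [g, f1] \<lhd> [u2])" and "\<eta>p = pcol [v, v1] \<lhd> [f2] \<cdot> ?\<eta>"
  have sp: "piso \<sigma>p" "psrc \<sigma>p = [g, f1, u2]" "ptgt \<sigma>p = [w, lf]" "piso \<eta>p" "psrc \<eta>p = [f, u3]"
      "ptgt \<eta>p = [v, v1, f2]"
    using cf cf2 M by (simp_all add: \<sigma>p_def \<eta>p_def)
  have gt: "psrc ga = [u1, u2, a4]" "ptgt ga = [u3, a5]" using r by simp_all
  note M = M r(1-5)
  define \<theta> where "\<theta> = \<eta>p \<lhd> [a5] \<cdot> [f] \<rhd> ga \<cdot> piv ?\<delta> \<lhd> [u2, a4]"
  have \<theta>: "piso \<theta>" "psrc \<theta> = [v] @ [f1, u2] @ [a4]" "ptgt \<theta> = [v] @ [v1, f2] @ [a5]"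
    using cf cf2 sp gt r(6) M by (simp_all add: \<theta>_def)
  obtain d om where d: "d \<in> W" "tgt C d = src C a4" "pwf om" "psrc om = [f1, u2] @ [a4 \<odot> d]"
      "ptgt om = [v1, f2] @ [a5 \<odot> d]"
    "[v] \<rhd> om = shrink [d] \<theta>" "piso \<theta> \<Longrightarrow> piso om"
    by (rule BF4_shrink[OF _ piso_pwf[OF \<theta>(1)] \<theta>(2,3)]) (use M that in auto)
  note M = M d(1,2)
  let ?a4 = "a4 \<odot> d" and ?a5 = "a5 \<odot> d"
  define ga' where "ga' = shrink [d] ga"
  have ga': "piso ga'" "psrc ga' = [u1, u2, ?a4]" "ptgt ga' = [u3, ?a5]" "piso om"
      "psrc om = [f1, u2, ?a4]" "ptgt om = [v1, f2, ?a5]"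
    using shrink_simps[of ga "[d]"] gt r(6) M d \<theta> by (simp_all add: ga'_def)
  have L1: "[v] \<rhd> om = \<eta>p \<lhd> [?a5] \<cdot> [f] \<rhd> ga' \<cdot> piv ?\<delta> \<lhd> [u2, ?a4]"
    unfolding d(6) \<theta>_def ga'_def using cf cf2 sp gt r(6) M by
        (simp add: shrink_pvcomp shrink_plwhisk shrink_prwhisk1 shrink_prwhisk2)
  \<comment> \<open>The value prescribed for the second lift, formed from the first lift
    \<open>om\<close>.\<close>
  define \<kappa> where "\<kappa> = ?\<xi> \<lhd> [f2, ?a5] \<cdot> [g] \<rhd> om \<cdot> piv \<sigma>p \<lhd> [?a4]"
  have \<kappa>: "piso \<kappa>" "psrc \<kappa> = [w] @ [lf] @ [?a4]" "ptgt \<kappa> = [w] @ [g1, f2] @ [?a5]"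
    using cf cf2 sp ga' M by (simp_all add: \<kappa>_def)
  obtain c ro where c: "c \<in> W" "tgt C c = src C ?a4" "pwf ro" "psrc ro = [lf] @ [?a4 \<odot> c]"
      "ptgt ro = [g1, f2] @ [?a5 \<odot> c]"
    "[w] \<rhd> ro = shrink [c] \<kappa>" "piso \<kappa> \<Longrightarrow> piso ro"
    by (rule BF4_shrink[OF _ piso_pwf[OF \<kappa>(1)] \<kappa>(2,3)]) (use M that in auto)
  note M = M c(1,2)
  let ?b4 = "?a4 \<odot> c" and ?b5 = "?a5 \<odot> c"
  \<comment> \<open>The refinement \<open>c\<close> of the second lift is imposed on the earlier
    cells too; \<open>shrink\<close> preserves the equation they satisfy.\<close>
  define Ga Om where "Ga = shrink [c] ga'" and "Om = shrink [c] om"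
  have e: "piso Ga" "psrc Ga = [u1, u2, ?b4]" "ptgt Ga = [u3, ?b5]" "piso Om" "psrc Om = [f1, u2, ?b4]"
      "ptgt Om = [v1, f2, ?b5]"
    "piso ro" "psrc ro = [lf, ?b4]" "ptgt ro = [g1, f2, ?b5]"
    using shrink_simps[of ga' "[c]"] shrink_simps[of om "[c]"] ga' M c \<kappa> by (simp_all add: Ga_def Om_def)
  have L2: "[v] \<rhd> Om = \<eta>p \<lhd> [?b5] \<cdot> [f] \<rhd> Ga \<cdot> piv ?\<delta> \<lhd> [u2, ?b4]"
  proof -
    have "[v] \<rhd> Om = shrink [c] ([v] \<rhd> om)" using ga' M by (simp add: Om_def shrink_plwhisk)
    also have "\<dots> = \<eta>p \<lhd> [?b5] \<cdot> [f] \<rhd> Ga \<cdot> piv ?\<delta> \<lhd> [u2, ?b4]"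
      unfolding L1 Ga_def using cf cf2 sp ga' M by (simp add: shrink_pvcomp shrink_plwhisk shrink_prwhisk1
          shrink_prwhisk2)
    finally show ?thesis .
  qed
  have L3: "[w] \<rhd> ro = ?\<xi> \<lhd> [f2, ?b5] \<cdot> [g] \<rhd> Om \<cdot> piv \<sigma>p \<lhd> [?b4]"
    unfolding c(6) \<kappa>_def Om_def using cf cf2 sp ga' M by
        (simp add: shrink_pvcomp shrink_plwhisk shrink_prwhisk1 shrink_prwhisk2)
  define \<sigma>' \<eta>' where "\<sigma>' = \<sigma> \<bullet> inv2 (unbr [g, f1] [u2])" and "\<eta>' = unbr [v, v1] [f2] \<bullet> \<eta>"
  have pv: "\<sigma>' = pval \<sigma>p" "\<eta>' = pval \<eta>p"
  proof -
    have "\<sigma> = pval ?\<sigma>" "\<eta> = pval ?\<eta>" by simp_all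
    then show "\<sigma>' = pval \<sigma>p" "\<eta>' = pval \<eta>p"
      unfolding \<sigma>'_def \<eta>'_def \<sigma>p_def \<eta>p_def using cf cf2 M by
          (simp_all add: unbr_pval pval_piv del: unbr.simps)
  qed
  have Pp: "Pcell [w, lf] [g, f1, u2] (inv2 \<sigma>') = piv \<sigma>p" "Pcell [f, u3] [v, v1, f2] \<eta>' = \<eta>p"
    "Pcell [u1, u2, ?b4] [u3, ?b5] (pval Ga) = Ga" "Pcell [f1, u2, ?b4] [v1, f2, ?b5] (pval Om) = Om"
    "Pcell [lf, ?b4] [g1, f2, ?b5] (pval ro) = ro"
    using sp pv e by (auto intro!: pcell_eqI simp: pval_piv)
  have raw1: "whisk [v] [f1, u2, ?b4] [v1, f2, ?b5] [] (pval Om) = whisk [] [f, u3] [v, v1, f2] [?b5] \<eta>' \<bullet>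
      whisk [f] [u1, u2, ?b4] [u3, ?b5] [] (pval Ga) \<bullet> whisk [] [v, f1] [f, u1] [u2, ?b4] (inv2 \<delta>)"
    using arg_cong[OF L2, of pval] cf cf2 sp e M
    by (simp add: whisk_pval Pp piv_Pcell pval_pvcomp del: psrc_pvcomp(3))
  have raw2: "whisk [w] [lf, ?b4] [g1, f2, ?b5] [] (pval ro) = whisk [] [g, v1] [w, g1] [f2, ?b5] \<xi> \<bullet>
      whisk [g] [f1, u2, ?b4] [v1, f2, ?b5] [] (pval Om) \<bullet> whisk [] [w, lf] [g, f1, u2] [?b4] (inv2 \<sigma>')"
    using arg_cong[OF L3, of pval] cf cf2 sp e M
    by (simp add: whisk_pval Pp piv_Pcell pval_pvcomp del: psrc_pvcomp(3))
  have h: "hom (src C c) A2 ?b4" "hom (src C c) A3 ?b5" "path [u, u1, u2, ?b4] \<in> W"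
    using M by (auto simp: hom_def W_comp)
  have i: "iso [u1, u2, ?b4] [u3, ?b5] (pval Ga)" "iso [f1, u2, ?b4] [v1, f2, ?b5] (pval Om)"
      "iso [lf, ?b4] [g1, f2, ?b5] (pval ro)"
    using e by (simp_all add: iso_pval)
  show ?thesis unfolding KK
    using fassoc_rel.intros[OF K G H c1 c2 c3 c4 \<sigma>'_def \<eta>'_def h(1,3,2) i raw1 raw2 refl refl] by blast
qed

lemma is_fmor_fcomp:
  assumes "is_fmor A B K" "is_fmor B E G"
  shows "is_fmor A E (fcomp G K)"
proof -
  obtain X w f Y v g where K: "K = (X, w, f)" "G = (Y, v, g)" by (cases K; cases G) auto
  obtain D v' f' \<rho> where c: "choice f v = (D, v', f', \<rho>)" by (cases "choice f v") auto
  have "f \<in> Mor C" "v \<in> W" "tgt C f = tgt C v" using assms by (auto simp: K hom_def)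
  from choice_cell[OF this c] show ?thesis
    using assms by (auto simp: K c hom_def W_comp)
qed

lemma is_fmor_prime: "is_fmor A B (X, w, f) \<Longrightarrow> is_fmor A B (prime (X, w, f))"
  using comp[of X X "id1 C X" B f] comp[of X X "id1 C X" A w] id1[of X] BF2[of X X "id1 C X" A w] BF1[of X]
  by (auto simp: hom_def)

end

section \<open>Canonical 2-morphisms\<close>

text \<open>Given spans \<open>(U i, F i)\<close>, a presentation of a morphism of fractions \<open>(X, w, k)\<close> over the
  interval \<open>l..r\<close> consists of legs \<open>X \<rightarrow> src (U i)\<close>, invertible junctions \<open>F i \<circ> leg i \<Rightarrow> U (i+1) \<circ> leg (i+1)\<close>
  and identifications of \<open>w\<close> and \<open>k\<close> with \<open>U l \<circ> leg l\<close> and \<open>F r \<circ> leg r\<close>. Legs may be empty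
  paths, which stand for identities.\<close>

record ('m, 'c) presentation =
  leg :: "nat \<Rightarrow> 'm list"
  jct :: "nat \<Rightarrow> ('m, 'c) pcell"
  ent :: "('m, 'c) pcell"
  ext :: "('m, 'c) pcell"

text \<open>Indexing the spans by numbers turns composition of fractions into joining of the
  intervals \<open>l..m\<close> and \<open>Suc m..r\<close>. Both bracketings of a threefold
  composite then have presentations over the same interval and can be compared directly.\<close>

locale fraction_chain = bicategory_of_fractions C W choice
  for C :: "('o, 'm, 'c) bicat" (structure) and W :: "'m set" and choice :: "'m \<Rightarrow> 'm \<Rightarrow> 'o \<times> 'm \<times> 'm \<times> 'c" +
  fixes U F :: "nat \<Rightarrow> 'm"
  assumes U_W: "U i \<in> W" and F_Mor [simp]: "F i \<in> Mor C" and src_F [simp]: "src C (F i) = src C (U i)"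
begin

section \<open>Presentations and comparisons between them\<close>

lemma U_Mor [simp]: "U i \<in> Mor C"
  using U_W by simp

text \<open>The letter \<open>U i\<close> is put in front so that an empty leg is covered; the
  condition then says that \<open>X\<close> is the source of \<open>U i\<close>.\<close>

definition leg_ok :: "'o \<Rightarrow> nat \<Rightarrow> 'm list \<Rightarrow> bool" where
  "leg_ok X i xs \<longleftrightarrow> ok (U i # xs) \<and> src C (last (U i # xs)) = X"

fun presents :: "nat \<Rightarrow> nat \<Rightarrow> ('o, 'm) fmor \<Rightarrow> ('m, 'c) presentation \<Rightarrow> bool" where
  "presents l r (X, w, k) P \<longleftrightarrow> l \<le> r \<and> w \<in> W \<and> k \<in> Mor C \<and> src C w = X \<and> src C k = X \<and>
    (\<forall>i. l \<le> i \<and> i \<le> r \<longrightarrow> leg_ok X i (leg P i)) \<and>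
    (\<forall>i. l \<le> i \<and> i < r \<longrightarrow> piso (jct P i) \<and> psrc (jct P i) = F i # leg P i \<and>
      ptgt (jct P i) = U (Suc i) # leg P (Suc i)) \<and>
    piso (ent P) \<and> psrc (ent P) = [w] \<and> ptgt (ent P) = U l # leg P l \<and>
    piso (ext P) \<and> psrc (ext P) = [k] \<and> ptgt (ext P) = F r # leg P r"

text \<open>The comparing cells need not be invertible, since the second component of a 2-morphism
  of fractions need not be. Where an inverse is wanted, it is obtained after refinement.\<close>

definition compat :: "nat \<Rightarrow> nat \<Rightarrow> ('m, 'c) presentation \<Rightarrow> ('m, 'c) presentation \<Rightarrow>
    'm list \<Rightarrow> 'm list \<Rightarrow> (nat \<Rightarrow> ('m, 'c) pcell) \<Rightarrow> bool" where
  "compat l r P P' q q' \<xi> \<longleftrightarrow>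
    (\<forall>i. l \<le> i \<and> i \<le> r \<longrightarrow> pwf (\<xi> i) \<and> psrc (\<xi> i) = leg P i @ q \<and> ptgt (\<xi> i) = leg P' i @ q') \<and>
    (\<forall>i. l \<le> i \<and> i < r \<longrightarrow> jct P' i \<lhd> q' \<cdot> [F i] \<rhd> \<xi> i = [U (Suc i)] \<rhd> \<xi> (Suc i) \<cdot> jct P i \<lhd> q)"

text \<open>Between presentations, the comparing family determines both \<open>\<phi>\<close> and
  \<open>\<beta>\<close>, because the cells at entrance and exit are invertible.\<close>

definition Cmp :: "nat \<Rightarrow> nat \<Rightarrow> ('m, 'c) presentation \<Rightarrow> ('m, 'c) presentation \<Rightarrow>
    'm list \<Rightarrow> 'm list \<Rightarrow> ('m, 'c) pcell \<Rightarrow> ('m, 'c) pcell \<Rightarrow> bool" where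
  "Cmp l r P P' q q' \<phi> \<beta> \<longleftrightarrow> (\<exists>\<xi>. compat l r P P' q q' \<xi> \<and>
    ent P' \<lhd> q' \<cdot> \<phi> = [U l] \<rhd> \<xi> l \<cdot> ent P \<lhd> q \<and>
    ext P' \<lhd> q' \<cdot> \<beta> = [F r] \<rhd> \<xi> r \<cdot> ext P \<lhd> q)"

lemma leg_okD:
  assumes "leg_ok X i xs" "ok q" "tgt C (hd q) = X"
  shows "ok (xs @ q)" "ok (U i # xs @ q)" "ok (F i # xs @ q)" "xs @ q \<noteq> []"
proof -
  have "q \<noteq> []" using assms by auto
  then show "ok (xs @ q)" "ok (U i # xs @ q)" "ok (F i # xs @ q)" "xs @ q \<noteq> []"
    using assms ok_append[of "U i # xs" q] by (auto simp: leg_ok_def ok_Cons)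
qed

lemma leg_ok_append:
  assumes "leg_ok X i xs" "ok q" "tgt C (hd q) = X"
  shows "leg_ok (src C (last q)) i (xs @ q)"
proof -
  have "q \<noteq> []" using assms by auto
  then show ?thesis using leg_okD[OF assms] by (auto simp: leg_ok_def)
qed

lemma Cmp_simps:
  assumes "presents l r (X, w, k) P" "presents l r (X', w', k') P'" "Cmp l r P P' q q' \<phi> \<beta>"
    "ok q" "ok q'" "tgt C (hd q) = X" "tgt C (hd q') = X'"
  shows "pwf \<phi>" "pwf \<beta>" "psrc \<phi> = w # q" "ptgt \<phi> = w' # q'" "psrc \<beta> = k # q" "ptgt \<beta> = k' # q'"
proof -
  obtain \<xi> where x: "\<And>i. l \<le> i \<Longrightarrow> i \<le> r \<Longrightarrow> pwf (\<xi> i) \<and> psrc (\<xi> i) = leg P i @ q \<and> ptgt (\<xi> i) = leg P' i @ q'"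
    "ent P' \<lhd> q' \<cdot> \<phi> = [U l] \<rhd> \<xi> l \<cdot> ent P \<lhd> q" "ext P' \<lhd> q' \<cdot> \<beta> = [F r] \<rhd> \<xi> r \<cdot> ext P \<lhd> q"
    using assms(3) by (auto simp: Cmp_def compat_def)
  have qn: "q \<noteq> []" "q' \<noteq> []" using assms by auto
  have lr: "l \<le> r" using assms by simp
  have lo: "leg_ok X l (leg P l)" "leg_ok X r (leg P r)" "leg_ok X' l (leg P' l)" "leg_ok X' r (leg P' r)"
    using assms by auto
  note o = leg_okD[OF lo(1) assms(4,6)] leg_okD[OF lo(2) assms(4,6)] leg_okD[OF lo(3) assms(5,7)]
      leg_okD[OF lo(4) assms(5,7)]
  have oo: "ok (w # q)" "ok (k # q)" "ok (w' # q')" "ok (k' # q')" using assms by (auto simp: ok_Cons)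
  have E: "pwf ([U l] \<rhd> \<xi> l \<cdot> ent P \<lhd> q)" "pwf ([F r] \<rhd> \<xi> r \<cdot> ext P \<lhd> q)"
    using x(1)[of l] x(1)[of r] assms(1) lr o oo by auto
  have E1: "pwf (ent P' \<lhd> q' \<cdot> \<phi>)" "pwf (ext P' \<lhd> q' \<cdot> \<beta>)" using E x by simp_all
  then show t: "pwf \<phi>" "pwf \<beta>" by auto
  have p: "piso (ent P')" "psrc (ent P') = [w']" "piso (ext P')" "psrc (ext P') = [k']"
    "piso (ent P)" "psrc (ent P) = [w]" "piso (ext P)" "psrc (ext P) = [k]" using assms by auto
  show "ptgt \<phi> = w' # q'" "ptgt \<beta> = k' # q'" using E1 p oo by auto
  have "psrc (ent P' \<lhd> q' \<cdot> \<phi>) = w # q" "psrc (ext P' \<lhd> q' \<cdot> \<beta>) = k # q"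
    unfolding x(2,3) using E p oo by auto
  then show "psrc \<phi> = w # q" "psrc \<beta> = k # q" using E1 by auto
qed

lemma Cmp_pull:
  assumes "Cmp l r P P' q q' \<phi> \<beta>" "presents l r (X, w, k) P" "ok q" "tgt C (hd q) = X" "ok (q @ t)"
  shows "Cmp l r P P' (q @ t) (q' @ t) (\<phi> \<lhd> t) (\<beta> \<lhd> t)"
proof -
  obtain \<xi> where x: "compat l r P P' q q' \<xi>"
    "ent P' \<lhd> q' \<cdot> \<phi> = [U l] \<rhd> \<xi> l \<cdot> ent P \<lhd> q" "ext P' \<lhd> q' \<cdot> \<beta> = [F r] \<rhd> \<xi> r \<cdot> ext P \<lhd> q"
    using assms(1) by (auto simp: Cmp_def)
  have q: "q \<noteq> []" using assms by auto
  have "ok (leg P i @ q @ t)" if "l \<le> i" "i \<le> r" for i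
    using leg_okD(1)[of X i "leg P i" "q @ t"] that assms q by auto
  moreover have "jct P' i \<lhd> (q' @ t) \<cdot> [F i] \<rhd> \<xi> i \<lhd> t = [U (Suc i)] \<rhd> \<xi> (Suc i) \<lhd> t \<cdot> jct P i \<lhd> (q @ t)"
    if "l \<le> i" "i < r" for i
  proof -
    have "jct P' i \<lhd> q' \<cdot> [F i] \<rhd> \<xi> i = [U (Suc i)] \<rhd> \<xi> (Suc i) \<cdot> jct P i \<lhd> q"
      using that x(1) by (simp add: compat_def)
    from arg_cong[OF this, of "\<lambda>c. c \<lhd> t"] show ?thesis by simp
  qed
  ultimately have "compat l r P P' (q @ t) (q' @ t) (\<lambda>i. \<xi> i \<lhd> t)"
    using x(1) by (simp add: compat_def)
  then show ?thesis
    using arg_cong[OF x(2), of "\<lambda>c. c \<lhd> t"] arg_cong[OF x(3), of "\<lambda>c. c \<lhd> t"]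
    unfolding Cmp_def by (intro exI[of _ "\<lambda>i. \<xi> i \<lhd> t"]) simp
qed

lemma Cmp_vcomp:
  assumes "Cmp l r P P' q q' \<phi> \<beta>" "Cmp l r P' P'' q' q'' \<phi>' \<beta>'" "l \<le> r"
  shows "Cmp l r P P'' q q'' (\<phi>' \<cdot> \<phi>) (\<beta>' \<cdot> \<beta>)"
proof -
  obtain \<xi> where x: "compat l r P P' q q' \<xi>"
    "ent P' \<lhd> q' \<cdot> \<phi> = [U l] \<rhd> \<xi> l \<cdot> ent P \<lhd> q" "ext P' \<lhd> q' \<cdot> \<beta> = [F r] \<rhd> \<xi> r \<cdot> ext P \<lhd> q"
    using assms(1) by (auto simp: Cmp_def)
  obtain \<xi>' where x': "compat l r P' P'' q' q'' \<xi>'"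
    "ent P'' \<lhd> q'' \<cdot> \<phi>' = [U l] \<rhd> \<xi>' l \<cdot> ent P' \<lhd> q'" "ext P'' \<lhd> q'' \<cdot> \<beta>' = [F r] \<rhd> \<xi>' r \<cdot> ext P' \<lhd> q'"
    using assms(2) by (auto simp: Cmp_def)
  have "jct P'' i \<lhd> q'' \<cdot> [F i] \<rhd> \<xi>' i \<cdot> [F i] \<rhd> \<xi> i =
      [U (Suc i)] \<rhd> \<xi>' (Suc i) \<cdot> [U (Suc i)] \<rhd> \<xi> (Suc i) \<cdot> jct P i \<lhd> q" if "l \<le> i" "i < r" for i
    by (rule paste_squares[of "jct P' i \<lhd> q'"]) (use that x(1) x'(1) in \<open>simp_all add: compat_def\<close>)
  then have "compat l r P P'' q q'' (\<lambda>i. \<xi>' i \<cdot> \<xi> i)"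
    using x(1) x'(1) by (simp add: compat_def)
  then show ?thesis unfolding Cmp_def
    using paste_squares[OF x(2) x'(2)] paste_squares[OF x(3) x'(3)]
    by (intro exI[of _ "\<lambda>i. \<xi>' i \<cdot> \<xi> i"]) simp
qed

text \<open>A change of test path induces the comparison that whiskers it with every leg;
  compatibility with junctions, entrance and exit is interchange.\<close>

lemma Cmp_whisk:
  assumes "presents l r (X, w, k) P" "pwf \<kappa>" "psrc \<kappa> = q" "ptgt \<kappa> = q'" "tgt C (hd q) = X"
  shows "Cmp l r P P q q' ([w] \<rhd> \<kappa>) ([k] \<rhd> \<kappa>)"
proof -
  have "ok q" using assms pwf_ok by blast
  then have o: "ok (leg P i @ q)" if "l \<le> i" "i \<le> r" for i
    using leg_okD(1)[of X i "leg P i" q] that assms by auto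
  have "jct P i \<lhd> q' \<cdot> (F i # leg P i) \<rhd> \<kappa> = (U (Suc i) # leg P (Suc i)) \<rhd> \<kappa> \<cdot> jct P i \<lhd> q" if "l \<le> i"
      "i < r" for i
    using pinterchange[of "jct P i" \<kappa>] that assms by simp
  then have "compat l r P P q q' (\<lambda>i. leg P i \<rhd> \<kappa>)"
    using assms o by (auto simp: compat_def)
  then show ?thesis unfolding Cmp_def
    using assms pinterchange[of "ent P" \<kappa>] pinterchange[of "ext P" \<kappa>]
    by (intro exI[of _ "\<lambda>i. leg P i \<rhd> \<kappa>"]) auto
qed

lemma Cmp_conj:
  assumes "presents l r (X, w, k) P" "presents l r (X', w', k') P'" "Cmp l r P P' q q' \<phi> \<beta>"
    "pwf \<kappa>" "psrc \<kappa> = p" "ptgt \<kappa> = q" "pwf \<kappa>'" "psrc \<kappa>' = q'" "ptgt \<kappa>' = p'"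
    "tgt C (hd p) = X" "tgt C (hd q') = X'"
  shows "Cmp l r P P' p p' ([w'] \<rhd> \<kappa>' \<cdot> \<phi> \<cdot> [w] \<rhd> \<kappa>) ([k'] \<rhd> \<kappa>' \<cdot> \<beta> \<cdot> [k] \<rhd> \<kappa>)"
proof -
  have "l \<le> r" using assms by simp
  show ?thesis
    by (intro Cmp_vcomp[OF Cmp_vcomp[OF Cmp_whisk[OF assms(1,4-6,10)] assms(3)]
          Cmp_whisk[OF assms(2,7-9,11)], unfolded pvcomp_assoc] \<open>l \<le> r\<close>)
qed

text \<open>A comparison known after the refinement \<open>y\<close> is transferred to an arbitrary
  refinement \<open>t\<close>. By \<open>Wl_right_cancel\<close> the path \<open>y\<close> extends
  to one in \<open>W\<close>, so (BF3) makes an extension of \<open>t\<close> isomorphic to an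
  extension of \<open>y\<close>, and conjugation by this isomorphism moves the comparison.\<close>

lemma Cmp_local:
  assumes P: "presents l r (X, w, k) P" "presents l r (X', w', k') P'"
    and q: "ok q" "tgt C (hd q) = X" "tgt C (hd q') = X'" "ok q'"
    and W: "Wl (w # q @ y)" "q @ y \<noteq> []"
    and t: "psrc \<phi> = w # q" "ptgt \<phi> = w' # q'" "psrc \<beta> = k # q" "ptgt \<beta> = k' # q'" "pwf \<phi>" "pwf \<beta>"
        "ok (q @ t)" "t \<noteq> []"
    and Wq: "Wl (w # q)"
    and cmp: "Cmp l r P P' (q @ y) (q' @ y) (\<phi> \<lhd> y) (\<beta> \<lhd> y)"
  obtains s where "Wl s" "ok (q @ t @ s)" "Cmp l r P P' (q @ t @ s) (q' @ t @ s) (\<phi> \<lhd> (t @ s)) (\<beta> \<lhd> (t @ s))"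
proof -
  have qn: "q \<noteq> []" "q' \<noteq> []" using q by auto
  obtain k0 where k0: "k0 \<noteq> []" "ok (w # q @ y @ k0)" "Wl (y @ k0)"
    using Wl_right_cancel[OF Wq, of y] W by auto
  have hy: "ok (y @ k0)" "src C (last q) = tgt C (hd (y @ k0))" "src C (last q) = tgt C (hd t)" "ok t"
    using k0 t ok_append[of "w # q" "y @ k0"] ok_append[of q t] qn by auto
  obtain s k1 \<rho> where r: "s \<in> W" "k1 \<in> Mor C" "tgt C s = src C (last t)" "tgt C k1 = src C (last (y @ k0))"
    "src C k1 = src C s" "piso \<rho>" "psrc \<rho> = t @ [s]" "ptgt \<rho> = (y @ k0) @ [k1]"
    using BF3l[OF k0(3), of t] hy by auto
  let ?m = "y @ k0 @ [k1]"
  have ok\<rho>: "ok (t @ [s])" "ok ?m" using pwf_ok[OF piso_pwf[OF r(6)]] r by auto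
  have hd: "hd (y @ k0 @ [k1]) = hd (y @ k0)" using k0(1) by (cases y) auto
  have last: "src C (last q') = src C (last q)" using pwf_parallel[OF t(5,1,2)] qn by simp
  have ok1: "ok (q @ t @ [s])" "ok (q @ ?m)" "ok (q' @ t @ [s])" "ok (q' @ ?m)"
    using ok\<rho> hy t q qn last hd by (auto simp: ok_append simp del: append_assoc)
  have ok2: "ok (w # q @ t @ [s])" "ok (w' # q' @ ?m)" "ok (k # q @ t @ [s])" "ok (k' # q' @ ?m)"
    using ok1 qn P q by (auto simp: ok_Cons)
  have oky: "ok (q @ y)" using ok1 qn ok_appendD1[of "q @ y" "k0 @ [k1]"] by simp
  have c1: "Cmp l r P P' (q @ ?m) (q' @ ?m) (\<phi> \<lhd> ?m) (\<beta> \<lhd> ?m)"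
    using Cmp_pull[OF cmp P(1) oky, of "k0 @ [k1]"] q qn ok1 by simp
  \<comment> \<open>By interchange the two copies of \<open>\<rho>\<close> pass through
    \<open>c\<close> and cancel, leaving \<open>c\<close> restricted along
    \<open>t @ [s]\<close>.\<close>
  have mv: "[x'] \<rhd> (q' \<rhd> piv \<rho>) \<cdot> c \<lhd> ?m \<cdot> [x] \<rhd> (q \<rhd> \<rho>) = c \<lhd> (t @ [s])"
    if "pwf c" "psrc c = x # q" "ptgt c = x' # q'" for c x x'
  proof -
    have o: "ok (x' # q' @ ?m)" "ok (x # q @ t @ [s])" using pwf_ok[OF that(1)] that(2,3) ok1 qn by (auto
        simp: ok_Cons)
    have o': "ok (x' # q' @ t @ [s])" using pwf_ok[OF that(1)] that(2,3) ok1 qn by (auto simp: ok_Cons)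
    have "c \<lhd> ?m \<cdot> (x # q) \<rhd> \<rho> = (x' # q') \<rhd> \<rho> \<cdot> c \<lhd> (t @ [s])" using pinterchange[of c \<rho>] that r by simp
    then have "(x' # q') \<rhd> piv \<rho> \<cdot> c \<lhd> ?m \<cdot> (x # q) \<rhd> \<rho> = piv ((x' # q') \<rhd> \<rho>) \<cdot> (x' # q') \<rhd> \<rho> \<cdot> c \<lhd> (t @ [s])"
      using piv_whisk(1)[of \<rho> "x' # q'"] r o o' by simp
    also have "\<dots> = c \<lhd> (t @ [s])"
      using that r o o' by (intro piv_cancel) auto
    finally show ?thesis by simp
  qed
  have "Cmp l r P P' (q @ t @ [s]) (q' @ t @ [s])
    ([w'] \<rhd> (q' \<rhd> piv \<rho>) \<cdot> \<phi> \<lhd> ?m \<cdot> [w] \<rhd> (q \<rhd> \<rho>)) ([k'] \<rhd> (q' \<rhd> piv \<rho>) \<cdot> \<beta> \<lhd> ?m \<cdot> [k] \<rhd> (q \<rhd> \<rho>))"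
    by (rule Cmp_conj[OF P c1]) (use r q qn ok1 in auto)
  then have "Cmp l r P P' (q @ t @ [s]) (q' @ t @ [s]) (\<phi> \<lhd> (t @ [s])) (\<beta> \<lhd> (t @ [s]))"
    using mv[of \<phi> w w'] mv[of \<beta> k k'] t by simp
  then show ?thesis using that[of "[s]"] r ok1 by simp
qed

text \<open>The comparing cells are identified one index at a time: the entrance, and later the
  junction, shows equality after whiskering with \<open>U i\<close>, and faithfulness removes
  \<open>U i\<close> at the price of a further refinement. The refinements accumulate into
  \<open>s\<close>.\<close>

lemma Cmp_unique:
  assumes P: "presents l r (X, w, k) P" "presents l r (X', w', k') P'"
    and q: "ok q" "tgt C (hd q) = X" "tgt C (hd q') = X'" "ok q'"
    and c: "Cmp l r P P' q q' \<phi> \<beta>" "Cmp l r P P' q q' \<phi> \<beta>'"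
  obtains s where "Wl s" "ok (q @ s)" "\<beta> \<lhd> s = \<beta>' \<lhd> s"
proof -
  obtain \<xi> where x: "compat l r P P' q q' \<xi>"
    "ent P' \<lhd> q' \<cdot> \<phi> = [U l] \<rhd> \<xi> l \<cdot> ent P \<lhd> q" "ext P' \<lhd> q' \<cdot> \<beta> = [F r] \<rhd> \<xi> r \<cdot> ext P \<lhd> q"
    using c(1) by (auto simp: Cmp_def)
  obtain \<xi>' where x': "compat l r P P' q q' \<xi>'"
    "ent P' \<lhd> q' \<cdot> \<phi> = [U l] \<rhd> \<xi>' l \<cdot> ent P \<lhd> q" "ext P' \<lhd> q' \<cdot> \<beta>' = [F r] \<rhd> \<xi>' r \<cdot> ext P \<lhd> q"
    using c(2) by (auto simp: Cmp_def)
  have qn: "q \<noteq> []" "q' \<noteq> []" using q by auto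
  have lr: "l \<le> r" using P by simp
  have t: "pwf (\<xi> i)" "psrc (\<xi> i) = leg P i @ q" "ptgt (\<xi> i) = leg P' i @ q'"
    "pwf (\<xi>' i)" "psrc (\<xi>' i) = leg P i @ q" "ptgt (\<xi>' i) = leg P' i @ q'"
    "ok (leg P i @ q)" "ok (U i # leg P i @ q)" "ok (F i # leg P i @ q)"
    "ok (leg P' i @ q')" "ok (U i # leg P' i @ q')" "ok (F i # leg P' i @ q')"
    if "l \<le> i" "i \<le> r" for i
    using that x(1) x'(1) leg_okD[of X i "leg P i" q] leg_okD[of X' i "leg P' i" q'] P q by (auto
        simp: compat_def)
  have "\<exists>s. Wl s \<and> ok (q @ s) \<and> \<xi> i \<lhd> s = \<xi>' i \<lhd> s" if "l \<le> i" "i \<le> r" for i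
    using that
  proof (induction i rule: dec_induct)
    case base
    have o: "ok (w # q)" using P q by (auto simp: ok_Cons)
    have "[U l] \<rhd> \<xi> l = [U l] \<rhd> \<xi>' l"
    proof (rule piso_epi[of "ent P \<lhd> q"])
      show "[U l] \<rhd> \<xi> l \<cdot> ent P \<lhd> q = [U l] \<rhd> \<xi>' l \<cdot> ent P \<lhd> q" using x x' by simp
    qed (use t[of l] lr P o in auto)
    then obtain s where s: "Wl s" "ok (leg P l @ q @ s)" "\<xi> l \<lhd> s = \<xi>' l \<lhd> s"
      using W_faithful[of "[U l]" "\<xi> l" "\<xi>' l"] t[of l] lr U_W by auto
    then have "ok (q @ s)" using ok_appendD2[of "leg P l" "q @ s"] qn by simp
    with s show ?case by blast
  next
    case (step i)
    then obtain s where s: "Wl s" "ok (q @ s)" "\<xi> i \<lhd> s = \<xi>' i \<lhd> s" by auto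
    have i: "l \<le> i" "i \<le> r" "l \<le> Suc i" "Suc i \<le> r" "i < r" using step by auto
    have qs: "ok (q @ s)" "q @ s \<noteq> []" "tgt C (hd (q @ s)) = X" using s q qn by auto
    have lo: "leg_ok X i (leg P i)" "leg_ok X (Suc i) (leg P (Suc i))" using P i by auto
    note o = leg_okD[OF lo(1) qs(1,3)] leg_okD[OF lo(2) qs(1,3)]
    have j: "piso (jct P i)" "psrc (jct P i) = F i # leg P i" "ptgt (jct P i) = U (Suc i) # leg P (Suc i)"
      using P i by auto
    have e: "jct P' i \<lhd> q' \<cdot> [F i] \<rhd> \<xi> i = [U (Suc i)] \<rhd> \<xi> (Suc i) \<cdot> jct P i \<lhd> q"
      "jct P' i \<lhd> q' \<cdot> [F i] \<rhd> \<xi>' i = [U (Suc i)] \<rhd> \<xi>' (Suc i) \<cdot> jct P i \<lhd> q"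
      using x(1) x'(1) i by (auto simp: compat_def)
    have "[U (Suc i)] \<rhd> (\<xi> (Suc i) \<lhd> s) \<cdot> jct P i \<lhd> (q @ s) = [U (Suc i)] \<rhd> (\<xi>' (Suc i) \<lhd> s) \<cdot>
        jct P i \<lhd> (q @ s)"
      using arg_cong[OF e(1), of "\<lambda>c. c \<lhd> s"] arg_cong[OF e(2), of "\<lambda>c. c \<lhd> s"] s(3) by simp
    then have "[U (Suc i)] \<rhd> (\<xi> (Suc i) \<lhd> s) = [U (Suc i)] \<rhd> (\<xi>' (Suc i) \<lhd> s)"
      by - (rule piso_epi[of "jct P i \<lhd> (q @ s)"], use t[OF i(3,4)] j o in auto)
    then obtain s' where s': "Wl s'" "ok ((leg P (Suc i) @ q @ s) @ s')"
        "\<xi> (Suc i) \<lhd> s \<lhd> s' = \<xi>' (Suc i) \<lhd> s \<lhd> s'"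
      using W_faithful[of "[U (Suc i)]" "\<xi> (Suc i) \<lhd> s" "\<xi>' (Suc i) \<lhd> s"] t[OF i(3,4)] o U_W by auto
    have "ok (q @ s @ s')" using ok_appendD2[of "leg P (Suc i)" "q @ s @ s'"] qn s'(2) by simp
    moreover have "Wl (s @ s')" using Wl_append[OF s(1) s'(1)] ok_appendD2[of q
        "s @ s'"] calculation Wl_nonempty[OF s(1)] by simp
    ultimately show ?case using s'(3) by auto
  qed
  from this[of r] lr obtain s where s: "Wl s" "ok (q @ s)" "\<xi> r \<lhd> s = \<xi>' r \<lhd> s" by auto
  have \<beta>: "pwf \<beta>" "psrc \<beta> = k # q" "ptgt \<beta> = k' # q'" "pwf \<beta>'" "psrc \<beta>' = k # q" "ptgt \<beta>' = k' # q'"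
    using Cmp_simps[OF P c(1) q(1,4,2,3)] Cmp_simps[OF P c(2) q(1,4,2,3)] by auto
  have o: "ok (k # q @ s)" using P q s qn by (auto simp: ok_Cons)
  have o': "ok (k' # q' @ s)" using ok_ptgt_prwhisk[OF \<beta>(1), of s] \<beta> o by simp
  have "ext P' \<lhd> (q' @ s) \<cdot> \<beta> \<lhd> s = ext P' \<lhd> (q' @ s) \<cdot> \<beta>' \<lhd> s"
    using arg_cong[OF x(3), of "\<lambda>c. c \<lhd> s"] arg_cong[OF x'(3), of "\<lambda>c. c \<lhd> s"] s(3) by simp
  then have "\<beta> \<lhd> s = \<beta>' \<lhd> s"
    by - (rule piso_mono[of "ext P' \<lhd> (q' @ s)"], use P \<beta> o o' in auto)
  with s that show ?thesis by blast
qed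

section \<open>Comparison after refinement, for representatives\<close>

fun locCmp :: "nat \<Rightarrow> nat \<Rightarrow> ('m, 'c) presentation \<Rightarrow> ('m, 'c) presentation \<Rightarrow>
    ('o, 'm) fmor \<Rightarrow> ('o, 'm) fmor \<Rightarrow> ('o, 'm, 'c) frep \<Rightarrow> bool" where
  "locCmp l r P P' (X, w, k) (X', w', k') (T, q, q', \<alpha>, \<beta>) \<longleftrightarrow>
    (\<exists>z. Wl (w # q # z) \<and> Cmp l r P P' (q # z) (q' # z)
      (Pcell [w, q] [w', q'] \<alpha> \<lhd> z) (Pcell [k, q] [k', q'] \<beta> \<lhd> z))"

text \<open>In \<open>locCmp\<close> the refinement \<open>z\<close> is required only to bring the
  composite with \<open>w\<close> and \<open>q\<close> into \<open>W\<close>. This lemma shows that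
  nothing depends on it: the comparison is available beyond any prescribed \<open>t\<close>.\<close>

lemma locCmp_refine:
  assumes P: "presents l r (X, w, k) P" "presents l r (X', w', k') P'"
    and f: "is_frep (X, w, k) (X', w', k') (T, q, q', \<alpha>, \<beta>)"
    and c: "locCmp l r P P' (X, w, k) (X', w', k') (T, q, q', \<alpha>, \<beta>)"
    and t: "ok (q # t)" "t \<noteq> []"
  obtains s where "Wl s" "ok (q # t @ s)" "Cmp l r P P' (q # t @ s) (q' # t @ s)
      (Pcell [w, q] [w', q'] \<alpha> \<lhd> (t @ s)) (Pcell [k, q] [k', q'] \<beta> \<lhd> (t @ s))"
proof -
  note a = is_frep_cells[OF f]
  obtain z where z: "Wl (w # q # z)" "Cmp l r P P' (q # z) (q' # z)
      (Pcell [w, q] [w', q'] \<alpha> \<lhd> z) (Pcell [k, q] [k', q'] \<beta> \<lhd> z)"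
    using c by auto
  show ?thesis
    by (rule Cmp_local[OF P, of "[q]" "[q']" z "Pcell [w, q] [w', q'] \<alpha>" "Pcell [k, q] [k', q'] \<beta>" t])
      (use a z t that in auto)
qed

lemma Wl_appendL: "Wl xs \<Longrightarrow> Wl ys \<Longrightarrow> src C (last xs) = tgt C (hd ys) \<Longrightarrow> Wl (xs @ ys)"
  by (rule Wl_append) (auto simp: ok_append_iff Wl_nonempty)

text \<open>The comparison is first refined along the \<open>z\<close> of the equivalence and then
  conjugated by the cells \<open>\<sigma>\<close> and \<open>\<tau>\<close>, which turn the
  components of one representative into those of the other.\<close>

lemma locCmp_frep_equiv:
  assumes P: "presents l r (X, w, k) P" "presents l r (X', w', k') P'"
    and f: "is_frep (X, w, k) (X', w', k') (T, q, q', \<alpha>, \<beta>)"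
      "is_frep (X, w, k) (X', w', k') (S, p, p', \<gamma>, \<delta>)"
    and c: "locCmp l r P P' (X, w, k) (X', w', k') (T, q, q', \<alpha>, \<beta>)"
    and e: "frep_equiv (X, w, k) (X', w', k') (T, q, q', \<alpha>, \<beta>) (S, p, p', \<gamma>, \<delta>)"
  shows "locCmp l r P P' (X, w, k) (X', w', k') (S, p, p', \<gamma>, \<delta>)"
proof -
  note a = is_frep_cells[OF f(1)] and b = is_frep_cells[OF f(2)]
  obtain z z' \<sigma> \<tau> where r: "piso \<sigma>" "psrc \<sigma> = [p, z']" "ptgt \<sigma> = [q, z]"
    "piso \<tau>" "psrc \<tau> = [q', z]" "ptgt \<tau> = [p', z']" "Wl [w, q, z]"
    "[w'] \<rhd> \<tau> \<cdot> Pcell [w, q] [w', q'] \<alpha> \<lhd> [z] \<cdot> [w] \<rhd> \<sigma> = Pcell [w, p] [w', p'] \<gamma> \<lhd> [z']"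
    "[k'] \<rhd> \<tau> \<cdot> Pcell [k, q] [k', q'] \<beta> \<lhd> [z] \<cdot> [k] \<rhd> \<sigma> = Pcell [k, p] [k', p'] \<delta> \<lhd> [z']"
    using e unfolding frep_equiv_iff[OF f] by blast
  have o: "ok [p, z']" "ok [q, z]" "ok [q', z]" "ok [p', z']" "src C z' = src C z"
    using r pwf_ok[of \<sigma>] pwf_ok[of \<tau>] by auto
  obtain s where s: "Wl s" "ok (q # [z] @ s)" "Cmp l r P P' (q # [z] @ s) (q' # [z] @ s)
      (Pcell [w, q] [w', q'] \<alpha> \<lhd> ([z] @ s)) (Pcell [k, q] [k', q'] \<beta> \<lhd> ([z] @ s))"
    using locCmp_refine[OF P f(1) c, of "[z]"] o by auto
  have sn: "s \<noteq> []" "ok s" "src C z = tgt C (hd s)" using s Wl_nonempty[OF s(1)] by (auto simp: ok_Cons)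
  have o2: "ok (p # z' # s)" "ok (q # z # s)" "ok (q' # z # s)" "ok (p' # z' # s)"
    using o sn by (auto simp: ok_Cons)
  have "Cmp l r P P' (p # z' # s) (p' # z' # s)
    ([w'] \<rhd> (\<tau> \<lhd> s) \<cdot> Pcell [w, q] [w', q'] \<alpha> \<lhd> ([z] @ s) \<cdot> [w] \<rhd> (\<sigma> \<lhd> s))
    ([k'] \<rhd> (\<tau> \<lhd> s) \<cdot> Pcell [k, q] [k', q'] \<beta> \<lhd> ([z] @ s) \<cdot> [k] \<rhd> (\<sigma> \<lhd> s))"
    by (rule Cmp_conj[OF P s(3)]) (use r o2 a b in simp_all)
  moreover have "[w'] \<rhd> (\<tau> \<lhd> s) \<cdot> Pcell [w, q] [w', q'] \<alpha> \<lhd> ([z] @ s) \<cdot> [w] \<rhd> (\<sigma> \<lhd> s) =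
      Pcell [w, p] [w', p'] \<gamma> \<lhd> (z' # s)"
    using arg_cong[OF r(8), of "\<lambda>c. c \<lhd> s"] by simp
  moreover have "[k'] \<rhd> (\<tau> \<lhd> s) \<cdot> Pcell [k, q] [k', q'] \<beta> \<lhd> ([z] @ s) \<cdot> [k] \<rhd> (\<sigma> \<lhd> s) =
      Pcell [k, p] [k', p'] \<delta> \<lhd> (z' # s)"
    using arg_cong[OF r(9), of "\<lambda>c. c \<lhd> s"] by simp
  moreover have "Wl (w # p # z' # s)"
  proof -
    have "Wl ([w, q, z] @ s)" using r s sn by (intro Wl_appendL) simp_all
    then show ?thesis using Wl_psrc[of "[w] \<rhd> (\<sigma> \<lhd> s)"] r o2 a b by simp
  qed
  ultimately show ?thesis by auto
qed

text \<open>The equivalence is built so that the equation for the first components holds by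
  construction. The equation for the second components is then forced by \<open>Cmp_unique\<close>,
  after one more refinement.\<close>

lemma locCmp_unique:
  assumes P: "presents l r (X, w, k) P" "presents l r (X', w', k') P'"
    and f: "is_frep (X, w, k) (X', w', k') (T, q, q', \<alpha>, \<beta>)"
      "is_frep (X, w, k) (X', w', k') (S, p, p', \<gamma>, \<delta>)"
    and c: "locCmp l r P P' (X, w, k) (X', w', k') (T, q, q', \<alpha>, \<beta>)"
      "locCmp l r P P' (X, w, k) (X', w', k') (S, p, p', \<gamma>, \<delta>)"
  shows "frep_equiv (X, w, k) (X', w', k') (T, q, q', \<alpha>, \<beta>) (S, p, p', \<gamma>, \<delta>)"
proof -
  note a = is_frep_cells[OF f(1)] and b = is_frep_cells[OF f(2)]
  let ?\<alpha> = "Pcell [w, q] [w', q'] \<alpha>" and ?\<beta> = "Pcell [k, q] [k', q'] \<beta>"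
    and ?\<gamma> = "Pcell [w, p] [w', p'] \<gamma>" and ?\<delta> = "Pcell [k, p] [k', p'] \<delta>"
  obtain z where z: "Wl (w # q # z)" "Cmp l r P P' (q # z) (q' # z) (?\<alpha> \<lhd> z) (?\<beta> \<lhd> z)"
    using c by auto
  obtain z' where z': "Wl (w # p # z')" "Cmp l r P P' (p # z') (p' # z') (?\<gamma> \<lhd> z') (?\<delta> \<lhd> z')"
    using c by auto
  \<comment> \<open>A common refinement of both comparisons; lifting the square through
    \<open>w\<close> turns it into an isomorphism \<open>\<kappa>\<close> between extensions of
    \<open>q\<close> and \<open>p\<close>.\<close>
  obtain s k0 \<rho> where r: "s \<in> W" "k0 \<in> Mor C" "tgt C s = src C (last (w # q # z))"
      "tgt C k0 = src C (last (w # p # z'))"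
    "src C k0 = src C s" "piso \<rho>" "psrc \<rho> = (w # q # z) @ [s]" "ptgt \<rho> = (w # p # z') @ [k0]"
    by (rule BF3l[OF z'(1) Wl_ok[OF z(1)]], simp) (blast intro: that)
  have pre: "Wl [w]" "pwf \<rho>" "psrc \<rho> = [w] @ q # z @ [s]" "ptgt \<rho> = [w] @ p # z' @ [k0]"
    "q # z @ [s] \<noteq> []" "p # z' @ [k0] \<noteq> []" using r a by simp_all
  obtain d \<kappa> where d: "d \<in> W" "tgt C d = src C (last (q # z @ [s]))" "piso \<kappa>" "psrc \<kappa> = (q # z @ [s]) @ [d]"
    "ptgt \<kappa> = (p # z' @ [k0]) @ [d]" "\<rho> \<lhd> [d] = [w] \<rhd> \<kappa>"
    by (rule BF4l[OF pre]) (blast intro: that r(6))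
  define y y' where "y = z @ [s, d]" and "y' = z' @ [k0, d]"
  have yn: "y \<noteq> []" "y' \<noteq> []" by (auto simp: y_def y'_def)
  have \<kappa>: "piso \<kappa>" "psrc \<kappa> = q # y" "ptgt \<kappa> = p # y'" using d by (auto simp: y_def y'_def)
  have o1: "ok (q # y)" "ok (p # y')" using pwf_ok[of \<kappa>] \<kappa> by auto
  have o2: "ok (q' # y)" "ok (p' # y')" using o1 yn a b by (auto simp: ok_Cons)
  have o3: "ok (w # q # y)" "ok (w # p # y')" "ok (w' # q' # y)" "ok (w' # p' # y')" "ok (k # q # y)"
      "ok (k' # p' # y')"
    "ok (k # p # y')" "ok (k' # q' # y)"
    using o1 o2 a b by auto
  have Wy: "Wl (w # q # y)"
  proof -
    have "Wl ((w # q # z) @ [s])" using Wl_appendL[OF z(1), of "[s]"] r by auto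
    from Wl_appendL[OF this, of "[d]"] show ?thesis using d by (simp add: y_def)
  qed
  \<comment> \<open>A cell over \<open>\<mu>\<close> is exactly what the equation between
    \<open>\<alpha>\<close> and \<open>\<gamma>\<close> asks for, so \<open>\<tau>\<close> is its
    lift through \<open>w'\<close>.\<close>
  define \<mu> where "\<mu> = ?\<gamma> \<lhd> y' \<cdot> [w] \<rhd> \<kappa> \<cdot> piv ?\<alpha> \<lhd> y"
  have \<mu>: "piso \<mu>" "psrc \<mu> = [w'] @ q' # y" "ptgt \<mu> = [w'] @ p' # y'"
    using a(1) b(1) \<kappa> o3 by (simp_all add: \<mu>_def)
  have pre: "Wl [w']" "pwf \<mu>" "psrc \<mu> = [w'] @ q' # y" "ptgt \<mu> = [w'] @ p' # y'" "q' # y \<noteq> []" "p' # y' \<noteq> []"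
    using \<mu> a by simp_all
  obtain e \<tau> where e: "e \<in> W" "tgt C e = src C (last (q' # y))" "piso \<tau>" "psrc \<tau> = (q' # y) @ [e]"
    "ptgt \<tau> = (p' # y') @ [e]" "\<mu> \<lhd> [e] = [w'] \<rhd> \<tau>"
    by (rule BF4l[OF pre]) (blast intro: that \<mu>(1))
  define x x' where "x = y @ [e]" and "x' = y' @ [e]"
  define \<sigma> where "\<sigma> = \<kappa> \<lhd> [e]"
  have eh: "src C (last y) = tgt C e" using e(2) yn by simp
  have eh': "src C (last y') = tgt C e" using pwf_parallel[OF piso_pwf[OF \<kappa>(1)] \<kappa>(2,3)] yn eh by simp
  have ox: "ok (q # x)" "ok (p # x')" "ok (w # q # x)" "ok (w # p # x')" "ok (w' # q' # x)"
      "ok (w' # p' # x')"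
    "ok (k # q # x)" "ok (k' # p' # x')" "ok (k # p # x')" "ok (k' # q' # x)" "ok (q' # x)" "ok (p' # x')"
  proof -
    have "ok y" "ok y'" using o1 yn by (auto simp: ok_Cons)
    then have "ok x" "ok x'" using eh eh' e(1) yn by (auto simp: x_def x'_def ok_append)
    moreover have "hd x = hd y" "hd x' = hd y'" "x \<noteq> []" "x' \<noteq> []" using yn by (auto simp: x_def x'_def)
    ultimately show "ok (q # x)" "ok (p # x')" "ok (q' # x)" "ok (p' # x')" using o1 o2 yn by (auto
        simp: ok_Cons)
    then show "ok (w # q # x)" "ok (w # p # x')" "ok (w' # q' # x)" "ok (w' # p' # x')"
    "ok (k # q # x)" "ok (k' # p' # x')" "ok (k # p # x')" "ok (k' # q' # x)" using a b by auto
  qed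
  have \<sigma>: "piso \<sigma>" "psrc \<sigma> = q # x" "ptgt \<sigma> = p # x'" using \<kappa> ox by (auto simp: \<sigma>_def x_def x'_def)
  have \<tau>: "piso \<tau>" "psrc \<tau> = q' # x" "ptgt \<tau> = p' # x'" using e by (auto simp: x_def x'_def)
  have Wx: "Wl (w # q # x)" using Wl_appendL[OF Wy, of "[e]"] eh e(1) yn by (simp add: x_def)
  have e1: "[w'] \<rhd> \<tau> = ?\<gamma> \<lhd> x' \<cdot> [w] \<rhd> \<sigma> \<cdot> piv ?\<alpha> \<lhd> x"
    unfolding e(6)[symmetric] by (simp add: \<mu>_def x_def x'_def \<sigma>_def)
  have e2: "[w'] \<rhd> \<tau> \<cdot> ?\<alpha> \<lhd> x \<cdot> [w] \<rhd> piv \<sigma> = ?\<gamma> \<lhd> x'"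
  proof -
    have "[w'] \<rhd> \<tau> \<cdot> ?\<alpha> \<lhd> x \<cdot> [w] \<rhd> piv \<sigma> = ?\<gamma> \<lhd> x' \<cdot> [w] \<rhd> \<sigma> \<cdot> piv (?\<alpha> \<lhd> x) \<cdot> ?\<alpha> \<lhd> x \<cdot> piv ([w] \<rhd> \<sigma>)"
      unfolding e1 using a(1) \<sigma> ox by (simp add: piv_whisk)
    also have "\<dots> = ?\<gamma> \<lhd> x'" using a(1) b(1) \<sigma> ox by simp
    finally show ?thesis .
  qed
  have oz: "ok (q # z)" "ok (p # z')" using Wl_ok[OF z(1)] Wl_ok[OF z'(1)] by (simp_all add: ok_Cons)
  have xz: "x = z @ [s, d, e]" "x' = z' @ [k0, d, e]" by (simp_all add: x_def x'_def y_def y'_def)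
  have "Cmp l r P P' (q # x) (q' # x) (?\<alpha> \<lhd> x) (?\<beta> \<lhd> x)"
    using Cmp_pull[OF z(2) P(1) oz(1), of "[s, d, e]"] a ox(1) by (simp add: xz)
  then have c1: "Cmp l r P P' (p # x') (p' # x') ([w'] \<rhd> \<tau> \<cdot> ?\<alpha> \<lhd> x \<cdot> [w] \<rhd> piv \<sigma>) ([k'] \<rhd> \<tau> \<cdot> ?\<beta> \<lhd> x \<cdot>
      [k] \<rhd> piv \<sigma>)"
    by (rule Cmp_conj[OF P]) (use \<sigma> \<tau> a b in simp_all)
  have c2: "Cmp l r P P' (p # x') (p' # x') (?\<gamma> \<lhd> x') (?\<delta> \<lhd> x')"
    using Cmp_pull[OF z'(2) P(1) oz(2), of "[k0, d, e]"] b ox(2) by (simp add: xz)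
  \<comment> \<open>By \<open>e2\<close> both comparisons have the same first component, so their
    second components agree after \<open>g\<close>.\<close>
  obtain g where g: "Wl g" "ok ((p # x') @ g)" "([k'] \<rhd> \<tau> \<cdot> ?\<beta> \<lhd> x \<cdot> [k] \<rhd> piv \<sigma>) \<lhd> g = ?\<delta> \<lhd> x' \<lhd> g"
    by (rule Cmp_unique[OF P _ _ _ _ c1[unfolded e2] c2]) (use ox b in auto)
  define v v' where "v = x @ g" and "v' = x' @ g"
  have gn: "g \<noteq> []" using g Wl_nonempty by blast
  have ng: "x \<noteq> []" "x' \<noteq> []" by (auto simp: x_def x'_def)
  have gh: "src C (last x') = tgt C (hd g)" "ok g"
    using g gn ng ok_append[of "p # x'" g] by auto
  have gh': "src C (last x) = tgt C (hd g)" using gh pwf_parallel[OF piso_pwf[OF \<sigma>(1)] \<sigma>(2,3)] ng by simp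
  have vn: "v \<noteq> []" "v' \<noteq> []" using ng by (auto simp: v_def v'_def)
  have vh: "hd v = hd x" "hd v' = hd x'" using ng by (auto simp: v_def v'_def)
  have ov: "ok v" "ok v'" "tgt C (hd v) = src C q" "tgt C (hd v') = src C p" "src C q' = src C q"
      "src C p' = src C p"
    using ox gh gh' ng gn vh a b by (auto simp: v_def v'_def ok_append ok_Cons)
  have ov2: "ok (q # v)" "ok (p # v')" "ok (q' # v)" "ok (p' # v')" "ok (w # q # v)" "ok (w # p # v')"
    "ok (w' # q' # v)" "ok (w' # p' # v')" "ok (k # q # v)" "ok (k # p # v')" "ok (k' # q' # v)"
        "ok (k' # p' # v')"
    using ov a b vn by (auto simp: ok_Cons)
  have opv: "ok [q, path v]" "ok [p, path v']" "ok [q', path v]" "ok [p', path v']" "ok [w, q, path v]"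
      "ok [w, p, path v']"
    "ok [w', q', path v]" "ok [w', p', path v']" "ok [k, q, path v]" "ok [k, p, path v']"
        "ok [k', q', path v]" "ok [k', p', path v']"
    using ov a b by auto
  let ?J = "pcol v" and ?J' = "pcol v'"
  \<comment> \<open>The equivalence demands single 1-morphisms as refinements, so the tails
    \<open>v\<close> and \<open>v'\<close> are collapsed.\<close>
  define S1 where "S1 = [q] \<rhd> piv ?J \<cdot> piv \<sigma> \<lhd> g \<cdot> [p] \<rhd> ?J'"
  define S2 where "S2 = [p'] \<rhd> piv ?J' \<cdot> \<tau> \<lhd> g \<cdot> [q'] \<rhd> ?J"
  have S1: "piso S1" "psrc S1 = [p, path v']" "ptgt S1 = [q, path v]"
    using \<sigma> ov ov2 opv by (simp_all add: S1_def v_def v'_def)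
  have S2: "piso S2" "psrc S2 = [q', path v]" "ptgt S2 = [p', path v']"
    using \<tau> ov ov2 opv by (simp_all add: S2_def v_def v'_def)
  have Wv: "Wl [w, q, path v]"
  proof -
    have "Wl ((w # q # x) @ g)" using Wl_appendL[OF Wx g(1)] gh' ng by auto
    then show ?thesis using Wl_psrc[of "[w, q] \<rhd> ?J"] ov ov2 opv by (simp add: v_def)
  qed
  have tr: "[m'] \<rhd> S2 \<cdot> c \<lhd> [path v] \<cdot> [m] \<rhd> S1 = c' \<lhd> [path v']"
    if c: "pwf c" "psrc c = [m, q]" "ptgt c = [m', q']" "pwf c'" "psrc c' = [m, p]" "ptgt c' = [m', p']"
      and e: "([m'] \<rhd> \<tau> \<cdot> c \<lhd> x \<cdot> [m] \<rhd> piv \<sigma>) \<lhd> g = c' \<lhd> x' \<lhd> g"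
      and m: "ok (m # q # v)" "ok (m # p # v')" "ok (m' # q' # v)" "ok (m' # p' # v')"
      "ok [m, q, path v]" "ok [m, p, path v']" "ok [m', q', path v]" "ok [m', p', path v']" for c c' m m'
  proof -
    have 1: "[m', q'] \<rhd> ?J \<cdot> c \<lhd> [path v] = c \<lhd> v \<cdot> [m, q] \<rhd> ?J"
      using pinterchange[of c ?J] c by simp
    have 2: "[m', p'] \<rhd> ?J' \<cdot> c' \<lhd> [path v'] = c' \<lhd> v' \<cdot> [m, p] \<rhd> ?J'"
      using pinterchange[of c' ?J'] c by simp
    have "[m'] \<rhd> S2 \<cdot> c \<lhd> [path v] \<cdot> [m] \<rhd> S1 =
      [m', p'] \<rhd> piv ?J' \<cdot> [m'] \<rhd> (\<tau> \<lhd> g) \<cdot> ([m', q'] \<rhd> ?J \<cdot> c \<lhd> [path v]) \<cdot> [m, q] \<rhd> piv ?J \<cdot> [m] \<rhd>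
          (piv \<sigma> \<lhd> g) \<cdot> [m, p] \<rhd> ?J'"
      by (simp add: S1_def S2_def)
    also have "\<dots> = [m', p'] \<rhd> piv ?J' \<cdot> [m'] \<rhd> (\<tau> \<lhd> g) \<cdot> c \<lhd> v \<cdot> [m, q] \<rhd> ?J \<cdot> piv ([m, q] \<rhd> ?J) \<cdot>
        [m] \<rhd> (piv \<sigma> \<lhd> g) \<cdot> [m, p] \<rhd> ?J'"
      unfolding 1 using ov m by (simp add: piv_whisk)
    also have "\<dots> = [m', p'] \<rhd> piv ?J' \<cdot> [m'] \<rhd> (\<tau> \<lhd> g) \<cdot> c \<lhd> v \<cdot> [m] \<rhd> (piv \<sigma> \<lhd> g) \<cdot> [m, p] \<rhd> ?J'"
      using ov m \<sigma> by (subst piv_cancel(2)) (simp_all add: v_def v'_def)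
    also have "\<dots> = [m', p'] \<rhd> piv ?J' \<cdot> (([m'] \<rhd> \<tau> \<cdot> c \<lhd> x \<cdot> [m] \<rhd> piv \<sigma>) \<lhd> g) \<cdot> [m, p] \<rhd> ?J'"
      by (simp add: v_def)
    also have "\<dots> = piv ([m', p'] \<rhd> ?J') \<cdot> [m', p'] \<rhd> ?J' \<cdot> c' \<lhd> [path v']"
      unfolding e 2 using ov m by (simp add: piv_whisk v'_def)
    also have "\<dots> = c' \<lhd> [path v']"
      using ov m c by (intro piv_cancel) simp_all
    finally show ?thesis .
  qed
  have "[w'] \<rhd> S2 \<cdot> ?\<alpha> \<lhd> [path v] \<cdot> [w] \<rhd> S1 = ?\<gamma> \<lhd> [path v']"
    by (rule tr) (use a(1) b(1) ov2 opv arg_cong[OF e2, of "\<lambda>c. c \<lhd> g"] in simp_all)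
  moreover have "[k'] \<rhd> S2 \<cdot> ?\<beta> \<lhd> [path v] \<cdot> [k] \<rhd> S1 = ?\<delta> \<lhd> [path v']"
    by (rule tr[OF _ _ _ _ _ _ g(3)]) (use a(2) b(2) ov2 opv in simp_all)
  ultimately show ?thesis unfolding frep_equiv_iff[OF f]
    using S1 S2 Wv by blast
qed

section \<open>Canonical 2-morphisms: independence of the representative and uniqueness\<close>

definition canonical :: "nat \<Rightarrow> nat \<Rightarrow> ('m, 'c) presentation \<Rightarrow> ('m, 'c) presentation \<Rightarrow>
    ('o, 'm) fmor \<Rightarrow> ('o, 'm) fmor \<Rightarrow> ('o, 'm, 'c) fcell \<Rightarrow> bool" where
  "canonical l r P P' K K' \<Gamma> \<longleftrightarrow>
    presents l r K P \<and> presents l r K' P' \<and> (\<exists>\<rho>. is_frep K K' \<rho> \<and> \<Gamma> = fclass K K' \<rho> \<and> locCmp l r P P' K K' \<rho>)"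

text \<open>The operations start from arbitrary representatives, so canonicity has to pass to each
  of them. Reflexivity of the equivalence puts a representative into its own class, and
  \<open>locCmp_frep_equiv\<close> does the rest.\<close>

lemma canonical_rep:
  assumes "canonical l r P P' K K' (fclass K K' \<rho>)" "is_frep K K' \<rho>"
  shows "locCmp l r P P' K K' \<rho>"
proof -
  obtain X w k X' w' k' where K: "K = (X, w, k)" "K' = (X', w', k')" by (cases K; cases K') auto
  obtain T q q' \<alpha> \<beta> where \<rho>: "\<rho> = (T, q, q', \<alpha>, \<beta>)" by (cases \<rho>)
  obtain \<rho>0 where r: "is_frep K K' \<rho>0" "fclass K K' \<rho> = fclass K K' \<rho>0" "locCmp l r P P' K K' \<rho>0"
    using assms(1) by (auto simp: canonical_def)
  obtain S p p' \<gamma> \<delta> where \<rho>0: "\<rho>0 = (S, p, p', \<gamma>, \<delta>)" by (cases \<rho>0)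
  have "frep_equiv K K' \<rho> \<rho>" using frep_equiv_refl assms(2) unfolding K \<rho> by blast
  then have "frep_equiv K K' \<rho>0 \<rho>" using r(2) assms(2) unfolding fclass_def by blast
  then show ?thesis using locCmp_frep_equiv r assms unfolding K \<rho> \<rho>0 canonical_def by blast
qed

text \<open>The class of a canonical representative consists of exactly the representatives
  satisfying \<open>locCmp\<close>. This description takes the place of symmetry and transitivity of
  the equivalence.\<close>

lemma canonical_unique:
  assumes "canonical l r P P' K K' \<Gamma>" "canonical l r P P' K K' \<Delta>"
  shows "\<Gamma> = \<Delta>"
proof -
  obtain X w k X' w' k' where K: "K = (X, w, k)" "K' = (X', w', k')" by (cases K; cases K') auto
  have P: "presents l r K P" "presents l r K' P'" using assms by (auto simp: canonical_def)
  obtain \<rho> \<rho>' where r: "is_frep K K' \<rho>" "\<Gamma> = fclass K K' \<rho>" "locCmp l r P P' K K' \<rho>"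
    "is_frep K K' \<rho>'" "\<Delta> = fclass K K' \<rho>'" "locCmp l r P P' K K' \<rho>'"
    using assms unfolding canonical_def by blast
  have 1: "frep_equiv K K' \<sigma> \<tau>" if "is_frep K K' \<sigma>" "is_frep K K' \<tau>" "locCmp l r P P' K K' \<sigma>"
      "locCmp l r P P' K K' \<tau>" for \<sigma> \<tau>
    using locCmp_unique P that unfolding K by (cases \<sigma>; cases \<tau>) blast
  have 2: "locCmp l r P P' K K' \<tau>" if "is_frep K K' \<sigma>" "is_frep K K' \<tau>" "locCmp l r P P' K K' \<sigma>"
      "frep_equiv K K' \<sigma> \<tau>" for \<sigma> \<tau>
    using locCmp_frep_equiv P that unfolding K by (cases \<sigma>; cases \<tau>) blast
  show ?thesis unfolding r fclass_def using 1 2 r by blast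
qed

lemma presents_fmor: "presents l r (X, w, k) P \<Longrightarrow> is_fmor (tgt C w) (tgt C k) (X, w, k)"
  by (auto simp: hom_def)

text \<open>The operations produce legs that are composites. Here the legs may be paths; they are
  collapsed to single 1-morphisms, which preserves the comparison by
  \<open>Cmp_conj\<close>.\<close>

lemma canonicalI:
  assumes P: "presents l r (X, w, k) P" "presents l r (X', w', k') P'"
    and a: "piso a" "psrc a = w # q" "ptgt a = w' # q'" "pwf b" "psrc b = k # q" "ptgt b = k' # q'"
    and q: "Wl (w # q)" "q \<noteq> []" "q' \<noteq> []" "T = src C (last q)" "x = path q" "x' = path q'" "\<alpha> = pval a"
        "\<beta> = pval b"
    and s: "Wl s" "ok (q @ s)" "Cmp l r P P' (q @ s) (q' @ s) (a \<lhd> s) (b \<lhd> s)"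
  shows "canonical l r P P' (X, w, k) (X', w', k') (fclass (X, w, k) (X', w', k') (T, x, x', \<alpha>, \<beta>))"
proof -
  have wa: "pwf a" using a by simp
  note o = pwf_ok[OF wa] pwf_ok[OF a(4)]
  have p: "src C w = X" "src C k = X" "src C w' = X'" "src C k' = X'" using P by auto
  have h: "ok q" "ok q'" "X = tgt C (hd q)" "X' = tgt C (hd q')" "src C (last q') = src C (last q)"
     "w \<in> Mor C" "w' \<in> Mor C" "k \<in> Mor C" "k' \<in> Mor C" "tgt C w' = tgt C w" "tgt C k' = tgt C k"
    using o a q P by (auto simp: ok_Cons)
  have f: "is_frep (X, w, k) (X', w', k') (T, x, x', \<alpha>, \<beta>)"
    unfolding q(4-8) using h presents_fmor[OF P(1)] presents_fmor[OF P(2)]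
    by (intro is_frep_pval[of "tgt C w" "tgt C k", OF _ _ a q(1-3)]) simp_all
  have sn: "s \<noteq> []" "ok s" using s Wl_nonempty by auto
  have hs: "src C (last q) = tgt C (hd s)" using s q sn by (auto simp: ok_append)
  have o2: "ok (path q # s)" "ok (path q' # s)" "ok (q' @ s)" using h hs sn q by (auto
      simp: ok_Cons ok_append)
  have o3: "ok (w # path q # s)" "ok (w # q @ s)" "ok (w' # path q' # s)" "ok (w' # q' @ s)"
    using o2 s h p q by (auto simp: ok_Cons)
  have "Cmp l r P P' (path q # s) (path q' # s)
    ([w'] \<rhd> (piv (pcol q') \<lhd> s) \<cdot> a \<lhd> s \<cdot> [w] \<rhd> (pcol q \<lhd> s)) ([k'] \<rhd> (piv (pcol q') \<lhd> s) \<cdot> b \<lhd> s \<cdot> [k] \<rhd>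
        (pcol q \<lhd> s))"
    by (rule Cmp_conj[OF P s(3)]) (use h o2 s q in auto)
  then have "Cmp l r P P' (path q # s) (path q' # s) (Pcell [w, path q] [w', path q'] (pval a) \<lhd> s)
      (Pcell [k, path q] [k', path q'] (pval b) \<lhd> s)"
    using Pcell_rebracket[OF wa a(2,3) q(2,3)] Pcell_rebracket[OF a(4,5,6) q(2,3)] by simp
  moreover have "Wl (w # path q # s)"
  proof -
    have "Wl ((w # q) @ s)" using Wl_appendL[OF q(1) s(1)] hs q by simp
    then show ?thesis using Wl_psrc[of "[w] \<rhd> (pcol q \<lhd> s)"] h o2 o3 by simp
  qed
  ultimately have "locCmp l r P P' (X, w, k) (X', w', k') (T, x, x', \<alpha>, \<beta>)" unfolding q(4-8) by auto
  with f P show ?thesis unfolding canonical_def by blast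
qed

text \<open>The presentation of a composite fraction: restriction along the two sides of the chosen
  square. The new junction at \<open>m\<close> undoes the exit of \<open>P\<close>, crosses the
  square and enters \<open>Q\<close>. The factors \<open>pcol\<close> appear because the 1-morphisms
  of the composite fraction are single letters.\<close>

definition glue :: "nat \<Rightarrow> ('m, 'c) presentation \<Rightarrow> ('m, 'c) presentation \<Rightarrow> 'm \<Rightarrow> 'm \<Rightarrow> 'm \<Rightarrow> 'm \<Rightarrow> ('m, 'c) pcell \<Rightarrow>
    ('m, 'c) presentation" where
  "glue m P Q w g v' f' \<rho> = \<lparr>leg = (\<lambda>i. if i \<le> m then leg P i @ [v'] else leg Q i @ [f']),
     jct = (\<lambda>i. if i < m then jct P i \<lhd> [v']
       else if i = m then ent Q \<lhd> [f'] \<cdot> \<rho> \<cdot> piv (ext P) \<lhd> [v'] else jct Q i \<lhd> [f']),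
     ent = ent P \<lhd> [v'] \<cdot> pcol [w, v'], ext = ext Q \<lhd> [f'] \<cdot> pcol [g, f']\<rparr>"

lemma presents_glue:
  assumes P: "presents l m (X, w, f) P" and Q: "presents (Suc m) r (Y, v, g) Q"
    and c: "v' \<in> W" "f' \<in> Mor C" "tgt C v' = X" "tgt C f' = Y" "src C v' = D" "piso \<rho>" "psrc \<rho> = [f, v']"
        "ptgt \<rho> = [v, f']"
  shows "presents l r (D, w \<odot> v', g \<odot> f') (glue m P Q w g v' f' \<rho>)"
proof -
  have f'D: "src C f' = D" using pwf_parallel[OF piso_pwf[OF c(6)] c(7,8)] c by simp
  have o: "ok [w, v']" "ok [g, f']" "ok [f, v']" "ok [v, f']" using P Q c by auto
  have lP: "leg_ok D i (leg P i @ [v'])" if "l \<le> i" "i \<le> m" for i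
    using leg_ok_append[of X i "leg P i" "[v']"] that P c by auto
  have lQ: "leg_ok D i (leg Q i @ [f'])" if "Suc m \<le> i" "i \<le> r" for i
    using leg_ok_append[of Y i "leg Q i" "[f']"] that Q c f'D by auto
  have oP: "ok (U i # leg P i @ [v'])" "ok (F i # leg P i @ [v'])" if "l \<le> i" "i \<le> m" for i
    using leg_okD(2,3)[of X i "leg P i" "[v']"] that P c by auto
  have oQ: "ok (U i # leg Q i @ [f'])" "ok (F i # leg Q i @ [f'])" if "Suc m \<le> i" "i \<le> r" for i
    using leg_okD(2,3)[of Y i "leg Q i" "[f']"] that Q c by auto
  have lm: "l \<le> m" "Suc m \<le> r" using P Q by auto
  have "w \<odot> v' \<in> W" using BF2[of D X v' "tgt C w" w] P c by (auto simp: hom_def)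
  then show ?thesis
    using P Q c o lP lQ oP oQ lm f'D by (auto simp: glue_def less_Suc_eq_le)
qed

text \<open>The exit component \<open>\<mu>\<close> of the first comparison and the entrance
  component \<open>\<nu>\<close> of the second must agree across the chosen squares; this agreement
  is precisely compatibility at the new junction.\<close>

lemma Cmp_glue:
  assumes P: "presents l m (X, w, f) P" and Q: "presents (Suc m) r (Y, v, g) Q"
    and c: "v1 \<in> W" "f1 \<in> Mor C" "tgt C v1 = X" "tgt C f1 = Y" "piso \<rho>" "psrc \<rho> = [f, v1]" "ptgt \<rho> = [v, f1]"
    and P': "presents l m (X', w', f') P'" and Q': "presents (Suc m) r (Y', v', g') Q'"
    and c': "v2 \<in> W" "f2 \<in> Mor C" "tgt C v2 = X'" "tgt C f2 = Y'" "piso \<rho>'" "psrc \<rho>' = [f', v2]"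
        "ptgt \<rho>' = [v', f2]"
    and q: "ok (v1 # q)" "ok (v2 # q')" "q \<noteq> []" "q' \<noteq> []"
    and cP: "Cmp l m P P' (v1 # q) (v2 # q') \<phi> \<mu>" and cQ: "Cmp (Suc m) r Q Q' (f1 # q) (f2 # q') \<nu> \<beta>"
    and e: "\<rho>' \<lhd> q' \<cdot> \<mu> = \<nu> \<cdot> \<rho> \<lhd> q"
  shows "Cmp l r (glue m P Q w g v1 f1 \<rho>) (glue m P' Q' w' g' v2 f2 \<rho>') q q'
    (piv (pcol [w', v2] \<lhd> q') \<cdot> \<phi> \<cdot> pcol [w, v1] \<lhd> q) (piv (pcol [g', f2] \<lhd> q') \<cdot> \<beta> \<cdot> pcol [g, f1] \<lhd> q)"
proof -
  have lm: "l \<le> m" "Suc m \<le> r" using P Q by auto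
  have s: "src C f1 = src C v1" using pwf_parallel[OF piso_pwf[OF c(5)] c(6,7)] by simp
  have s': "src C f2 = src C v2" using pwf_parallel[OF piso_pwf[OF c'(5)] c'(6,7)] by simp
  have q2: "ok (f1 # q)" "ok (f2 # q')" "ok q" "ok q'" using q s s' c c' by (auto simp: ok_Cons)
  obtain \<xi> where x: "compat l m P P' (v1 # q) (v2 # q') \<xi>"
    "ent P' \<lhd> (v2 # q') \<cdot> \<phi> = [U l] \<rhd> \<xi> l \<cdot> ent P \<lhd> (v1 # q)"
        "ext P' \<lhd> (v2 # q') \<cdot> \<mu> = [F m] \<rhd> \<xi> m \<cdot> ext P \<lhd> (v1 # q)"
    using cP by (auto simp: Cmp_def)
  obtain \<zeta> where y: "compat (Suc m) r Q Q' (f1 # q) (f2 # q') \<zeta>"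
    "ent Q' \<lhd> (f2 # q') \<cdot> \<nu> = [U (Suc m)] \<rhd> \<zeta> (Suc m) \<cdot> ent Q \<lhd> (f1 # q)"
        "ext Q' \<lhd> (f2 # q') \<cdot> \<beta> = [F r] \<rhd> \<zeta> r \<cdot> ext Q \<lhd> (f1 # q)"
    using cQ by (auto simp: Cmp_def)
  have sP: "pwf \<phi>" "pwf \<mu>" "psrc \<phi> = w # v1 # q" "ptgt \<phi> = w' # v2 # q'" "psrc \<mu> = f # v1 # q"
      "ptgt \<mu> = f' # v2 # q'"
    using Cmp_simps[OF P P' cP q(1,2)] c c' by simp_all
  have sQ: "pwf \<nu>" "pwf \<beta>" "psrc \<beta> = g # f1 # q" "ptgt \<beta> = g' # f2 # q'"
    using Cmp_simps[OF Q Q' cQ q2(1,2)] c c' by simp_all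
  \<comment> \<open>The two families are kept on their own sides, so only index \<open>m\<close>
    requires a new argument.\<close>
  let ?\<xi> = "\<lambda>i. if i \<le> m then \<xi> i else \<zeta> i"
  have ex: "piso (ext P)" "psrc (ext P) = [f]" "ptgt (ext P) = F m # leg P m"
    "piso (ext P')" "psrc (ext P') = [f']" "ptgt (ext P') = F m # leg P' m" using P P' by auto
  have of: "ok (f # v1 # q)" "ok (f' # v2 # q')" using q P P' c c' by auto
  have m: "[F m] \<rhd> \<xi> m \<cdot> ext P \<lhd> (v1 # q) = ext P' \<lhd> (v2 # q') \<cdot> \<mu>" using x by simp
  have wx: "pwf (\<xi> m)" "psrc (\<xi> m) = leg P m @ v1 # q" "ptgt (\<xi> m) = leg P' m @ v2 # q'" using x lm by
      (auto simp: compat_def)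
  have oP: "ok (F m # leg P m @ v1 # q)"
    using leg_okD(3)[of X m "leg P m" "v1 # q"] P q c lm by auto
  have im: "piv (ext P') \<lhd> (v2 # q') \<cdot> [F m] \<rhd> \<xi> m = \<mu> \<cdot> piv (ext P) \<lhd> (v1 # q)"
  proof -
    have "piv (ext P') \<lhd> (v2 # q') \<cdot> [F m] \<rhd> \<xi> m =
        piv (ext P') \<lhd> (v2 # q') \<cdot> ([F m] \<rhd> \<xi> m \<cdot> ext P \<lhd> (v1 # q)) \<cdot> piv (ext P) \<lhd> (v1 # q)"
      using ex of wx oP by simp
    also have "\<dots> = \<mu> \<cdot> piv (ext P) \<lhd> (v1 # q)"
      unfolding m using ex of sP c c' oP by simp
    finally show ?thesis .
  qed
  have "(ent Q' \<lhd> (f2 # q') \<cdot> \<rho>' \<lhd> q' \<cdot> piv (ext P') \<lhd> (v2 # q')) \<cdot> [F m] \<rhd> \<xi> m =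
      ent Q' \<lhd> (f2 # q') \<cdot> (\<rho>' \<lhd> q' \<cdot> \<mu>) \<cdot> piv (ext P) \<lhd> (v1 # q)"
    using im by simp
  also have "\<dots> = (ent Q' \<lhd> (f2 # q') \<cdot> \<nu>) \<cdot> \<rho> \<lhd> q \<cdot> piv (ext P) \<lhd> (v1 # q)" unfolding e by simp
  also have "\<dots> = [U (Suc m)] \<rhd> \<zeta> (Suc m) \<cdot> ent Q \<lhd> (f1 # q) \<cdot> \<rho> \<lhd> q \<cdot> piv (ext P) \<lhd> (v1 # q)"
    unfolding y(2) by simp
  finally have J: "ent Q' \<lhd> (f2 # q') \<cdot> \<rho>' \<lhd> q' \<cdot> piv (ext P') \<lhd> (v2 # q') \<cdot> [F m] \<rhd> \<xi> m =
      [U (Suc m)] \<rhd> \<zeta> (Suc m) \<cdot> ent Q \<lhd> (f1 # q) \<cdot> \<rho> \<lhd> q \<cdot> piv (ext P) \<lhd> (v1 # q)" by simp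
  have "compat l r (glue m P Q w g v1 f1 \<rho>) (glue m P' Q' w' g' v2 f2 \<rho>') q q' ?\<xi>"
    unfolding compat_def
  proof (intro conjI allI impI; (elim conjE)?)
    fix i assume i: "l \<le> i" "i < r"
    consider "i < m" | "i = m" | "m < i" by linarith
    then show "jct (glue m P' Q' w' g' v2 f2 \<rho>') i \<lhd> q' \<cdot> [F i] \<rhd> ?\<xi> i =
        [U (Suc i)] \<rhd> ?\<xi> (Suc i) \<cdot> jct (glue m P Q w g v1 f1 \<rho>) i \<lhd> q"
      using x(1) y(1) i J by cases (simp_all add: glue_def compat_def)
  qed (use x(1) y(1) in \<open>auto simp: glue_def compat_def\<close>)
  moreover have oo: "ok (w' # v2 # q')" "ok (g' # f2 # q')" "ok (w # v1 # q)" "ok (g # f1 # q)"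
    using q q2 P Q P' Q' c c' by auto
  have "pcol [w', v2] \<lhd> q' \<cdot> piv (pcol [w', v2] \<lhd> q') \<cdot> \<phi> \<cdot> pcol [w, v1] \<lhd> q = \<phi> \<cdot> pcol [w, v1] \<lhd> q"
    "pcol [g', f2] \<lhd> q' \<cdot> piv (pcol [g', f2] \<lhd> q') \<cdot> \<beta> \<cdot> pcol [g, f1] \<lhd> q = \<beta> \<cdot> pcol [g, f1] \<lhd> q"
    by (rule piv_cancel(2); use oo sP sQ q in \<open>auto simp: ok_Cons\<close>)+
  ultimately show ?thesis unfolding Cmp_def
    using lm pvcomp_reassoc[OF x(2), of "pcol [w, v1] \<lhd> q"] pvcomp_reassoc[OF y(3), of "pcol [g, f1] \<lhd> q"]
    by (intro exI[of _ ?\<xi>]) (simp add: glue_def)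
qed

section \<open>Stability of canonicity under the operations\<close>

lemma canonical_fclass:
  assumes "canonical l r P P' K K' (fclass L L' \<rho>)"
  shows "L = K" "L' = K'"
  using assms by (auto simp: canonical_def fclass_def)

lemma canonical_refine:
  assumes "canonical l r P P' (X, w, k) (X', w', k') (fclass (X, w, k) (X', w', k') (T, q, q', \<alpha>, \<beta>))"
    and f: "is_frep (X, w, k) (X', w', k') (T, q, q', \<alpha>, \<beta>)" and t: "ok (q # t)" "t \<noteq> []"
  obtains s where "Wl s" "ok (q # t @ s)" "Cmp l r P P' (q # t @ s) (q' # t @ s)
      (Pcell [w, q] [w', q'] \<alpha> \<lhd> (t @ s)) (Pcell [k, q] [k', q'] \<beta> \<lhd> (t @ s))"
  using locCmp_refine[OF _ _ f canonical_rep[OF assms(1,2)] t] assms(1) that unfolding canonical_def by blast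

text \<open>Both factors are brought to one common refinement \<open>s @ s'\<close> behind
  \<open>t1\<close> and \<open>t2\<close>. The auxiliary cell in the middle is a change of test
  path, hence a comparison for any choice of it.\<close>

lemma canonical_fvcomp_rel:
  assumes "fvcomp_rel \<Gamma> \<Delta> \<Omega>" and \<Gamma>: "canonical l r P P' K K' \<Gamma>" and \<Delta>: "canonical l r P' P'' K' K'' \<Delta>"
  shows "canonical l r P P'' K K'' \<Omega>"
  using assms(1)
proof cases
  case (1 A1 w1 f1 A2 w2 f2 A4 u1 u2 \<alpha>1 \<beta>1 A3 w3 f3 A5 u3 u4 \<alpha>2 \<beta>2 D t1 t2 \<rho> \<alpha> \<beta>)
  have K: "K = (A1, w1, f1)" "K' = (A2, w2, f2)" "K'' = (A3, w3, f3)"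
    using canonical_fclass \<Gamma> \<Delta> 1 by metis+
  have P: "presents l r (A1, w1, f1) P" "presents l r (A2, w2, f2) P'" "presents l r (A3, w3, f3) P''"
    using \<Gamma> \<Delta> by (auto simp: canonical_def K)
  note f = 1(4,5) note a = is_frep_cells[OF f(1)] and b = is_frep_cells[OF f(2)]
  have t: "t1 \<in> W" "t2 \<in> Mor C" "tgt C t1 = A4" "tgt C t2 = A5" "src C t1 = D" "src C t2 = D"
    using 1 by (auto simp: hom_def)
  define \<rho>' where "\<rho>' = Pcell [u2, t1] [u3, t2] \<rho>"
  have o: "ok [u1, t1]" "ok [u2, t1]" "ok [u3, t2]" "ok [u4, t2]" using a b t by auto
  have \<rho>': "piso \<rho>'" "psrc \<rho>' = [u2, t1]" "ptgt \<rho>' = [u3, t2]"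
    using 1(9) o by (auto simp: \<rho>'_def Pcell_iso)
  let ?\<alpha>1 = "Pcell [w1, u1] [w2, u2] \<alpha>1" and ?\<beta>1 = "Pcell [f1, u1] [f2, u2] \<beta>1"
    and ?\<alpha>2 = "Pcell [w2, u3] [w3, u4] \<alpha>2" and ?\<beta>2 = "Pcell [f2, u3] [f3, u4] \<beta>2"
  define A where "A = ?\<alpha>2 \<lhd> [t2] \<cdot> [w2] \<rhd> \<rho>' \<cdot> ?\<alpha>1 \<lhd> [t1]"
  define B where "B = ?\<beta>2 \<lhd> [t2] \<cdot> [f2] \<rhd> \<rho>' \<cdot> ?\<beta>1 \<lhd> [t1]"
  have A: "piso A" "psrc A = w1 # [u1, t1]" "ptgt A = w3 # [u4, t2]" using a b t \<rho>' by (auto simp: A_def)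
  have B: "pwf B" "psrc B = f1 # [u1, t1]" "ptgt B = f3 # [u4, t2]" using a b t \<rho>' by (auto simp: B_def)
  have pA: "\<alpha> = pval A" "\<beta> = pval B"
    using a b t \<rho>' unfolding 1 A_def B_def by (simp_all add: whisk_pval \<rho>'_def)
  obtain s where s: "Wl s" "ok (u1 # [t1] @ s)" "Cmp l r P P' (u1 # [t1] @ s) (u2 # [t1] @ s) (?\<alpha>1 \<lhd> ([t1]
      @ s)) (?\<beta>1 \<lhd> ([t1] @ s))"
    using canonical_refine[OF _ f(1), of l r P P' "[t1]"] \<Gamma> o unfolding K 1 by auto
  have sn: "s \<noteq> []" "ok s" "tgt C (hd s) = D" using s Wl_nonempty[OF s(1)] t by (auto simp: ok_Cons)
  \<comment> \<open>The second factor is refined beyond \<open>s\<close>; the first is then pulled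
    along \<open>s'\<close> to match.\<close>
  obtain s' where s': "Wl s'" "ok (u3 # (t2 # s) @ s')"
      "Cmp l r P' P'' (u3 # (t2 # s) @ s') (u4 # (t2 # s) @ s')
      (?\<alpha>2 \<lhd> ((t2 # s) @ s')) (?\<beta>2 \<lhd> ((t2 # s) @ s'))"
    by (rule canonical_refine[OF _ f(2), of l r P' P'' "t2 # s"])
      (use \<Delta> o sn t b in \<open>auto simp: K 1 ok_Cons intro: that\<close>)
  have s'n: "s' \<noteq> []" "src C (last s) = tgt C (hd s')" "ok (s @ s')"
    using s' Wl_nonempty[OF s'(1)] sn ok_append[of "u3 # t2 # s" s'] by (auto simp: ok_append)
  have oS: "ok (u1 # t1 # s @ s')" "ok (u2 # t1 # s @ s')" "ok (u3 # t2 # s @ s')" "ok (u4 # t2 # s @ s')"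
    using s'n sn t o by (auto simp: ok_Cons)
  have c1: "Cmp l r P P' (u1 # t1 # s @ s') (u2 # t1 # s @ s') (?\<alpha>1 \<lhd> (t1 # s @ s')) (?\<beta>1 \<lhd> (t1 # s @ s'))"
    using Cmp_pull[OF s(3) P(1), of s'] s oS a by simp
  have c2: "Cmp l r P' P' (u2 # t1 # s @ s') (u3 # t2 # s @ s') ([w2] \<rhd> (\<rho>' \<lhd> (s @ s'))) ([f2] \<rhd> (\<rho>' \<lhd> (s
      @ s')))"
    by (rule Cmp_whisk[OF P(2)]) (use \<rho>' oS a in auto)
  have c3: "Cmp l r P' P'' (u3 # t2 # s @ s') (u4 # t2 # s @ s') (?\<alpha>2 \<lhd> (t2 # s @ s')) (?\<beta>2 \<lhd> (t2 # s @ s'))"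
    using s'(3) by simp
  have lr: "l \<le> r" using P by simp
  have c: "Cmp l r P P'' ([u1, t1] @ s @ s') ([u4, t2] @ s @ s') (A \<lhd> (s @ s')) (B \<lhd> (s @ s'))"
    using Cmp_vcomp[OF Cmp_vcomp[OF c1 c2 lr] c3 lr] by (simp add: A_def B_def)
  show ?thesis unfolding K 1
  proof (rule canonicalI[OF P(1,3) A B, where s = "s @ s'"])
    show "Wl (w1 # [u1, t1])" using Wl_appendL[OF a(3), of "[t1]"] t a by simp
    show "Wl (s @ s')" using s s' s'n by (intro Wl_appendL) auto
    show "ok ([u1, t1] @ s @ s')" using oS by simp
    show "whisk [] [w2, u3] [w3, u4] [t2] \<alpha>2 \<bullet> whisk [w2] [u2, t1] [u3, t2] [] \<rho> \<bullet>
        whisk [] [w1, u1] [w2, u2] [t1] \<alpha>1 = pval A"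
      using pA 1 by simp
    show "whisk [] [f2, u3] [f3, u4] [t2] \<beta>2 \<bullet> whisk [f2] [u2, t1] [u3, t2] [] \<rho> \<bullet>
        whisk [] [f1, u1] [f2, u2] [t1] \<beta>1 = pval B"
      using pA 1 by simp
  qed (use c t in simp_all)
qed

definition glue_choice :: "nat \<Rightarrow> ('o, 'm) fmor \<Rightarrow> ('m, 'c) presentation \<Rightarrow> ('o, 'm) fmor \<Rightarrow>
    ('m, 'c) presentation \<Rightarrow>
    ('m, 'c) presentation" where
  "glue_choice m K P G Q = (case K of (X, w, f) \<Rightarrow> case G of (Y, v, g) \<Rightarrow> case choice f v of (D, v', f', \<rho>) \<Rightarrow>
     glue m P Q w g v' f' (Pcell [f, v'] [v, f'] \<rho>))"

lemma glue_choice_simp: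
  "choice f v = (D, v', f', \<rho>) \<Longrightarrow>
    glue_choice m (X, w, f) P (Y, v, g) Q = glue m P Q w g v' f' (Pcell [f, v'] [v, f'] \<rho>)"
  by (simp add: glue_choice_def)

lemma presents_glue_choice:
  assumes "presents l m (X, w, f) P" "presents (Suc m) r (Y, v, g) Q" "tgt C f = tgt C v"
  shows "presents l r (fcomp (Y, v, g) (X, w, f)) (glue_choice m (X, w, f) P (Y, v, g) Q)"
proof -
  obtain D v' f' \<rho> where c: "choice f v = (D, v', f', \<rho>)" by (cases "choice f v") auto
  have "f \<in> Mor C" "v \<in> W" using assms by auto
  note cc = choice_cell[OF this assms(3) c]
  show ?thesis using presents_glue[OF assms(1,2), of v' f' D] cc assms by (simp add: c glue_choice_def)
qed

text \<open>The equation imposed on \<Lambda> is the agreement across the chosen squares required by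
  \<open>Cmp_glue\<close>; the fixed fraction contributes the comparison induced by
  \<Lambda>.\<close>

lemma canonical_fwhisk_l_rel:
  assumes "fwhisk_l_rel G \<Gamma> \<Omega>" and \<Gamma>: "canonical l m P P' K K' \<Gamma>" and Q: "presents (Suc m) r G Q"
  shows "canonical l r (glue_choice m K P G Q) (glue_choice m K' P' G Q) (fcomp G K) (fcomp G K') \<Omega>"
  using assms(1)
proof cases
  case (1 B E B' u g A A1 w1 f1 A2 w2 f2 A3 v1 v2 \<alpha> \<beta> D1 u1 h1 \<rho>1 D2 u2 h2 \<rho>2 D3 u3 D4 u5 u4 u6 \<eta>1 \<eta>2 D5
      u7 u8 \<eta>3 \<Lambda> \<mu> \<mu>' \<nu>)
  have K: "K = (A1, w1, f1)" "K' = (A2, w2, f2)" "G = (B', u, g)"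
    using canonical_fclass \<Gamma> 1 by metis+
  have P: "presents l m (A1, w1, f1) P" "presents l m (A2, w2, f2) P'"
      and Q': "presents (Suc m) r (B', u, g) Q"
    using \<Gamma> Q by (auto simp: canonical_def K)
  note f = 1(7) and c = 1(8,9) note a = is_frep_cells[OF f]
  have u: "u \<in> W" "tgt C f1 = tgt C u" "tgt C f2 = tgt C u" "src C u = B'" "g \<in> Mor C" "src C g = B'"
    using 1(4-6) by (auto simp: hom_def)
  note c1 = choice_cell[OF a(6) u(1,2) c(1)] and c2 = choice_cell[OF a(7) u(1,3) c(2)]
  have M: "u3 \<in> W" "u5 \<in> W" "u7 \<in> W" "u4 \<in> Mor C" "u6 \<in> Mor C" "u8 \<in> Mor C" "tgt C u3 = A3" "tgt C u5 = A3"
    "tgt C u7 = D3" "tgt C u8 = D4" "tgt C u4 = D1" "tgt C u6 = D2" "src C u3 = D3" "src C u4 = D3"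
        "src C u5 = D4"
    "src C u6 = D4" "src C u7 = D5" "src C u8 = D5"
    using 1 by (auto simp: hom_def)
  define e1 e2 e3 L where "e1 = Pcell [v1, u3] [u1, u4] \<eta>1" and "e2 = Pcell [v2, u5] [u2, u6] \<eta>2"
    and "e3 = Pcell [u3, u7] [u5, u8] \<eta>3" and "L = Pcell [h1, u4, u7] [h2, u6, u8] \<Lambda>"
  note M = M a(3-) c1(1-6) c2(1-6) u
  have e: "piso e1" "psrc e1 = [v1, u3]" "ptgt e1 = [u1, u4]" "piso e2" "psrc e2 = [v2, u5]"
      "ptgt e2 = [u2, u6]"
    "piso e3" "psrc e3 = [u3, u7]" "ptgt e3 = [u5, u8]" "pwf L" "psrc L = [h1, u4, u7]"
        "ptgt L = [h2, u6, u8]"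
    using 1 M by (simp_all add: e1_def e2_def e3_def L_def Pcell_iso Pcell_cell)
  let ?\<alpha> = "Pcell [w1, v1] [w2, v2] \<alpha>" and ?\<beta> = "Pcell [f1, v1] [f2, v2] \<beta>"
    and ?r1 = "Pcell [f1, u1] [u, h1] \<rho>1" and ?r2 = "Pcell [f2, u2] [u, h2] \<rho>2"
  note cells = a(1,2) c1(7) c2(7) e
  \<comment> \<open>One expression for both components: the \<open>w\<close>s with
    \<open>\<alpha>\<close> give the first component, the \<open>f\<close>s with
    \<open>\<beta>\<close> the cell that \<Lambda> has to match.\<close>
  define N where "N x x' c = [x'] \<rhd> (e2 \<lhd> [u8]) \<cdot> [x', v2] \<rhd> e3 \<cdot> c \<lhd> [u3, u7] \<cdot> [x] \<rhd> (piv e1 \<lhd> [u7])"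
      for x x' c
  have L: "[u] \<rhd> L = ?r2 \<lhd> [u6, u8] \<cdot> N f1 f2 ?\<beta> \<cdot> piv ?r1 \<lhd> [u4, u7]"
  proof (rule pcell_eqI)
    show "pval ([u] \<rhd> L) = pval (?r2 \<lhd> [u6, u8] \<cdot> N f1 f2 ?\<beta> \<cdot> piv ?r1 \<lhd> [u4, u7])"
      using 1(23) cells M by (simp add: N_def e1_def e2_def e3_def L_def to_pval del: psrc_pvcomp(3)
          unbr.simps)
  qed (use cells M in \<open>simp_all add: N_def\<close>)
  define a1 where "a1 = piv (pcol [w2, u2] \<lhd> [u6, u8]) \<cdot> N w1 w2 ?\<alpha> \<cdot> pcol [w1, u1] \<lhd> [u4, u7]"
  define b1 where "b1 = piv (pcol [g, h2] \<lhd> [u6, u8]) \<cdot> [g] \<rhd> L \<cdot> pcol [g, h1] \<lhd> [u4, u7]"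
  have a1: "piso a1" "psrc a1 = (w1 \<odot> u1) # [u4, u7]" "ptgt a1 = (w2 \<odot> u2) # [u6, u8]"
    using cells M by (simp_all add: a1_def N_def)
  have b1: "pwf b1" "psrc b1 = (g \<odot> h1) # [u4, u7]" "ptgt b1 = (g \<odot> h2) # [u6, u8]"
    using cells M by (simp_all add: b1_def)
  have pa: "\<mu>' = pval a1"
    unfolding 1(24,25) a1_def N_def using cells M by
        (simp add: e1_def e2_def e3_def to_pval del: psrc_pvcomp(3) unbr.simps)
  have pb: "\<nu> = pval b1"
    unfolding 1(26) b1_def using cells M by (simp add: L_def to_pval del: psrc_pvcomp(3) unbr.simps)
  obtain s where s: "Wl s" "ok (v1 # [u3, u7] @ s)" "Cmp l m P P' (v1 # [u3, u7] @ s) (v2 # [u3, u7] @ s)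
      (?\<alpha> \<lhd> ([u3, u7] @ s)) (?\<beta> \<lhd> ([u3, u7] @ s))"
    by (rule canonical_refine[OF _ f, of l m P P' "[u3, u7]"]) (use \<Gamma> M in \<open>auto simp: K 1 intro: that\<close>)
  have sn: "s \<noteq> []" "ok s" "tgt C (hd s) = D5" using s Wl_nonempty[OF s(1)] M by (auto simp: ok_Cons)
  have o8: "ok (u7 # s)" "ok (u8 # s)" using sn M by (auto simp: ok_Cons)
  have c0: "Cmp l m P P' (u1 # u4 # u7 # s) (u2 # u6 # u8 # s)
    ([w2] \<rhd> ((e2 \<lhd> [u8] \<cdot> [v2] \<rhd> e3) \<lhd> s) \<cdot> ?\<alpha> \<lhd> ([u3, u7] @ s) \<cdot> [w1] \<rhd> (piv e1 \<lhd> (u7 # s)))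
    ([f2] \<rhd> ((e2 \<lhd> [u8] \<cdot> [v2] \<rhd> e3) \<lhd> s) \<cdot> ?\<beta> \<lhd> ([u3, u7] @ s) \<cdot> [f1] \<rhd> (piv e1 \<lhd> (u7 # s)))"
    by (rule Cmp_conj[OF P s(3)]) (use cells M o8 in simp_all)
  then have c1': "Cmp l m P P' (u1 # [u4, u7] @ s) (u2 # [u6, u8] @ s) (N w1 w2 ?\<alpha> \<lhd> s) (N f1 f2 ?\<beta> \<lhd> s)"
    by (simp add: N_def)
  have c2': "Cmp (Suc m) r Q Q (h1 # [u4, u7] @ s) (h2 # [u6, u8] @ s) ([u] \<rhd> (L \<lhd> s)) ([g] \<rhd> (L \<lhd> s))"
    by (rule Cmp_whisk[OF Q']) (use cells M o8 in simp_all)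
  have sq: "?r2 \<lhd> ([u6, u8] @ s) \<cdot> (N f1 f2 ?\<beta> \<lhd> s) = [u] \<rhd> (L \<lhd> s) \<cdot> ?r1 \<lhd> ([u4, u7] @ s)"
  proof -
    have "[u] \<rhd> L \<cdot> ?r1 \<lhd> [u4, u7] = ?r2 \<lhd> [u6, u8] \<cdot> N f1 f2 ?\<beta>"
      unfolding L using cells M by (simp add: N_def)
    from arg_cong[OF this, of "\<lambda>c. c \<lhd> s"] show ?thesis by simp
  qed
  have T: "Cmp l r (glue_choice m K P G Q) (glue_choice m K' P' G Q) ([u4, u7] @ s) ([u6, u8] @ s)
      (piv (pcol [w2, u2] \<lhd> ([u6, u8] @ s)) \<cdot> (N w1 w2 ?\<alpha> \<lhd> s) \<cdot> pcol [w1, u1] \<lhd> ([u4, u7] @ s))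
      (piv (pcol [g, h2] \<lhd> ([u6, u8] @ s)) \<cdot> [g] \<rhd> (L \<lhd> s) \<cdot> pcol [g, h1] \<lhd> ([u4, u7] @ s))"
    unfolding K glue_choice_simp[OF c(1)] glue_choice_simp[OF c(2)]
    by (rule Cmp_glue[OF P(1) Q' _ _ _ _ c1(7) _ _ P(2) Q' _ _ _ _ c2(7) _ _ _ _ _ _ c1' c2' sq])
      (use M o8 in simp_all)
  have fc: "fcomp G K = (D1, w1 \<odot> u1, g \<odot> h1)" "fcomp G K' = (D2, w2 \<odot> u2, g \<odot> h2)"
    by (simp_all add: K c)
  have pp: "presents l r (D1, w1 \<odot> u1, g \<odot> h1) (glue_choice m K P G Q)"
      "presents l r (D2, w2 \<odot> u2, g \<odot> h2) (glue_choice m K' P' G Q)"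
    using presents_glue_choice[OF P(1) Q' u(2)] presents_glue_choice[OF P(2) Q' u(3)] by (simp_all add: K c)
  show ?thesis unfolding 1(3) fc
    unfolding K(1,2)[symmetric] K(3)[symmetric] fc
  proof (rule canonicalI[OF pp a1 b1, where s = s])
    have "Wl [w1, v1, u3, u7]"
      using Wl_appendL[OF a(3), of "[u3, u7]"] Wl_Cons[of u3 "[u7]"] M by simp
    then have "Wl [w1, u1, u4, u7]"
      using Wl_psrc[of "[w1] \<rhd> (piv e1 \<lhd> [u7])"] cells M by simp
    then show "Wl ((w1 \<odot> u1) # [u4, u7])"
      using Wl_psrc[of "pcol [w1, u1] \<lhd> [u4, u7]"] M by simp
    show "ok ([u4, u7] @ s)" using M o8 by simp
    show "Cmp l r (glue_choice m K P G Q) (glue_choice m K' P' G Q) ([u4, u7] @ s) ([u6, u8] @ s) (a1 \<lhd> s)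
        (b1 \<lhd> s)"
      using T M o8 by (simp add: a1_def b1_def piv_whisk)
  qed (use pa pb s M in simp_all)
qed

text \<open>Dual to the previous case: the fixed fraction contributes the comparison induced by the
  cell \<phi>, and the equation imposed on \<delta>, rearranged, is the agreement across the chosen
  squares.\<close>

lemma canonical_fwhisk_r_rel:
  assumes "fwhisk_r_rel \<Delta> K \<Omega>" and \<Delta>: "canonical (Suc m) r Q Q' G G' \<Delta>" and P: "presents l m K P"
  shows "canonical l r (glue_choice m K P G Q) (glue_choice m K P G' Q') (fcomp G K) (fcomp G' K) \<Omega>"
  using assms(1)
proof cases
  case (1 A B A' w f E B1 v1 g1 B2 v2 g2 B3 u1 u2 \<alpha> \<beta> D1 w1 f1 \<rho>1 D2 w2 f2 \<rho>2 D3 t1 D4 t2 h1 h2 \<sigma>1 \<sigma>2 D5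
      t3 t4 \<phi> \<delta> \<mu> \<xi> \<nu>)
  have K: "G = (B1, v1, g1)" "G' = (B2, v2, g2)" "K = (A', w, f)"
    using canonical_fclass \<Delta> 1 by metis+
  have Q: "presents (Suc m) r (B1, v1, g1) Q" "presents (Suc m) r (B2, v2, g2) Q'"
      and P': "presents l m (A', w, f) P"
    using \<Delta> P by (auto simp: canonical_def K)
  note ff = 1(7) and c = 1(8,9) note a = is_frep_cells[OF ff]
  have u: "w \<in> W" "f \<in> Mor C" "tgt C f = tgt C v1" "tgt C f = tgt C v2" "src C w = A'" "src C f = A'"
    using 1(4-6) by (auto simp: hom_def)
  note c1 = choice_cell[OF u(2) a(4) u(3) c(1)] and c2 = choice_cell[OF u(2) a(5) u(4) c(2)]
  have M: "t1 \<in> W" "t2 \<in> W" "t3 \<in> W" "t4 \<in> Mor C" "h1 \<in> Mor C" "h2 \<in> Mor C" "tgt C t1 = D1" "tgt C t2 = D2"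
    "tgt C h1 = B3" "tgt C h2 = B3" "tgt C t3 = D3" "tgt C t4 = D4" "src C t1 = D3" "src C h1 = D3"
        "src C t2 = D4"
    "src C h2 = D4" "src C t3 = D5" "src C t4 = D5"
    using 1 by (auto simp: hom_def)
  define s1 s2 ph d where "s1 = Pcell [f1, t1] [u1, h1] \<sigma>1" and "s2 = Pcell [f2, t2] [u2, h2] \<sigma>2"
    and "ph = Pcell [w1, t1, t3] [w2, t2, t4] \<phi>" and "d = Pcell [h1, t3] [h2, t4] \<delta>"
  note M = M a(4-) c1(1-6) c2(1-6) u(1,2,5,6)
  have e: "piso s1" "psrc s1 = [f1, t1]" "ptgt s1 = [u1, h1]" "piso s2" "psrc s2 = [f2, t2]"
      "ptgt s2 = [u2, h2]"
    "piso ph" "psrc ph = [w1, t1, t3]" "ptgt ph = [w2, t2, t4]" "piso d" "psrc d = [h1, t3]"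
        "ptgt d = [h2, t4]"
    using 1(16,17,21,22) M by (simp_all add: s1_def s2_def ph_def d_def Pcell_iso)
  let ?\<alpha> = "Pcell [v1, u1] [v2, u2] \<alpha>" and ?\<beta> = "Pcell [g1, u1] [g2, u2] \<beta>"
    and ?r1 = "Pcell [f, w1] [v1, f1] \<rho>1" and ?r2 = "Pcell [f, w2] [v2, f2] \<rho>2"
  note cells = a(1,2) c1(7) c2(7) e
  define N where "N x x' c = [x'] \<rhd> (piv s2 \<lhd> [t4]) \<cdot> c \<lhd> [h2, t4] \<cdot> [x, u1] \<rhd> d \<cdot> [x] \<rhd> (s1 \<lhd> [t3])"
      for x x' c
  have L: "[v1, u1] \<rhd> d = piv ?\<alpha> \<lhd> [h2, t4] \<cdot> [v2] \<rhd> (s2 \<lhd> [t4]) \<cdot> ?r2 \<lhd> [t2, t4] \<cdot> [f] \<rhd> ph \<cdot>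
      piv ?r1 \<lhd> [t1, t3] \<cdot> [v1] \<rhd> (piv s1 \<lhd> [t3])" (is "?l = ?r")
  proof (rule pcell_eqI)
    show "pval ?l = pval ?r"
      using 1(23) cells M by (simp add: s1_def s2_def ph_def d_def to_pval del: psrc_pvcomp(3) unbr.simps)
  qed (use cells M in simp_all)
  define a1 where "a1 = piv (pcol [w, w2] \<lhd> [t2, t4]) \<cdot> [w] \<rhd> ph \<cdot> pcol [w, w1] \<lhd> [t1, t3]"
  define b1 where "b1 = piv (pcol [g2, f2] \<lhd> [t2, t4]) \<cdot> N g1 g2 ?\<beta> \<cdot> pcol [g1, f1] \<lhd> [t1, t3]"
  have a1: "piso a1" "psrc a1 = (w \<odot> w1) # [t1, t3]" "ptgt a1 = (w \<odot> w2) # [t2, t4]"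
    using cells M by (simp_all add: a1_def)
  have b1: "pwf b1" "psrc b1 = (g1 \<odot> f1) # [t1, t3]" "ptgt b1 = (g2 \<odot> f2) # [t2, t4]"
    using cells M by (simp_all add: b1_def N_def)
  have pa: "\<mu> = pval a1"
    unfolding 1(24) a1_def using cells M by (simp add: ph_def to_pval del: psrc_pvcomp(3) unbr.simps)
  have pb: "\<nu> = pval b1"
    unfolding 1(25,26) b1_def N_def using cells M by
        (simp add: s1_def s2_def d_def to_pval del: psrc_pvcomp(3) unbr.simps)
  obtain s where s: "Wl s" "ok (u1 # [h2, t4] @ s)"
      "Cmp (Suc m) r Q Q' (u1 # [h2, t4] @ s) (u2 # [h2, t4] @ s)
      (?\<alpha> \<lhd> ([h2, t4] @ s)) (?\<beta> \<lhd> ([h2, t4] @ s))"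
    by (rule canonical_refine[OF _ ff, of "Suc m" r Q Q' "[h2, t4]"]) (use \<Delta> M in \<open>auto
        simp: K 1 intro: that\<close>)
  have sn: "s \<noteq> []" "ok s" "tgt C (hd s) = D5" using s Wl_nonempty[OF s(1)] M by (auto simp: ok_Cons)
  have o8: "ok (t3 # s)" "ok (t4 # s)" using sn M by (auto simp: ok_Cons)
  have c0: "Cmp (Suc m) r Q Q' (f1 # t1 # t3 # s) (f2 # t2 # t4 # s)
    ([v2] \<rhd> (piv s2 \<lhd> (t4 # s)) \<cdot> ?\<alpha> \<lhd> ([h2, t4] @ s) \<cdot> [v1] \<rhd> (([u1] \<rhd> d \<cdot> s1 \<lhd> [t3]) \<lhd> s))
    ([g2] \<rhd> (piv s2 \<lhd> (t4 # s)) \<cdot> ?\<beta> \<lhd> ([h2, t4] @ s) \<cdot> [g1] \<rhd> (([u1] \<rhd> d \<cdot> s1 \<lhd> [t3]) \<lhd> s))"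
    by (rule Cmp_conj[OF Q s(3)]) (use cells M o8 in simp_all)
  then have c1': "Cmp (Suc m) r Q Q' (f1 # [t1, t3] @ s) (f2 # [t2, t4] @ s) (N v1 v2 ?\<alpha> \<lhd> s) (N g1 g2 ?\<beta>
      \<lhd> s)"
    by (simp add: N_def)
  have c2': "Cmp l m P P (w1 # [t1, t3] @ s) (w2 # [t2, t4] @ s) ([w] \<rhd> (ph \<lhd> s)) ([f] \<rhd> (ph \<lhd> s))"
    by (rule Cmp_whisk[OF P']) (use cells M o8 in simp_all)
  have sq: "?r2 \<lhd> ([t2, t4] @ s) \<cdot> [f] \<rhd> (ph \<lhd> s) = (N v1 v2 ?\<alpha> \<lhd> s) \<cdot> ?r1 \<lhd> ([t1, t3] @ s)"
  proof -
    have "?r2 \<lhd> [t2, t4] \<cdot> [f] \<rhd> ph = N v1 v2 ?\<alpha> \<cdot> ?r1 \<lhd> [t1, t3]"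
      unfolding N_def L using cells M by simp
    from arg_cong[OF this, of "\<lambda>c. c \<lhd> s"] show ?thesis by simp
  qed
  have T: "Cmp l r (glue_choice m K P G Q) (glue_choice m K P G' Q') ([t1, t3] @ s) ([t2, t4] @ s)
      (piv (pcol [w, w2] \<lhd> ([t2, t4] @ s)) \<cdot> [w] \<rhd> (ph \<lhd> s) \<cdot> pcol [w, w1] \<lhd> ([t1, t3] @ s))
      (piv (pcol [g2, f2] \<lhd> ([t2, t4] @ s)) \<cdot> (N g1 g2 ?\<beta> \<lhd> s) \<cdot> pcol [g1, f1] \<lhd> ([t1, t3] @ s))"
    unfolding K glue_choice_simp[OF c(1)] glue_choice_simp[OF c(2)]
    by (rule Cmp_glue[OF P' Q(1) _ _ _ _ c1(7) _ _ P' Q(2) _ _ _ _ c2(7) _ _ _ _ _ _ c2' c1' sq])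
      (use M o8 in simp_all)
  have fc: "fcomp G K = (D1, w \<odot> w1, g1 \<odot> f1)" "fcomp G' K = (D2, w \<odot> w2, g2 \<odot> f2)"
    by (simp_all add: K c)
  have pp: "presents l r (D1, w \<odot> w1, g1 \<odot> f1) (glue_choice m K P G Q)"
      "presents l r (D2, w \<odot> w2, g2 \<odot> f2) (glue_choice m K P G' Q')"
    using presents_glue_choice[OF P' Q(1) u(3)] presents_glue_choice[OF P' Q(2) u(4)] by (simp_all add: K c)
  show ?thesis unfolding 1(3) fc
    unfolding K(1,2)[symmetric] K(3)[symmetric] fc
  proof (rule canonicalI[OF pp a1 b1, where s = s])
    have "w \<odot> w1 \<in> W" using pp(1) by simp
    moreover have "Wl [t1, t3]" using Wl_Cons[of t1 "[t3]"] M by simp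
    ultimately show "Wl ((w \<odot> w1) # [t1, t3])" using Wl_Cons[of "w \<odot> w1" "[t1, t3]"] M by simp
    show "ok ([t1, t3] @ s)" using M o8 by simp
    show "Cmp l r (glue_choice m K P G Q) (glue_choice m K P G' Q') ([t1, t3] @ s) ([t2, t4] @ s) (a1 \<lhd> s)
        (b1 \<lhd> s)"
      using T M o8 by (simp add: a1_def b1_def piv_whisk)
  qed (use pa pb s M in simp_all)
qed

lemma jct_natural:
  assumes "presents l r (X, w, k) P" "l \<le> i" "i < r"
  shows "jct P i \<lhd> ptgt \<kappa> \<cdot> (F i # leg P i) \<rhd> \<kappa> = (U (Suc i) # leg P (Suc i)) \<rhd> \<kappa> \<cdot> jct P i \<lhd> psrc \<kappa>"
  using pinterchange[of "jct P i" \<kappa>] assms by simp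

lemma ent_natural:
  assumes "presents l r (X, w, k) P"
  shows "ent P \<lhd> ptgt \<kappa> \<cdot> [w] \<rhd> \<kappa> = (U l # leg P l) \<rhd> \<kappa> \<cdot> ent P \<lhd> psrc \<kappa>"
    "ext P \<lhd> ptgt \<kappa> \<cdot> [k] \<rhd> \<kappa> = (F r # leg P r) \<rhd> \<kappa> \<cdot> ext P \<lhd> psrc \<kappa>"
    "piv (ext P) \<lhd> ptgt \<kappa> \<cdot> (F r # leg P r) \<rhd> \<kappa> = [k] \<rhd> \<kappa> \<cdot> piv (ext P) \<lhd> psrc \<kappa>"
  using pinterchange[of "ent P" \<kappa>] pinterchange[of "ext P" \<kappa>] pinterchange[of "piv (ext P)" \<kappa>] assms by
      simp_all

text \<open>The comparing cells are \<gamma>, \<omega> and \<rho>, whiskered with the legs of the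
  three presentations. The two equations required of \<omega> and \<rho> are compatibility at the
  junctions \<open>m\<close> and \<open>n\<close>; at all other indices compatibility is
  interchange.\<close>

lemma canonical_fassoc_rel:
  assumes "fassoc_rel H G K \<Omega>" and P: "presents l m K P" and Q: "presents (Suc m) n G Q"
      and R: "presents (Suc n) r H R"
  shows "canonical l r (glue_choice n (fcomp G K) (glue_choice m K P G Q) H R) (glue_choice m K P (fcomp H
      G) (glue_choice n G Q H R))
    (fcomp H (fcomp G K)) (fcomp (fcomp H G) K) \<Omega>"
  using assms(1)
proof cases
  case (1 A B A' u f E B' v g D E' w h A1 u1 f1 \<delta> A2 u2 lf \<sigma> B2 v1 g1 \<xi> A3 u3 f2 \<eta> \<sigma>' \<eta>' A4 u4 u5 \<gamma> \<omega> \<rho> \<mu> \<nu>)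
  note K = 1(3,2,1)
  note P = P[unfolded K] and Q = Q[unfolded K] and R = R[unfolded K]
  note c = 1(8-11)
  have M: "u \<in> W" "f \<in> Mor C" "src C u = A'" "src C f = A'" "v \<in> W" "g \<in> Mor C" "src C v = B'" "src C g = B'"
    "w \<in> W" "h \<in> Mor C" "src C w = E'" "src C h = E'" "tgt C f = B" "tgt C v = B" "tgt C g = E" "tgt C w = E"
    "u4 \<in> Mor C" "tgt C u4 = A2" "src C u4 = A4" "u5 \<in> Mor C" "tgt C u5 = A3" "src C u5 = A4" "A4 \<in> Ob C"
    using 1(5-7,14,16) by (auto simp: hom_def)
  have cf: "v1 \<in> W" "g1 \<in> Mor C" "tgt C v1 = B'" "tgt C g1 = E'" "src C v1 = B2" "src C g1 = B2"
      "piso (Pcell [g, v1] [w, g1] \<xi>)"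
    "u1 \<in> W" "f1 \<in> Mor C" "tgt C u1 = A'" "tgt C f1 = B'" "src C u1 = A1" "src C f1 = A1"
        "piso (Pcell [f, u1] [v, f1] \<delta>)"
    using choice_cell[OF _ _ _ c(3)] choice_cell[OF _ _ _ c(1)] M by simp_all
  have "v \<odot> v1 \<in> W" using BF2[of B2 B' v1 B v] M cf by (auto simp: hom_def)
  then have cf2: "u2 \<in> W" "lf \<in> Mor C" "tgt C u2 = A1" "tgt C lf = E'" "src C u2 = A2" "src C lf = A2"
      "piso (Pcell [g \<odot> f1, u2] [w, lf] \<sigma>)"
    "u3 \<in> W" "f2 \<in> Mor C" "tgt C u3 = A'" "tgt C f2 = B2" "src C u3 = A3" "src C f2 = A3"
        "piso (Pcell [f, u3] [v \<odot> v1, f2] \<eta>)"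
    using choice_cell[OF _ _ _ c(2)] choice_cell[OF _ _ _ c(4)] M cf by simp_all
  note M = M cf(1-6,8-13) cf2(1-6,8-13)
  let ?\<xi> = "Pcell [g, v1] [w, g1] \<xi>" and ?\<delta> = "Pcell [f, u1] [v, f1] \<delta>"
      and ?\<sigma> = "Pcell [g \<odot> f1, u2] [w, lf] \<sigma>"
    and ?\<eta> = "Pcell [f, u3] [v \<odot> v1, f2] \<eta>"
  define ga om ro where "ga = Pcell [u1, u2, u4] [u3, u5] \<gamma>" and "om = Pcell [f1, u2, u4] [v1, f2, u5] \<omega>"
    and "ro = Pcell [lf, u4] [g1, f2, u5] \<rho>"
  have e: "piso ga" "psrc ga = [u1, u2, u4]" "ptgt ga = [u3, u5]" "piso om" "psrc om = [f1, u2, u4]"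
      "ptgt om = [v1, f2, u5]"
    "piso ro" "psrc ro = [lf, u4]" "ptgt ro = [g1, f2, u5]"
    using 1(17-19) M by (simp_all add: ga_def om_def ro_def Pcell_iso)
  note cells = cf(7,14) cf2(7,14) e
  define \<sigma>p \<eta>p where "\<sigma>p = ?\<sigma> \<cdot> piv (pcol [g, f1] \<lhd> [u2])" and "\<eta>p = pcol [v, v1] \<lhd> [f2] \<cdot> ?\<eta>"
  have sp: "piso \<sigma>p" "psrc \<sigma>p = [g, f1, u2]" "ptgt \<sigma>p = [w, lf]" "piso \<eta>p" "psrc \<eta>p = [f, u3]"
      "ptgt \<eta>p = [v, v1, f2]"
    using cells M by (simp_all add: \<sigma>p_def \<eta>p_def)
  have pv: "\<sigma>' = pval \<sigma>p" "\<eta>' = pval \<eta>p"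
  proof -
    have "\<sigma> = pval ?\<sigma>" "\<eta> = pval ?\<eta>" by simp_all
    then show "\<sigma>' = pval \<sigma>p" "\<eta>' = pval \<eta>p"
      unfolding 1(12,13) \<sigma>p_def \<eta>p_def using cells M by (simp_all add: unbr_pval pval_piv del: unbr.simps)
  qed
  have Pp: "Pcell [g, f1, u2] [w, lf] \<sigma>' = \<sigma>p" "Pcell [f, u3] [v, v1, f2] \<eta>' = \<eta>p"
    using sp pv by (auto intro!: pcell_eqI)
  have L1: "[v] \<rhd> om = \<eta>p \<lhd> [u5] \<cdot> [f] \<rhd> ga \<cdot> piv ?\<delta> \<lhd> [u2, u4]" (is "?l = ?r")
  proof (rule pcell_eqI)
    show "pval ?l = pval ?r"
      using 1(20) cells sp M by (simp add: Pp ga_def om_def to_pval del: psrc_pvcomp(3) unbr.simps)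
  qed (use cells sp M in simp_all)
  have Ps: "Pcell [w, lf] [g, f1, u2] (inv2 \<sigma>') = piv \<sigma>p"
    using sp pv by (auto intro!: pcell_eqI simp: pval_piv)
  have L2: "[w] \<rhd> ro = ?\<xi> \<lhd> [f2, u5] \<cdot> [g] \<rhd> om \<cdot> piv \<sigma>p \<lhd> [u4]" (is "?l = ?r")
  proof (rule pcell_eqI)
    show "pval ?l = pval ?r"
      using 1(21) cells sp M by (simp add: Ps om_def ro_def to_pval del: psrc_pvcomp(3) unbr.simps)
  qed (use cells sp M in simp_all)
  define a1 where "a1 = piv (pcol [u, u3] \<lhd> [u5]) \<cdot> [u] \<rhd> ga \<cdot> pcol [u, u1] \<lhd> [u2, u4] \<cdot>
      pcol [u \<odot> u1, u2] \<lhd> [u4]"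
  define b1 where "b1 = piv (pcol [h \<odot> g1, f2] \<lhd> [u5]) \<cdot> piv (pcol [h, g1] \<lhd> [f2, u5]) \<cdot> [h] \<rhd> ro \<cdot>
      pcol [h, lf] \<lhd> [u4]"
  have a1: "piso a1" "psrc a1 = ((u \<odot> u1) \<odot> u2) # [u4]" "ptgt a1 = (u \<odot> u3) # [u5]"
    using cells M by (simp_all add: a1_def)
  have b1: "pwf b1" "psrc b1 = (h \<odot> lf) # [u4]" "ptgt b1 = ((h \<odot> g1) \<odot> f2) # [u5]"
    using cells M by (simp_all add: b1_def)
  have pa: "\<mu> = pval a1"
    unfolding 1(22) a1_def using cells M by (simp add: ga_def to_pval del: psrc_pvcomp(3) unbr.simps)
  have pb: "\<nu> = pval b1"
    unfolding 1(23) b1_def using cells M by (simp add: ro_def to_pval del: psrc_pvcomp(3) unbr.simps)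
  define PQ QR where "PQ = glue m P Q u g u1 f1 ?\<delta>" and "QR = glue n Q R v h v1 g1 ?\<xi>"
  define PS PT where "PS = glue n PQ R (u \<odot> u1) h u2 lf ?\<sigma>" and "PT = glue m P QR u (h \<odot> g1) u3 f2 ?\<eta>"
  have fcs: "fcomp G K = (A1, u \<odot> u1, g \<odot> f1)" "fcomp H G = (B2, v \<odot> v1, h \<odot> g1)"
    "fcomp H (fcomp G K) = (A2, (u \<odot> u1) \<odot> u2, h \<odot> lf)" "fcomp (fcomp H G) K = (A3, u \<odot> u3, (h \<odot> g1) \<odot> f2)"
    unfolding K by (simp_all add: c)
  have pts: "glue_choice n (fcomp G K) (glue_choice m K P G Q) H R = PS"
      "glue_choice m K P (fcomp H G) (glue_choice n G Q H R) = PT"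
    unfolding fcs unfolding K by (simp_all add: glue_choice_simp[OF c(1)] glue_choice_simp[OF c(2)]
        glue_choice_simp[OF c(3)] glue_choice_simp[OF c(4)]
        PQ_def QR_def PS_def PT_def)
  have pPQ: "presents l n (A1, u \<odot> u1, g \<odot> f1) PQ"
    unfolding PQ_def by (rule presents_glue[OF P Q]) (use cells M in simp_all)
  have pQR: "presents (Suc m) r (B2, v \<odot> v1, h \<odot> g1) QR"
    unfolding QR_def by (rule presents_glue[OF Q R]) (use cells M in simp_all)
  have pPS: "presents l r (A2, (u \<odot> u1) \<odot> u2, h \<odot> lf) PS"
    unfolding PS_def by (rule presents_glue[OF pPQ R]) (use cells M in simp_all)
  have pPT: "presents l r (A3, u \<odot> u3, (h \<odot> g1) \<odot> f2) PT"
    unfolding PT_def by (rule presents_glue[OF P pQR]) (use cells M in simp_all)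
  have lmn: "l \<le> m" "m < n" "n < r" using P Q R by auto
  have xP: "piso (ext P)" "psrc (ext P) = [f]" "ptgt (ext P) = F m # leg P m"
    "piso (ext Q)" "psrc (ext Q) = [g]" "ptgt (ext Q) = F n # leg Q n"
    using P Q by auto
  define x where "x i = (if i \<le> m then leg P i \<rhd> ga else if i \<le> n then leg Q i \<rhd> om else leg R i \<rhd> ro)" for i
  have oP: "ok (leg P i @ psrc ga)" if "l \<le> i" "i \<le> m" for i
    using leg_okD(1)[of A' i "leg P i" "psrc ga"] that P e M by auto
  have oQ: "ok (leg Q i @ psrc om)" if "m < i" "i \<le> n" for i
    using leg_okD(1)[of B' i "leg Q i" "psrc om"] that Q e M by auto
  have oR: "ok (leg R i @ psrc ro)" if "n < i" "i \<le> r" for i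
    using leg_okD(1)[of E' i "leg R i" "psrc ro"] that R e M by auto
  have J1: "jct PT i \<lhd> [u5] \<cdot> [F i] \<rhd> x i = [U (Suc i)] \<rhd> x (Suc i) \<cdot> jct PS i \<lhd> [u4]" if i: "l \<le> i"
      "i < m" for i
    using jct_natural[OF P i, of ga] i lmn e by (simp add: x_def PT_def PS_def PQ_def glue_def)
  have J2: "jct PT i \<lhd> [u5] \<cdot> [F i] \<rhd> x i = [U (Suc i)] \<rhd> x (Suc i) \<cdot> jct PS i \<lhd> [u4]" if i: "m < i"
      "i < n" for i
    using jct_natural[OF Q _ i(2), of om] i lmn e by (simp add: x_def PT_def PS_def PQ_def QR_def glue_def)
  have J3: "jct PT i \<lhd> [u5] \<cdot> [F i] \<rhd> x i = [U (Suc i)] \<rhd> x (Suc i) \<cdot> jct PS i \<lhd> [u4]" if i: "n < i"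
      "i < r" for i
    using jct_natural[OF R _ i(2), of ro] i lmn e by (simp add: x_def PT_def PS_def PQ_def QR_def glue_def)
  have J4: "jct PT m \<lhd> [u5] \<cdot> [F m] \<rhd> x m = [U (Suc m)] \<rhd> x (Suc m) \<cdot> jct PS m \<lhd> [u4]"
  proof -
    have 1: "\<eta>p \<lhd> [u5] \<cdot> [f] \<rhd> ga = [v] \<rhd> om \<cdot> ?\<delta> \<lhd> [u2, u4]"
      unfolding L1 using cells sp M by simp
    have 2: "piv (ext P) \<lhd> [u3, u5] \<cdot> (F m # leg P m) \<rhd> ga = [f] \<rhd> ga \<cdot> piv (ext P) \<lhd> [u1, u2, u4]"
      using ent_natural(3)[OF P, of ga] e by simp
    have 3: "ent Q \<lhd> [v1, f2, u5] \<cdot> [v] \<rhd> om = (U (Suc m) # leg Q (Suc m)) \<rhd> om \<cdot> ent Q \<lhd> [f1, u2, u4]"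
      using ent_natural(1)[OF Q, of om] e by simp
    have "jct PT m \<lhd> [u5] \<cdot> [F m] \<rhd> x m =
        ent Q \<lhd> [v1, f2, u5] \<cdot> \<eta>p \<lhd> [u5] \<cdot> piv (ext P) \<lhd> [u3, u5] \<cdot> (F m # leg P m) \<rhd> ga"
      using lmn by (simp add: x_def PT_def QR_def glue_def \<eta>p_def)
    also have "\<dots> = ent Q \<lhd> [v1, f2, u5] \<cdot> (\<eta>p \<lhd> [u5] \<cdot> [f] \<rhd> ga) \<cdot> piv (ext P) \<lhd> [u1, u2, u4]"
      unfolding 2 by simp
    also have "\<dots> = (ent Q \<lhd> [v1, f2, u5] \<cdot> [v] \<rhd> om) \<cdot> ?\<delta> \<lhd> [u2, u4] \<cdot> piv (ext P) \<lhd> [u1, u2, u4]"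
      unfolding 1 by simp
    also have "\<dots> = [U (Suc m)] \<rhd> x (Suc m) \<cdot> jct PS m \<lhd> [u4]"
      unfolding 3 using lmn by (simp add: x_def PS_def PQ_def glue_def)
    finally show ?thesis .
  qed
  have J5: "jct PT n \<lhd> [u5] \<cdot> [F n] \<rhd> x n = [U (Suc n)] \<rhd> x (Suc n) \<cdot> jct PS n \<lhd> [u4]"
  proof -
    have 1: "?\<xi> \<lhd> [f2, u5] \<cdot> [g] \<rhd> om = [w] \<rhd> ro \<cdot> \<sigma>p \<lhd> [u4]"
      unfolding L2 using cells sp M by simp
    have 2: "piv (ext Q) \<lhd> [v1, f2, u5] \<cdot> (F n # leg Q n) \<rhd> om = [g] \<rhd> om \<cdot> piv (ext Q) \<lhd> [f1, u2, u4]"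
      using ent_natural(3)[OF Q, of om] e by simp
    have 3: "ent R \<lhd> [g1, f2, u5] \<cdot> [w] \<rhd> ro = (U (Suc n) # leg R (Suc n)) \<rhd> ro \<cdot> ent R \<lhd> [lf, u4]"
      using ent_natural(1)[OF R, of ro] e by simp
    \<comment> \<open>The exit of \<open>PQ\<close> contains a rebracketing, namely the one by which
      \<open>\<sigma>p\<close> differs from the chosen square \<open>?\<sigma>\<close>.\<close>
    have 4: "piv (ext Q \<lhd> [f1] \<cdot> pcol [g, f1]) \<lhd> [u2] = piv (pcol [g, f1] \<lhd> [u2]) \<cdot> piv (ext Q) \<lhd> [f1, u2]"
      using xP M by (simp add: piv_pvcomp piv_whisk)
    have "jct PT n \<lhd> [u5] \<cdot> [F n] \<rhd> x n =
        ent R \<lhd> [g1, f2, u5] \<cdot> ?\<xi> \<lhd> [f2, u5] \<cdot> piv (ext Q) \<lhd> [v1, f2, u5] \<cdot> (F n # leg Q n) \<rhd> om"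
      using lmn by (simp add: x_def PT_def QR_def glue_def)
    also have "\<dots> = ent R \<lhd> [g1, f2, u5] \<cdot> (?\<xi> \<lhd> [f2, u5] \<cdot> [g] \<rhd> om) \<cdot> piv (ext Q) \<lhd> [f1, u2, u4]"
      unfolding 2 by simp
    also have "\<dots> = (ent R \<lhd> [g1, f2, u5] \<cdot> [w] \<rhd> ro) \<cdot> (?\<sigma> \<cdot> piv (pcol [g, f1] \<lhd> [u2]) \<cdot>
        piv (ext Q) \<lhd> [f1, u2]) \<lhd> [u4]"
      unfolding 1 by (simp add: \<sigma>p_def)
    also have "\<dots> = [U (Suc n)] \<rhd> x (Suc n) \<cdot> jct PS n \<lhd> [u4]"
      unfolding 3 4[symmetric] using lmn by (simp add: x_def PS_def PQ_def glue_def)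
    finally show ?thesis .
  qed
  have cmp: "compat l r PS PT [u4] [u5] x"
    unfolding compat_def
  proof (intro conjI allI impI; (elim conjE)?)
    fix i assume i: "l \<le> i" "i < r"
    consider "i < m" | "i = m" | "m < i" "i < n" | "i = n" | "n < i" by linarith
    then show "jct PT i \<lhd> [u5] \<cdot> [F i] \<rhd> x i = [U (Suc i)] \<rhd> x (Suc i) \<cdot> jct PS i \<lhd> [u4]"
      using i J1 J2 J3 J4 J5 by cases auto
  next
    fix i assume i: "l \<le> i" "i \<le> r"
    consider "i \<le> m" | "m < i" "i \<le> n" | "n < i" by linarith
    note case3 = this
    show "pwf (x i)" using i oP[of i] oQ[of i] oR[of i] e lmn case3 by (auto simp: x_def)
    show "psrc (x i) = leg PS i @ [u4]" "ptgt (x i) = leg PT i @ [u5]"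
      using i oP[of i] oQ[of i] oR[of i] e lmn case3 by (auto
          simp: x_def PS_def PT_def PQ_def QR_def glue_def)
  qed
  have o4: "ok [u, u3, u5]" "ok [h \<odot> g1, f2, u5]" "ok [h, g1, f2, u5]" using M by auto
  have "ent PT \<lhd> [u5] \<cdot> a1 = [U l] \<rhd> x l \<cdot> ent PS \<lhd> [u4]"
  proof -
    have "ent P \<lhd> [u3, u5] \<cdot> [u] \<rhd> ga = (U l # leg P l) \<rhd> ga \<cdot> ent P \<lhd> [u1, u2, u4]"
      using ent_natural(1)[OF P, of ga] e by simp
    from pvcomp_reassoc[OF this, of "pcol [u, u1] \<lhd> [u2, u4] \<cdot> pcol [u \<odot> u1, u2] \<lhd> [u4]"]
    show ?thesis using cells M lmn
      by (simp add: a1_def x_def PS_def PT_def PQ_def glue_def piv_whisk)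
  qed
  moreover have "ext PT \<lhd> [u5] \<cdot> b1 = [F r] \<rhd> x r \<cdot> ext PS \<lhd> [u4]"
  proof -
    have "ext R \<lhd> [g1, f2, u5] \<cdot> [h] \<rhd> ro = (F r # leg R r) \<rhd> ro \<cdot> ext R \<lhd> [lf, u4]"
      using ent_natural(2)[OF R, of ro] e by simp
    from pvcomp_reassoc[OF this, of "pcol [h, lf] \<lhd> [u4]"]
    show ?thesis using cells M lmn
      by (simp add: b1_def x_def PS_def PT_def QR_def glue_def piv_whisk)
  qed
  ultimately have T: "Cmp l r PS PT [u4] [u5] a1 b1"
    using cmp unfolding Cmp_def by blast
  \<comment> \<open>The comparison holds without refinement; \<open>canonicalI\<close> asks for a
    nonempty one, so an identity is taken.\<close>
  let ?i = "id1 C A4"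
  have i: "?i \<in> W" "src C ?i = A4" "tgt C ?i = A4" using M BF1 by auto
  have "\<Omega> = fclass (fcomp H (fcomp G K)) (fcomp (fcomp H G) K) (A4, u4, u5, \<mu>, \<nu>)"
    unfolding K by (rule 1(4))
  then have \<Omega>: "\<Omega> = fclass (A2, (u \<odot> u1) \<odot> u2, h \<odot> lf) (A3, u \<odot> u3, (h \<odot> g1) \<odot> f2) (A4, u4, u5, \<mu>, \<nu>)"
    unfolding fcs(3,4) .
  show ?thesis unfolding pts fcs(3,4) \<Omega>
  proof (rule canonicalI[OF pPS pPT a1 b1, where s = "[?i]"])
    have "ok [u, u1, u2, u4]" using M by simp
    then have "Wl [u, u1, u2, u4]" using 1(15) by (simp add: Wl_def)
    then have "Wl [u \<odot> u1, u2, u4]" using Wl_psrc[of "pcol [u, u1] \<lhd> [u2, u4]"] M by simp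
    then show "Wl (((u \<odot> u1) \<odot> u2) # [u4])" using Wl_psrc[of "pcol [u \<odot> u1, u2] \<lhd> [u4]"] M by simp
    show "Cmp l r PS PT ([u4] @ [?i]) ([u5] @ [?i]) (a1 \<lhd> [?i]) (b1 \<lhd> [?i])"
      by (rule Cmp_pull[OF T pPS]) (use M i in simp_all)
  qed (use pa pb i M in simp_all)
qed

text \<open>A presentation over a single index: the legs are identities, hence empty, and there are
  no junctions, so \<open>bad\<close> is only a placeholder.\<close>

definition base_pres :: "('m, 'c) pcell \<Rightarrow> ('m, 'c) pcell \<Rightarrow> ('m, 'c) presentation" where
  "base_pres a b = \<lparr>leg = (\<lambda>_. []), jct = (\<lambda>_. bad), ent = a, ext = b\<rparr>"

lemma presents_base:
  assumes "piso a" "psrc a = [w]" "ptgt a = [U i]" "piso b" "psrc b = [k]" "ptgt b = [F i]" "w \<in> W"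
  shows "presents i i (src C (U i), w, k) (base_pres a b)"
  using assms pwf_parallel[OF piso_pwf[OF assms(1)] assms(2,3)] pwf_parallel[OF piso_pwf[OF assms(4)]
      assms(5,6)]
    pwf_ok[of b] by (auto simp: base_pres_def leg_ok_def)

text \<open>Two identifications of triples with the same span differ by
  \<open>piv a' \<cdot> a\<close> and \<open>piv b' \<cdot> b\<close>. All legs being empty, the
  comparing cell is an identity. The whiskering by \<open>x\<close> matches the representatives of
  \<open>chi\<close> and of identities, whose legs are identity 1-morphisms.\<close>

lemma canonical_base:
  assumes P: "presents i i (X, w, k) (base_pres a b)" "presents i i (X, w', k') (base_pres a' b')"
    and r: "x = id1 C X" "\<alpha> = pval ((piv a' \<cdot> a) \<lhd> [x])" "\<beta> = pval ((piv b' \<cdot> b) \<lhd> [x])"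
  shows "canonical i i (base_pres a b) (base_pres a' b') (X, w, k) (X, w', k') (fclass (X, w, k) (X, w',
      k') (X, x, x, \<alpha>, \<beta>))"
proof -
  have p: "w \<in> W" "k \<in> Mor C" "src C w = X" "src C k = X" "w' \<in> W" "k' \<in> Mor C" "src C w' = X" "src C k' = X"
    "piso a" "psrc a = [w]" "ptgt a = [U i]" "piso b" "psrc b = [k]" "ptgt b = [F i]"
    "piso a'" "psrc a' = [w']" "ptgt a' = [U i]" "piso b'" "psrc b' = [k']" "ptgt b' = [F i]" "leg_ok X i []"
    using P by (auto simp: base_pres_def)
  have X: "X \<in> Ob C" using p by auto
  have x: "x \<in> W" "src C x = X" "tgt C x = X" using X BF1 by (auto simp: r)
  have U: "src C (U i) = X" using p by (simp add: leg_ok_def)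
  let ?a = "(piv a' \<cdot> a) \<lhd> [x]" and ?b = "(piv b' \<cdot> b) \<lhd> [x]"
  have a: "piso ?a" "psrc ?a = w # [x]" "ptgt ?a = w' # [x]" "pwf ?b" "psrc ?b = k # [x]" "ptgt ?b = k' # [x]"
    using p x U by (simp_all del: prwhisk_pvcomp)
  show ?thesis
  proof (rule canonicalI[OF P a, where s = "[x]"])
    show "Wl (w # [x])" using Wl_Cons[of w "[x]"] p x by simp
    show "Cmp i i (base_pres a b) (base_pres a' b') ([x] @ [x]) ([x] @ [x]) (?a \<lhd> [x]) (?b \<lhd> [x])"
      unfolding Cmp_def compat_def
      by (rule exI[of _ "\<lambda>_. pid [x, x]"]) (use p x U in \<open>auto simp: base_pres_def\<close>)
  qed (use x r in simp_all)
qed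

text \<open>The comparing cell need not be invertible, but it is so after refinement because
  \<open>\<phi>\<close> is invertible.\<close>

lemma Cmp_cancel:
  assumes P: "presents i i (X, w, k) P" "presents i i (X', w', k') P'" "presents i i (X'', w'', k'') P''"
    and q: "ok q" "tgt C (hd q) = X" "ok q'" "tgt C (hd q') = X'" "ok q''" "tgt C (hd q'') = X''"
    and c: "Cmp i i P P' q q' \<phi> \<beta>" "Cmp i i P P'' q q'' (\<phi>' \<cdot> \<phi>) (\<beta>' \<cdot> \<beta>)" and iso: "piso \<phi>"
  obtains s where "Wl s" "ok (q' @ s)" "Cmp i i P' P'' (q' @ s) (q'' @ s) (\<phi>' \<lhd> s) (\<beta>' \<lhd> s)"
proof -
  obtain \<xi> where x: "pwf (\<xi> i)" "psrc (\<xi> i) = leg P i @ q" "ptgt (\<xi> i) = leg P' i @ q'"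
    "ent P' \<lhd> q' \<cdot> \<phi> = [U i] \<rhd> \<xi> i \<cdot> ent P \<lhd> q" "ext P' \<lhd> q' \<cdot> \<beta> = [F i] \<rhd> \<xi> i \<cdot> ext P \<lhd> q"
    using c(1) by (auto simp: Cmp_def compat_def)
  obtain \<zeta> where y: "pwf (\<zeta> i)" "psrc (\<zeta> i) = leg P i @ q" "ptgt (\<zeta> i) = leg P'' i @ q''"
    "ent P'' \<lhd> q'' \<cdot> \<phi>' \<cdot> \<phi> = [U i] \<rhd> \<zeta> i \<cdot> ent P \<lhd> q" "ext P'' \<lhd> q'' \<cdot> \<beta>' \<cdot> \<beta> = [F i] \<rhd> \<zeta> i \<cdot> ext P \<lhd> q"
    using c(2) by (auto simp: Cmp_def compat_def)
  have T: "pwf \<phi>" "pwf \<beta>" "psrc \<phi> = w # q" "ptgt \<phi> = w' # q'" "psrc \<beta> = k # q" "ptgt \<beta> = k' # q'"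
    using Cmp_simps[OF P(1,2) c(1) q(1,3,2,4)] by auto
  have T': "pwf (\<phi>' \<cdot> \<phi>)" "pwf (\<beta>' \<cdot> \<beta>)" "ptgt (\<phi>' \<cdot> \<phi>) = w'' # q''" "ptgt (\<beta>' \<cdot> \<beta>) = k'' # q''"
    using Cmp_simps[OF P(1,3) c(2) q(1,5,2,6)] by auto
  have t: "pwf \<phi>'" "pwf \<beta>'" "psrc \<phi>' = w' # q'" "psrc \<beta>' = k' # q'" "ptgt \<phi>' = w'' # q''"
      "ptgt \<beta>' = k'' # q''"
    using T T' by auto
  have p: "piso (ent P)" "psrc (ent P) = [w]" "ptgt (ent P) = U i # leg P i" "piso (ext P)"
      "psrc (ext P) = [k]" "ptgt (ext P) = F i # leg P i"
    "piso (ent P')" "psrc (ent P') = [w']" "ptgt (ent P') = U i # leg P' i" "piso (ext P')"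
        "psrc (ext P') = [k']" "ptgt (ext P') = F i # leg P' i"
    "piso (ent P'')" "psrc (ent P'') = [w'']" "ptgt (ent P'') = U i # leg P'' i" "piso (ext P'')"
        "psrc (ext P'') = [k'']" "ptgt (ext P'') = F i # leg P'' i"
    "leg_ok X i (leg P i)" "leg_ok X' i (leg P' i)" "leg_ok X'' i (leg P'' i)"
    using P by auto
  note o = leg_okD[OF p(19) q(1,2)] leg_okD[OF p(20) q(3,4)] leg_okD[OF p(21) q(5,6)]
  have ok: "ok (w # q)" "ok (k # q)" "ok (w' # q')" "ok (k' # q')" "ok (w'' # q'')" "ok (k'' # q'')"
    using pwf_ok[OF T(1)] pwf_ok[OF T(2)] T pwf_ok[OF t(1)] pwf_ok[OF t(2)] t by auto
  have "[U i] \<rhd> \<xi> i = ent P' \<lhd> q' \<cdot> \<phi> \<cdot> piv (ent P) \<lhd> q"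
  proof -
    have "ent P' \<lhd> q' \<cdot> \<phi> \<cdot> piv (ent P) \<lhd> q = (ent P' \<lhd> q' \<cdot> \<phi>) \<cdot> piv (ent P) \<lhd> q" by simp
    also have "\<dots> = [U i] \<rhd> \<xi> i" unfolding x(4) using p o ok x by simp
    finally show ?thesis by simp
  qed
  then have "piso ([U i] \<rhd> \<xi> i)" using p ok o iso T by simp
  then obtain s where s: "Wl s" "ok (psrc (\<xi> i) @ s)" "piso (\<xi> i \<lhd> s)"
    using W_reflects_iso[of "[U i]" "\<xi> i"] U_W x by auto
  have sn: "s \<noteq> []" using s Wl_nonempty by blast
  have qn: "q \<noteq> []" "q' \<noteq> []" "q'' \<noteq> []" using q by auto
  have os: "ok (q @ s)" using s(2) ok_appendD2[of "leg P i" "q @ s"] x qn by simp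
  have os': "ok (q' @ s)" "ok (q'' @ s)"
    using ok_ptgt_prwhisk[OF T(1), of s] ok_ptgt_prwhisk[OF t(1), of s] T t os ok qn by (auto simp: ok_Cons)
  have hs: "tgt C (hd (q @ s)) = X" "tgt C (hd (q' @ s)) = X'" "tgt C (hd (q'' @ s)) = X''" using q qn by auto
  note o' = leg_okD[OF p(19) os hs(1)] leg_okD[OF p(20) os'(1) hs(2)] leg_okD[OF p(21) os'(2) hs(3)]
  have ok': "ok (w # q @ s)" "ok (k # q @ s)" "ok (w' # q' @ s)" "ok (k' # q' @ s)" "ok (w'' # q'' @ s)"
      "ok (k'' # q'' @ s)"
    using ok os os' qn by (auto simp: ok_Cons)
  have xs: "psrc (\<xi> i \<lhd> s) = leg P i @ q @ s" "ptgt (\<xi> i \<lhd> s) = leg P' i @ q' @ s" using x s by simp_all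
  have ys: "pwf (\<zeta> i \<lhd> s)" "psrc (\<zeta> i \<lhd> s) = leg P i @ q @ s" "ptgt (\<zeta> i \<lhd> s) = leg P'' i @ q'' @ s"
    using x y s by simp_all
  \<comment> \<open>The comparison for the remaining factor is the quotient of the two given ones,
    defined once \<open>\<xi> i\<close> has become invertible.\<close>
  define \<chi> where "\<chi> = \<zeta> i \<lhd> s \<cdot> piv (\<xi> i \<lhd> s)"
  have chi: "pwf \<chi>" "psrc \<chi> = leg P' i @ q' @ s" "ptgt \<chi> = leg P'' i @ q'' @ s" "\<chi> \<cdot> \<xi> i \<lhd> s = \<zeta> i \<lhd> s"
    using s xs ys by (simp_all add: \<chi>_def del: pwf_prwhisk)
  have e1: "ent P' \<lhd> (q' @ s) \<cdot> \<phi> \<lhd> s = [U i] \<rhd> (\<xi> i \<lhd> s) \<cdot> ent P \<lhd> (q @ s)"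
    "ext P' \<lhd> (q' @ s) \<cdot> \<beta> \<lhd> s = [F i] \<rhd> (\<xi> i \<lhd> s) \<cdot> ext P \<lhd> (q @ s)"
    "ent P'' \<lhd> (q'' @ s) \<cdot> \<phi>' \<lhd> s \<cdot> \<phi> \<lhd> s = [U i] \<rhd> (\<zeta> i \<lhd> s) \<cdot> ent P \<lhd> (q @ s)"
    "ext P'' \<lhd> (q'' @ s) \<cdot> \<beta>' \<lhd> s \<cdot> \<beta> \<lhd> s = [F i] \<rhd> (\<zeta> i \<lhd> s) \<cdot> ext P \<lhd> (q @ s)"
    using arg_cong[OF x(4), of "\<lambda>c. c \<lhd> s"] arg_cong[OF x(5), of "\<lambda>c. c \<lhd> s"]
      arg_cong[OF y(4), of "\<lambda>c. c \<lhd> s"] arg_cong[OF y(5), of "\<lambda>c. c \<lhd> s"] by simp_all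
  have "piso (\<phi> \<lhd> s)" using iso T ok' by simp
  moreover have "piso (\<beta> \<lhd> s)"
  proof -
    have "\<beta> \<lhd> s = piv (ext P') \<lhd> (q' @ s) \<cdot> ext P' \<lhd> (q' @ s) \<cdot> \<beta> \<lhd> s"
      using p T ok' by simp
    then have "\<beta> \<lhd> s = piv (ext P') \<lhd> (q' @ s) \<cdot> [F i] \<rhd> (\<xi> i \<lhd> s) \<cdot> ext P \<lhd> (q @ s)"
      unfolding e1(2) .
    moreover have "piso ([F i] \<rhd> (\<xi> i \<lhd> s))" using piso_whisk(1)[OF s(3), of "[F i]"] xs o' by simp
    moreover have "psrc ([F i] \<rhd> (\<xi> i \<lhd> s)) = F i # leg P i @ q @ s"
        "ptgt ([F i] \<rhd> (\<xi> i \<lhd> s)) = F i # leg P' i @ q' @ s"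
      using x s o' by simp_all
    ultimately show ?thesis using p o' ok' x(1-3) s(2) by simp
  qed
  ultimately have i: "piso (\<phi> \<lhd> s)" "piso (\<beta> \<lhd> s)" by simp_all
  have E1: "ent P'' \<lhd> (q'' @ s) \<cdot> \<phi>' \<lhd> s = [U i] \<rhd> \<chi> \<cdot> ent P' \<lhd> (q' @ s)"
  proof (rule piso_epi[OF i(1)])
    have "([U i] \<rhd> \<chi> \<cdot> ent P' \<lhd> (q' @ s)) \<cdot> \<phi> \<lhd> s = [U i] \<rhd> (\<chi> \<cdot> \<xi> i \<lhd> s) \<cdot> ent P \<lhd> (q @ s)"
      using e1(1) by simp
    then show "(ent P'' \<lhd> (q'' @ s) \<cdot> \<phi>' \<lhd> s) \<cdot> \<phi> \<lhd> s = ([U i] \<rhd> \<chi> \<cdot> ent P' \<lhd> (q' @ s)) \<cdot> \<phi> \<lhd> s"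
      unfolding chi(4) using e1(3) by simp
  qed (use p T t chi o' ok' in simp_all)
  have E2: "ext P'' \<lhd> (q'' @ s) \<cdot> \<beta>' \<lhd> s = [F i] \<rhd> \<chi> \<cdot> ext P' \<lhd> (q' @ s)"
  proof (rule piso_epi[OF i(2)])
    have "([F i] \<rhd> \<chi> \<cdot> ext P' \<lhd> (q' @ s)) \<cdot> \<beta> \<lhd> s = [F i] \<rhd> (\<chi> \<cdot> \<xi> i \<lhd> s) \<cdot> ext P \<lhd> (q @ s)"
      using e1(2) by simp
    then show "(ext P'' \<lhd> (q'' @ s) \<cdot> \<beta>' \<lhd> s) \<cdot> \<beta> \<lhd> s = ([F i] \<rhd> \<chi> \<cdot> ext P' \<lhd> (q' @ s)) \<cdot> \<beta> \<lhd> s"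
      unfolding chi(4) using e1(4) by simp
  qed (use p T t chi o' ok' in simp_all)
  have "Cmp i i P' P'' (q' @ s) (q'' @ s) (\<phi>' \<lhd> s) (\<beta>' \<lhd> s)"
    unfolding Cmp_def compat_def using E1 E2 chi by (intro exI[of _ "\<lambda>_. \<chi>"]) auto
  then show ?thesis using that s os' by blast
qed

lemma canonical_is_fcell: "canonical l r P P' K K' \<Gamma> \<Longrightarrow> is_fcell K K' \<Gamma>"
  unfolding canonical_def is_fcell_def by blast

text \<open>Makes the inverse of a canonical 2-morphism canonical, without associativity of the
  vertical composition.\<close>

lemma canonical_cancel:
  assumes \<Gamma>: "canonical i i P P' K K' \<Gamma>" and P'': "presents i i K'' P''" and \<Delta>: "is_fcell K' K'' \<Delta>"
    and e: "canonical i i P P'' K K'' (fvcomp \<Delta> \<Gamma>)"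
  shows "canonical i i P' P'' K' K'' \<Delta>"
proof -
  have "is_fcell K K' \<Gamma>" using \<Gamma> by (rule canonical_is_fcell)
  then have "fvcomp_rel \<Gamma> \<Delta> (fvcomp \<Delta> \<Gamma>)"
    unfolding fvcomp_def using fvcomp_rel_exists[OF _ \<Delta>] someI_ex by metis
  then show ?thesis
  proof cases
    case (1 A1 w1 f1 A2 w2 f2 A4 u1 u2 \<alpha>1 \<beta>1 A3 w3 f3 A5 u3 u4 \<alpha>2 \<beta>2 D t1 t2 \<rho> \<alpha> \<beta>)
    have K: "K = (A1, w1, f1)" "K' = (A2, w2, f2)"
      using canonical_fclass \<Gamma> 1 by metis+
    have K'': "K'' = (A3, w3, f3)" using canonical_fclass(2)[of i i P P'' K K''] e unfolding 1(3) by metis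
    have P: "presents i i (A1, w1, f1) P" "presents i i (A2, w2, f2) P'" "presents i i (A3, w3, f3) P''"
      using \<Gamma> P'' by (auto simp: canonical_def K K'')
    note f = 1(4,5) note a = is_frep_cells[OF f(1)] and b = is_frep_cells[OF f(2)]
    have t: "t1 \<in> W" "t2 \<in> Mor C" "tgt C t1 = A4" "tgt C t2 = A5" "src C t1 = D" "src C t2 = D"
      using 1(6-8) by (auto simp: hom_def)
    define \<rho>' where "\<rho>' = Pcell [u2, t1] [u3, t2] \<rho>"
    have o: "ok [u1, t1]" "ok [u2, t1]" "ok [u3, t2]" "ok [u4, t2]" using a b t by auto
    have \<rho>': "piso \<rho>'" "psrc \<rho>' = [u2, t1]" "ptgt \<rho>' = [u3, t2]"
      using 1(9) o by (auto simp: \<rho>'_def Pcell_iso)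
    let ?\<alpha>1 = "Pcell [w1, u1] [w2, u2] \<alpha>1" and ?\<beta>1 = "Pcell [f1, u1] [f2, u2] \<beta>1"
      and ?\<alpha>2 = "Pcell [w2, u3] [w3, u4] \<alpha>2" and ?\<beta>2 = "Pcell [f2, u3] [f3, u4] \<beta>2"
    define A where "A = ?\<alpha>2 \<lhd> [t2] \<cdot> [w2] \<rhd> \<rho>' \<cdot> ?\<alpha>1 \<lhd> [t1]"
    define B where "B = ?\<beta>2 \<lhd> [t2] \<cdot> [f2] \<rhd> \<rho>' \<cdot> ?\<beta>1 \<lhd> [t1]"
    have A: "piso A" "psrc A = w1 # [u1, t1]" "ptgt A = w3 # [u4, t2]" using a b t \<rho>' by (auto simp: A_def)
    have B: "pwf B" "psrc B = f1 # [u1, t1]" "ptgt B = f3 # [u4, t2]" using a b t \<rho>' by (auto simp: B_def)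
    have pA: "\<alpha> = pval A" "\<beta> = pval B"
      using a b t \<rho>' unfolding 1(10,11) A_def B_def by (simp_all add: whisk_pval \<rho>'_def)
    have W1: "Wl (w1 # [u1, t1])" using Wl_appendL[OF a(3), of "[t1]"] t a by simp
    have hK: "is_fmor (tgt C w1) (tgt C f1) (A1, w1, f1)" "is_fmor (tgt C w1) (tgt C f1) (A3, w3, f3)"
      using a b by (auto simp: hom_def)
    have fr: "is_frep (A1, w1, f1) (A3, w3, f3) (D, u1 \<odot> t1, u4 \<odot> t2, \<alpha>, \<beta>)"
      using is_frep_pval[OF hK A B W1] t pA by simp
    have rA: "Pcell [w1, u1 \<odot> t1] [w3, u4 \<odot> t2] \<alpha> = [w3] \<rhd> piv (pcol [u4, t2]) \<cdot> A \<cdot> [w1] \<rhd> pcol [u1, t1]"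
      "Pcell [f1, u1 \<odot> t1] [f3, u4 \<odot> t2] \<beta> = [f3] \<rhd> piv (pcol [u4, t2]) \<cdot> B \<cdot> [f1] \<rhd> pcol [u1, t1]"
      using Pcell_rebracket[OF piso_pwf[OF A(1)] A(2,3)] Pcell_rebracket[OF B] pA by simp_all
    obtain s where s: "Wl s" "ok (u1 # [t1] @ s)" "Cmp i i P P' (u1 # [t1] @ s) (u2 # [t1] @ s) (?\<alpha>1 \<lhd>
        ([t1] @ s)) (?\<beta>1 \<lhd> ([t1] @ s))"
      using canonical_refine[OF _ f(1), of i i P P' "[t1]"] \<Gamma> o unfolding K 1 by auto
    have sn: "s \<noteq> []" "ok s" "tgt C (hd s) = D" using s Wl_nonempty[OF s(1)] t by (auto simp: ok_Cons)
    obtain s' where s': "Wl s'" "ok ((u1 \<odot> t1) # s @ s')"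
        "Cmp i i P P'' ((u1 \<odot> t1) # s @ s') ((u4 \<odot> t2) # s @ s')
        (Pcell [w1, u1 \<odot> t1] [w3, u4 \<odot> t2] \<alpha> \<lhd> (s @ s')) (Pcell [f1, u1 \<odot> t1] [f3, u4 \<odot> t2] \<beta> \<lhd> (s @ s'))"
      by (rule canonical_refine[OF _ fr, of i i P P'' s])
        (use e sn t a that in \<open>simp_all add: K K'' 1(3) ok_Cons\<close>)
    let ?s = "s @ s'"
    have s'n: "?s \<noteq> []" "ok ?s" "tgt C (hd ?s) = D" using s'(2) sn by (auto simp: ok_Cons)
    have oS: "ok (u1 # t1 # ?s)" "ok (u2 # t1 # ?s)" "ok (u3 # t2 # ?s)" "ok (u4 # t2 # ?s)"
        "ok ((u4 \<odot> t2) # ?s)" "ok ((u1 \<odot> t1) # ?s)"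
      "ok (t1 # ?s)" "ok (t2 # ?s)"
      using s'n t o a b by (auto simp: ok_Cons)
    have c1: "Cmp i i P P' (u1 # t1 # ?s) (u2 # t1 # ?s) (?\<alpha>1 \<lhd> (t1 # ?s)) (?\<beta>1 \<lhd> (t1 # ?s))"
      using Cmp_pull[OF s(3) P(1), of s'] s oS a by simp
    have c2: "Cmp i i P' P' (u2 # t1 # ?s) (u3 # t2 # ?s) ([w2] \<rhd> (\<rho>' \<lhd> ?s)) ([f2] \<rhd> (\<rho>' \<lhd> ?s))"
      by (rule Cmp_whisk[OF P(2)]) (use \<rho>' oS a in auto)
    note c12 = Cmp_vcomp[OF c1 c2 le_refl]
    have c3: "Cmp i i P P'' (u1 # t1 # ?s) (u4 # t2 # ?s)
      ([w3] \<rhd> (pcol [u4, t2] \<lhd> ?s) \<cdot> (Pcell [w1, u1 \<odot> t1] [w3, u4 \<odot> t2] \<alpha> \<lhd> ?s) \<cdot> [w1] \<rhd> (piv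
          (pcol [u1, t1]) \<lhd> ?s))
      ([f3] \<rhd> (pcol [u4, t2] \<lhd> ?s) \<cdot> (Pcell [f1, u1 \<odot> t1] [f3, u4 \<odot> t2] \<beta> \<lhd> ?s) \<cdot> [f1] \<rhd> (piv
          (pcol [u1, t1]) \<lhd> ?s))"
      by (rule Cmp_conj[OF P(1,3) s'(3)]) (use oS a b t in auto)
    \<comment> \<open>Undoes the collapse of \<open>[u1, t1]\<close> and \<open>[u4, t2]\<close> in
      the composite, so that the first factor can be split off.\<close>
    have sim: "[x'] \<rhd> (pcol [u4, t2] \<lhd> ?s) \<cdot> ([x'] \<rhd> piv (pcol [u4, t2]) \<cdot> c \<cdot> [x] \<rhd> pcol [u1, t1]) \<lhd> ?s \<cdot>
        [x] \<rhd> (piv (pcol [u1, t1]) \<lhd> ?s) = c \<lhd> ?s"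
      if "pwf c" "psrc c = x # [u1, t1]" "ptgt c = x' # [u4, t2]" for c x x'
      using that pwf_ok[OF that(1)] oS o by (simp del: append_assoc)
    have c4: "Cmp i i P P'' (u1 # t1 # ?s) (u4 # t2 # ?s) (A \<lhd> ?s) (B \<lhd> ?s)"
      using c3 unfolding rA using sim[OF piso_pwf[OF A(1)] A(2,3)] sim[OF B] by simp
    have c5: "Cmp i i P P'' (u1 # t1 # ?s) (u4 # t2 # ?s) (?\<alpha>2 \<lhd> (t2 # ?s) \<cdot> [w2] \<rhd> (\<rho>' \<lhd> ?s) \<cdot>
        ?\<alpha>1 \<lhd> (t1 # ?s))
        (?\<beta>2 \<lhd> (t2 # ?s) \<cdot> [f2] \<rhd> (\<rho>' \<lhd> ?s) \<cdot> ?\<beta>1 \<lhd> (t1 # ?s))"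
      using c4 by (simp add: A_def B_def)
    have iso: "piso ([w2] \<rhd> (\<rho>' \<lhd> ?s) \<cdot> ?\<alpha>1 \<lhd> (t1 # ?s))" using a \<rho>' oS by simp
    obtain g where g: "Wl g" "ok ((u3 # t2 # ?s) @ g)"
      "Cmp i i P' P'' ((u3 # t2 # ?s) @ g) ((u4 # t2 # ?s) @ g) (?\<alpha>2 \<lhd> (t2 # ?s) \<lhd> g) (?\<beta>2 \<lhd> (t2 # ?s) \<lhd> g)"
      by (rule Cmp_cancel[OF P _ _ _ _ _ _ c12 c5 iso]) (use oS a b that in auto)
    \<comment> \<open>Membership in \<open>W\<close> is known along the first factor and passes to
      the second through the invertible first component.\<close>
    have "Wl (w2 # u3 # t2 # ?s @ g)"
    proof -
      have lg: "src C (last s) = tgt C (hd s')" "src C (last ?s) = tgt C (hd g)"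
        using ok_append[of s s'] s'n sn Wl_nonempty[OF s'(1)] ok_append[of "u3 # t2 # ?s" g] g
            Wl_nonempty[OF g(1)] by auto
      have "Wl ?s" using Wl_appendL[OF s(1) s'(1)] lg by simp
      then have ws: "Wl (?s @ g)" using Wl_appendL[OF _ g(1), of ?s] lg by simp
      have hg: "tgt C (hd (?s @ g)) = D" using sn by simp
      have "Wl ([w1, u1, t1] @ ?s @ g)" using Wl_appendL[OF W1 ws] hg t by simp
      moreover have "piso (([w2] \<rhd> \<rho>' \<cdot> ?\<alpha>1 \<lhd> [t1]) \<lhd> (?s @ g))"
          "psrc (([w2] \<rhd> \<rho>' \<cdot> ?\<alpha>1 \<lhd> [t1]) \<lhd> (?s @ g)) = [w1, u1, t1] @ ?s @ g"
        "ptgt (([w2] \<rhd> \<rho>' \<cdot> ?\<alpha>1 \<lhd> [t1]) \<lhd> (?s @ g)) = [w2, u3, t2] @ ?s @ g"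
        using Wl_ok[OF calculation] \<rho>' a t by (simp_all del: prwhisk_pvcomp)
      ultimately have "Wl ([w2, u3, t2] @ ?s @ g)" using Wl_ptgt by metis
      then show ?thesis by simp
    qed
    with g(3) have "locCmp i i P' P'' (A2, w2, f2) (A3, w3, f3) (A5, u3, u4, \<alpha>2, \<beta>2)"
      by (auto intro!: exI[of _ "t2 # ?s @ g"])
    then show ?thesis using P f(2) unfolding canonical_def K K'' 1(2) by blast
  qed
qed

lemma canonical_fvcomp:
  assumes "canonical l r P P' K K' \<Gamma>" "canonical l r P' P'' K' K'' \<Delta>"
  shows "canonical l r P P'' K K'' (fvcomp \<Delta> \<Gamma>)"
proof -
  have "fvcomp_rel \<Gamma> \<Delta> (fvcomp \<Delta> \<Gamma>)"
    unfolding fvcomp_def using fvcomp_rel_exists[OF canonical_is_fcell canonical_is_fcell] assms someI_ex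
        by metis
  then show ?thesis using canonical_fvcomp_rel assms by blast
qed

text \<open>That \<open>\<Delta>\<close> is an inverse follows from uniqueness of canonical
  2-morphisms, the identities being canonical. Any other inverse is canonical by
  \<open>canonical_cancel\<close>, hence equal to \<open>\<Delta>\<close>.\<close>

lemma finv2_canonical:
  assumes "canonical i i P P' K K' \<Gamma>" "canonical i i P' P K' K \<Delta>"
    and "canonical i i P P K K (fid2 K)" "canonical i i P' P' K' K' (fid2 K')"
  shows "finv2 \<Gamma> = \<Delta>"
proof -
  have g: "fsrc \<Gamma> = K" "ftgt \<Gamma> = K'" using assms(1) by (auto simp: canonical_def fclass_def)
  show ?thesis unfolding finv2_def g
  proof (rule the_equality)
    show "is_fcell K' K \<Delta> \<and> fvcomp \<Delta> \<Gamma> = fid2 K \<and> fvcomp \<Gamma> \<Delta> = fid2 K'"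
      using canonical_is_fcell[OF assms(2)] canonical_unique[OF canonical_fvcomp[OF assms(1,2)] assms(3)]
        canonical_unique[OF canonical_fvcomp[OF assms(2,1)] assms(4)] by blast
  next
    fix \<Delta>' assume d: "is_fcell K' K \<Delta>' \<and> fvcomp \<Delta>' \<Gamma> = fid2 K \<and> fvcomp \<Gamma> \<Delta>' = fid2 K'"
    have "presents i i K P" using assms(1) by (simp add: canonical_def)
    then have "canonical i i P' P K' K \<Delta>'" using canonical_cancel[OF assms(1)] d assms(3) by metis
    then show "\<Delta>' = \<Delta>" using canonical_unique assms(2) by blast
  qed
qed

text \<open>The intermediate presentation glues the target of \<open>\<Gamma>\<close> with the
  source of \<open>\<Delta>\<close>; it is shared by the two whiskerings, so that they
  compose.\<close>

lemma canonical_fhcomp: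
  assumes \<Gamma>: "canonical l m P P' K K' \<Gamma>" and \<Delta>: "canonical (Suc m) r Q Q' G G' \<Delta>"
    and t: "is_fmor A B K" "is_fmor A B K'" "is_fmor B E G" "is_fmor B E G'"
  shows "canonical l r (glue_choice m K P G Q) (glue_choice m K' P' G' Q') (fcomp G K) (fcomp G' K')
      (fhcomp \<Delta> \<Gamma>)"
proof -
  have g: "fsrc \<Delta> = G" "ftgt \<Gamma> = K'" using \<Gamma> \<Delta> by (auto simp: canonical_def fclass_def)
  have P: "presents l m K' P'" "presents (Suc m) r G Q" using \<Gamma> \<Delta> by (auto simp: canonical_def)
  have "fwhisk_l_rel G \<Gamma> (fwhisk_l G \<Gamma>)"
    unfolding fwhisk_l_def using fwhisk_l_rel_exists[OF t(3,1,2) canonical_is_fcell[OF \<Gamma>]] someI_ex by metis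
  then have 1: "canonical l r (glue_choice m K P G Q) (glue_choice m K' P' G Q) (fcomp G K) (fcomp G K')
      (fwhisk_l G \<Gamma>)"
    using canonical_fwhisk_l_rel \<Gamma> P by blast
  have "fwhisk_r_rel \<Delta> K' (fwhisk_r \<Delta> K')"
    unfolding fwhisk_r_def using fwhisk_r_rel_exists[OF t(2,3,4) canonical_is_fcell[OF \<Delta>]] someI_ex by metis
  then have 2: "canonical l r (glue_choice m K' P' G Q) (glue_choice m K' P' G' Q') (fcomp G K') (fcomp G'
      K') (fwhisk_r \<Delta> K')"
    using canonical_fwhisk_r_rel \<Delta> P by blast
  show ?thesis unfolding fhcomp_def g using canonical_fvcomp[OF 1 2] .
qed

section \<open>The given spans, their primed versions, and the assembly of both sides\<close>

definition base_std :: "nat \<Rightarrow> ('m, 'c) presentation" where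
  "base_std i = base_pres (pid [U i]) (pid [F i])"

text \<open>The primed triple presented over the unprimed span: the right unitors identify its
  1-morphisms with \<open>U i\<close> and \<open>F i\<close>.\<close>

definition base_prime :: "nat \<Rightarrow> ('m, 'c) presentation" where
  "base_prime i = base_pres (Pcell [U i \<odot> id1 C (src C (U i))] [U i] (runit C (U i)))
     (Pcell [F i \<odot> id1 C (src C (U i))] [F i] (runit C (F i)))"

abbreviation base :: "nat \<Rightarrow> ('o, 'm) fmor" where
  "base i \<equiv> (src C (U i), U i, F i)"

lemma base_cells:
  "piso (Pcell [U i \<odot> id1 C (src C (U i))] [U i] (runit C (U i)))"
  "piso (Pcell [F i \<odot> id1 C (src C (U i))] [F i] (runit C (F i)))"
  using runit[of "src C (U i)" "tgt C (U i)" "U i"] runit[of "src C (U i)" "tgt C (F i)" "F i"]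
  by (auto simp: hom_def hom2_def piso_def pwf_def pcl_def)

lemma presents_base_std: "presents i i (base i) (base_std i)" "presents i i (prime (base i)) (base_prime i)"
  unfolding base_std_def base_prime_def prime.simps
  by (rule presents_base; use U_W BF1 base_cells W_comp[of "id1 C (src C (U i))" "U i"] in simp)+

text \<open>All instances of \<open>canonical_base\<close>. For \<open>chi\<close> the difference of
  the identifications is a right unitor, and for identities it is trivial; the last claim provides
  the candidate for the inverse of \<open>chi\<close>.\<close>

lemma canonical_chi:
  "canonical i i (base_prime i) (base_std i) (prime (base i)) (base i) (chi (base i))"
  "canonical i i (base_prime i) (base_prime i) (prime (base i)) (prime (base i)) (fid2 (prime (base i)))"
  "canonical i i (base_std i) (base_std i) (base i) (base i) (fid2 (base i))"
  "\<exists>\<Delta>. canonical i i (base_std i) (base_prime i) (base i) (prime (base i)) \<Delta>"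
proof -
  note p = presents_base_std[of i, unfolded base_std_def base_prime_def prime.simps]
  note c = base_cells[of i]
  have pw: "pval (Pcell [x \<odot> id1 C (src C (U i))] [x] \<alpha> \<lhd> [id1 C (src C (U i))]) =
      \<alpha> \<star> id2 C (id1 C (src C (U i)))"
    if "piso (Pcell [x \<odot> id1 C (src C (U i))] [x] \<alpha>)" "x \<in> Mor C" "src C x = src C (U i)" for x \<alpha>
    using that pwf_ok(7-9)[OF piso_pwf[OF that(1)]] by (simp add: pval_prwhisk rwhisk_def)
  have pp: "pval (pid [x] \<lhd> [id1 C (src C (U i))]) = id2 C (x \<odot> id1 C (src C (U i)))"
    if "x \<in> Mor C" "src C x = src C (U i)" for x
    using that by (subst prwhisk_pid) (simp_all, simp add: pid_def)
  show "canonical i i (base_prime i) (base_std i) (prime (base i)) (base i) (chi (base i))"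
    unfolding base_std_def base_prime_def prime.simps chi.simps
    by (rule canonical_base[OF p(2,1) refl]) (use c in \<open>simp_all add: pw piv_pid\<close>)
  show "canonical i i (base_prime i) (base_prime i) (prime (base i)) (prime (base i)) (fid2 (prime (base i)))"
    unfolding base_std_def base_prime_def prime.simps fid2.simps
    by (rule canonical_base[OF p(2,2) refl]) (use c pp[of "U i \<odot> id1 C (src C (U i))"] pp[of "F i \<odot> id1 C
        (src C (U i))"] in \<open>simp_all del: prwhisk_pvcomp prwhisk_pid\<close>)
  show "canonical i i (base_std i) (base_std i) (base i) (base i) (fid2 (base i))"
    unfolding base_std_def base_prime_def prime.simps fid2.simps
    by (rule canonical_base[OF p(1,1) refl]) (use pp[of "U i"] pp[of "F i"]
        in \<open>simp_all del: prwhisk_pvcomp prwhisk_pid\<close>)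
  show "\<exists>\<Delta>. canonical i i (base_std i) (base_prime i) (base i) (prime (base i)) \<Delta>"
    unfolding base_std_def base_prime_def prime.simps using canonical_base[OF p(1,2) refl refl refl] by blast
qed

lemma canonical_finv2_chi: "canonical i i (base_std i) (base_prime i) (base i) (prime (base i)) (finv2
    (chi (base i)))"
  using canonical_chi finv2_canonical by metis

lemma canonical_fassoc:
  assumes "presents l m K P" "presents (Suc m) n G Q" "presents (Suc n) r H R"
    "is_fmor A B K" "is_fmor B E G" "is_fmor E D H"
  shows "canonical l r (glue_choice n (fcomp G K) (glue_choice m K P G Q) H R) (glue_choice m K P (fcomp H
      G) (glue_choice n G Q H R))
    (fcomp H (fcomp G K)) (fcomp (fcomp H G) K) (fassoc H G K)"
proof -
  have "fassoc_rel H G K (fassoc H G K)"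
    unfolding fassoc_def using fassoc_rel_exists[OF assms(4-6)] someI_ex by metis
  then show ?thesis using canonical_fassoc_rel assms(1-3) by blast
qed

text \<open>Both sides run between the two gluings of the standard presentations, one for each
  bracketing. On the right-hand side the primed presentations occur only in between.\<close>

lemma associator_prime:
  assumes "is_fmor A B (base 0)" "is_fmor B E (base (Suc 0))" "is_fmor E D (base (Suc (Suc 0)))"
  defines "K \<equiv> base 0" and "G \<equiv> base (Suc 0)" and "H \<equiv> base (Suc (Suc 0))"
  shows "fassoc H G K = fvcomp (fhcomp (fhcomp (chi H) (chi G)) (chi K))
    (fvcomp (fassoc (prime H) (prime G) (prime K)) (fhcomp (finv2 (chi H)) (fhcomp (finv2 (chi G)) (finv2
        (chi K)))))"
proof -
  let ?K = "prime K" and ?G = "prime G" and ?H = "prime H"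
  note k = assms(1-3)[folded K_def G_def H_def]
  have k': "is_fmor A B ?K" "is_fmor B E ?G" "is_fmor E D ?H"
    unfolding K_def G_def H_def using assms(1-3) is_fmor_prime by blast+
  note p = presents_base_std[of 0, folded K_def] presents_base_std[of "Suc 0", folded G_def]
      presents_base_std[of "Suc (Suc 0)", folded H_def]
  note c = canonical_chi(1)[of 0, folded K_def] canonical_chi(1)[of "Suc 0", folded G_def]
      canonical_chi(1)[of "Suc (Suc 0)", folded H_def]
  note i = canonical_finv2_chi[of 0, folded K_def] canonical_finv2_chi[of "Suc 0", folded G_def]
      canonical_finv2_chi[of "Suc (Suc 0)", folded H_def]
  note co = is_fmor_fcomp[OF k(1,2)] is_fmor_fcomp[OF k(2,3)] is_fmor_fcomp[OF k'(1,2)] is_fmor_fcomp[OF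
      k'(2,3)]
  \<comment> \<open>\<open>1\<close>, \<open>2\<close> and \<open>3\<close> are the three factors.
    Each ends in the glued presentation where the next begins, so they compose as they
    stand.\<close>
  note 1 = canonical_fhcomp[OF canonical_fhcomp[OF i(1,2) k(1) k'(1) k(2) k'(2)] i(3) co(1,3) k(3) k'(3)]
  note 2 = canonical_fassoc[OF p(2,4,6) k']
  note 3 = canonical_fhcomp[OF c(1) canonical_fhcomp[OF c(2,3) k'(2) k(2) k'(3) k(3)] k'(1) k(1) co(4,2)]
  show ?thesis
    by (rule canonical_unique[OF canonical_fassoc[OF p(1,3,5) k] canonical_fvcomp[OF canonical_fvcomp[OF 1
        2] 3]])
qed

end

theorem corollary8p1:
  fixes C :: "('o, 'm, 'c) bicat"
    and W :: "'m set"
    and choice :: "'m \<Rightarrow> 'm \<Rightarrow> 'o \<times> 'm \<times> 'm \<times> 'c"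
    and A B E D A' B' E' :: 'o
    and u f v g w h :: 'm
  assumes "bicategory_of_fractions C W choice"
    and "bicategory_of_fractions.is_fmor C W A B (A', u, f)"
    and "bicategory_of_fractions.is_fmor C W B E (B', v, g)"
    and "bicategory_of_fractions.is_fmor C W E D (E', w, h)"
  shows
    "let vcomp = bicategory_of_fractions.fvcomp C W;
         hcomp = bicategory_of_fractions.fhcomp C W choice;
         inv = bicategory_of_fractions.finv2 C W;
         \<Theta> = bicategory_of_fractions.fassoc C W choice;
         \<chi> = bicategory_of_fractions.chi C W;
         F = (A', u, f); G = (B', v, g); H = (E', w, h);
         F' = (A', u \<odot>\<^bsub>C\<^esub> id1 C A', f \<odot>\<^bsub>C\<^esub> id1 C A');
         G' = (B', v \<odot>\<^bsub>C\<^esub> id1 C B', g \<odot>\<^bsub>C\<^esub> id1 C B');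
         H' = (E', w \<odot>\<^bsub>C\<^esub> id1 C E', h \<odot>\<^bsub>C\<^esub> id1 C E')
     in \<Theta> H G F =
          vcomp (hcomp (hcomp (\<chi> H) (\<chi> G)) (\<chi> F))
            (vcomp (\<Theta> H' G' F')
              (hcomp (inv (\<chi> H)) (hcomp (inv (\<chi> G)) (inv (\<chi> F)))))"
proof -
  interpret bicategory_of_fractions C W choice by fact
  note m = assms(2-4)
  have s: "u \<in> W" "v \<in> W" "w \<in> W" "f \<in> Mor C" "g \<in> Mor C" "h \<in> Mor C"
    "src C u = A'" "src C f = A'" "src C v = B'" "src C g = B'" "src C w = E'" "src C h = E'"
    using m by (auto simp: hom_def)
  \<comment> \<open>Only the indices 0, 1 and 2 occur; the third span is repeated beyond them so
    that the assumptions on the chain hold for every index.\<close>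
  define U where "U i = (if i = 0 then u else if i = Suc 0 then v else w)" for i :: nat
  define F where "F i = (if i = 0 then f else if i = Suc 0 then g else h)" for i :: nat
  interpret fraction_chain C W choice U F
    by unfold_locales (use s in \<open>auto simp: U_def F_def\<close>)
  have e: "base 0 = (A', u, f)" "base (Suc 0) = (B', v, g)" "base (Suc (Suc 0)) = (E', w, h)"
    using s by (simp_all add: U_def F_def)
  show ?thesis
    using associator_prime[unfolded e, OF m] by (simp only: Let_def prime.simps)
qed

end
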